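(* Let $C_\bullet$ be a complex of graded $R$-modules and let $i,j\in\mathbf{Z}$. Assume that the following condition holds: if $H^{i}_B(H_{j}(C_\bullet))\neq 0$, then $$H^{i+\ell +1}_B(H_{j+\ell}(C_\bullet))=0\quad\text{and}\quad H^{i-\ell -1}_B(H_{j-\ell }(C_\bullet))=0\quad\text{for all }\ell\geq 1 .$$ Then $$\mathrm{Supp}_G(H^i_B(H_j(C_\bullet)))\subset \bigcup_{k\in\mathbf{Z}}\mathrm{Supp}_G(H^{i+k}_B(C_{j+k})).$$
   Context: $G$ is a finitely generated abelian group, $R$ is a commutative $G$-graded ring with unit, and $B$ is a finitely generated homogeneous ideal of $R$. Complexes are indexed homologically (the differential lowers the index by one and is homogeneous of degree $0$) and need not be bounded. For an $R$-module $M$, $H^i_B(M)$ denotes the $i$-th cohomology of the Čech complex of $M$ on a finite set of homogeneous generators of $B$ (it is zero for $i<0$); it is graded when $M$ is. For a graded $R$-module $M$, $\mathrm{Supp}_G(M):=\{\gamma\in G: M_\gamma\neq 0\}$. *)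

theory Defs
  imports "HOL-Algebra.Module" "HOL-Algebra.Ideal" "HOL-Algebra.Generated_Groups"
begin

section \<open>Graded rings and graded modules\<close>

text \<open>
  The grading group is written multiplicatively, as usual in HOL-Algebra.  The rings and modules
  carry their family of homogeneous parts as an additional record field; only its values at
  indices in the carrier of the grading group are relevant.
\<close>

definition finitely_generated_group :: "('g, 'u) monoid_scheme \<Rightarrow> bool" where
  "finitely_generated_group G \<longleftrightarrow> (\<exists>S. finite S \<and> S \<subseteq> carrier G \<and> generate G S = carrier G)"

record ('g, 'a) graded_ring = "'a ring" +
  ring_part :: "'g \<Rightarrow> 'a set"

record ('g, 'a, 'b) graded_module = "('a, 'b) module" +
  mod_part :: "'g \<Rightarrow> 'b set"

definition internal_direct_sum :: "'g set \<Rightarrow> ('b, 'v) ring_scheme \<Rightarrow> ('g \<Rightarrow> 'b set) \<Rightarrow> bool" where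
  "internal_direct_sum I M P \<longleftrightarrow>
     (\<forall>\<gamma>\<in>I. additive_subgroup (P \<gamma>) M) \<and>
     (\<forall>x\<in>carrier M. \<exists>!c. c \<in> (\<Pi>\<^sub>E \<gamma>\<in>I. P \<gamma>) \<and> finite {\<gamma>\<in>I. c \<gamma> \<noteq> \<zero>\<^bsub>M\<^esub>} \<and>
        x = (\<Oplus>\<^bsub>M\<^esub>\<gamma>\<in>{\<gamma>\<in>I. c \<gamma> \<noteq> \<zero>\<^bsub>M\<^esub>}. c \<gamma>))"

locale graded_ring = G?: comm_group G + R?: cring R
  for G :: "('g, 'u) monoid_scheme" (structure)
  and R :: "('g, 'a, 'v) graded_ring_scheme" (structure) +
  assumes ring_direct_sum: "internal_direct_sum (carrier G) R (ring_part R)"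
    and ring_part_mult:
      "\<lbrakk>\<gamma> \<in> carrier G; \<delta> \<in> carrier G; r \<in> ring_part R \<gamma>; s \<in> ring_part R \<delta>\<rbrakk>
        \<Longrightarrow> r \<otimes>\<^bsub>R\<^esub> s \<in> ring_part R (\<gamma> \<otimes>\<^bsub>G\<^esub> \<delta>)"

locale graded_module = graded_ring G R + M?: module R M
  for G :: "('g, 'u) monoid_scheme" (structure)
  and R :: "('g, 'a, 'v) graded_ring_scheme" (structure)
  and M :: "('g, 'a, 'b, 'w) graded_module_scheme" (structure) +
  assumes mod_direct_sum: "internal_direct_sum (carrier G) M (mod_part M)"
    and mod_part_smult:
      "\<lbrakk>\<gamma> \<in> carrier G; \<delta> \<in> carrier G; r \<in> ring_part R \<gamma>; x \<in> mod_part M \<delta>\<rbrakk>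
        \<Longrightarrow> r \<odot>\<^bsub>M\<^esub> x \<in> mod_part M (\<gamma> \<otimes>\<^bsub>G\<^esub> \<delta>)"

definition Supp :: "('g, 'u) monoid_scheme \<Rightarrow> ('g, 'a, 'b, 'w) graded_module_scheme \<Rightarrow> 'g set" where
  "Supp G M = {\<gamma> \<in> carrier G. mod_part M \<gamma> \<noteq> {\<zero>\<^bsub>M\<^esub>}}"

definition zero_module :: "('a, 'b, 'w) module_scheme \<Rightarrow> bool" where
  "zero_module M \<longleftrightarrow> carrier M = {\<zero>\<^bsub>M\<^esub>}"

text \<open>
  A finite family \<open>fs\<close> of homogeneous generators of the ideal \<open>B\<close>.  Such a family exists exactly
  if \<open>B\<close> is a finitely generated homogeneous ideal.
\<close>

definition homogeneous_generators ::
    "('g, 'u) monoid_scheme \<Rightarrow> ('g, 'a, 'v) graded_ring_scheme \<Rightarrow> 'a set \<Rightarrow> 'a list \<Rightarrow> bool" where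
  "homogeneous_generators G R B fs \<longleftrightarrow>
     set fs \<subseteq> (\<Union>\<gamma>\<in>carrier G. ring_part R \<gamma>) \<and> B = Idl\<^bsub>R\<^esub> (set fs)"


section \<open>Complexes and homology\<close>

locale graded_complex = graded_ring G R
  for G :: "('g, 'u) monoid_scheme" (structure)
  and R :: "('g, 'a, 'v) graded_ring_scheme" (structure)
  and C :: "int \<Rightarrow> ('g, 'a, 'b) graded_module"
  and d :: "int \<Rightarrow> 'b \<Rightarrow> 'b" +
  assumes graded_module: "graded_module G R (C j)"
    and diff_hom: "d j \<in> hom (add_monoid (C j)) (add_monoid (C (j - 1)))"
    and diff_smult:
      "\<lbrakk>r \<in> carrier R; x \<in> carrier (C j)\<rbrakk> \<Longrightarrow> d j (r \<odot>\<^bsub>C j\<^esub> x) = r \<odot>\<^bsub>C (j - 1)\<^esub> d j x"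
    and diff_degree:
      "\<lbrakk>\<gamma> \<in> carrier G; x \<in> mod_part (C j) \<gamma>\<rbrakk> \<Longrightarrow> d j x \<in> mod_part (C (j - 1)) \<gamma>"
    and diff_diff: "x \<in> carrier (C j) \<Longrightarrow> d (j - 1) (d j x) = \<zero>\<^bsub>C (j - 2)\<^esub>"

text \<open>
  The subquotient \<open>Z / W\<close> of a graded module \<open>M\<close>, with the induced grading.  The ring
  multiplication and unit that the module record inherits have no meaning for a module.
\<close>

definition subquotient ::
    "('g, 'a, 'b) graded_module \<Rightarrow> 'b set \<Rightarrow> 'b set \<Rightarrow> ('g, 'a, 'b set) graded_module" where
  "subquotient M Z W =
     \<lparr>carrier = (\<lambda>z. W +>\<^bsub>M\<^esub> z) ` Z, mult = undefined, one = undefined,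
      zero = W, add = set_add M,
      smult = (\<lambda>r X. \<Union>x\<in>X. W +>\<^bsub>M\<^esub> (r \<odot>\<^bsub>M\<^esub> x)),
      mod_part = (\<lambda>\<gamma>. (\<lambda>z. W +>\<^bsub>M\<^esub> z) ` (Z \<inter> mod_part M \<gamma>))\<rparr>"

text \<open>The homology at \<open>M\<close> of \<open>L \<rightarrow> M \<rightarrow> N\<close>, the maps being \<open>f\<close> and \<open>g\<close>.\<close>

definition homology_at ::
    "('g, 'a, 'b) graded_module \<Rightarrow> ('g, 'a, 'b) graded_module \<Rightarrow> ('g, 'a, 'b) graded_module \<Rightarrow>
     ('b \<Rightarrow> 'b) \<Rightarrow> ('b \<Rightarrow> 'b) \<Rightarrow> ('g, 'a, 'b set) graded_module" where
  "homology_at L M N f g = subquotient M (a_kernel M N g) (f ` carrier L)"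

definition homology ::
    "(int \<Rightarrow> ('g, 'a, 'b) graded_module) \<Rightarrow> (int \<Rightarrow> 'b \<Rightarrow> 'b) \<Rightarrow> int
     \<Rightarrow> ('g, 'a, 'b set) graded_module" where
  "homology C d j = homology_at (C (j + 1)) (C j) (C (j - 1)) (d (j + 1)) (d j)"


section \<open>Localization at one element\<close>

text \<open>
  Elements of \<open>M\<^sub>f\<close> are classes of pairs \<open>(m, n)\<close>, standing for \<open>m / f\<^sup>n\<close>.
\<close>

definition loc_rel ::
    "('a, 'v) ring_scheme \<Rightarrow> ('a, 'b, 'w) module_scheme \<Rightarrow> 'a \<Rightarrow> (('b \<times> nat) \<times> ('b \<times> nat)) set" where
  "loc_rel R M f = {((m, n), (m', n')). m \<in> carrier M \<and> m' \<in> carrier M \<and>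
     (\<exists>k::nat. (f [^]\<^bsub>R\<^esub> (k + n')) \<odot>\<^bsub>M\<^esub> m = (f [^]\<^bsub>R\<^esub> (k + n)) \<odot>\<^bsub>M\<^esub> m')}"

definition loc_frac ::
    "('a, 'v) ring_scheme \<Rightarrow> ('a, 'b, 'w) module_scheme \<Rightarrow> 'a \<Rightarrow> 'b \<Rightarrow> nat \<Rightarrow> ('b \<times> nat) set" where
  "loc_frac R M f m n = loc_rel R M f `` {(m, n)}"

text \<open>
  The fraction \<open>m / f\<^sup>n\<close> has degree \<open>\<gamma>\<close> if \<open>f\<^sup>n\<close> has degree \<open>\<delta>\<close> and \<open>m\<close> has degree \<open>\<gamma> \<delta>\<close>.
  The degree of \<open>f\<^sup>n\<close> is ambiguous only if \<open>f\<^sup>n = 0\<close>, and then \<open>M\<^sub>f = 0\<close>.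
\<close>

definition localization ::
    "('g, 'u) monoid_scheme \<Rightarrow> ('g, 'a, 'v) graded_ring_scheme \<Rightarrow> ('g, 'a, 'b) graded_module \<Rightarrow> 'a
     \<Rightarrow> ('g, 'a, ('b \<times> nat) set) graded_module" where
  "localization G R M f =
     \<lparr>carrier = (carrier M \<times> UNIV) // loc_rel R M f, mult = undefined, one = undefined,
      zero = loc_frac R M f \<zero>\<^bsub>M\<^esub> 0,
      add = (\<lambda>X Y. \<Union>(m, n)\<in>X. \<Union>(m', n')\<in>Y.
               loc_frac R M f ((f [^]\<^bsub>R\<^esub> n') \<odot>\<^bsub>M\<^esub> m \<oplus>\<^bsub>M\<^esub> (f [^]\<^bsub>R\<^esub> n) \<odot>\<^bsub>M\<^esub> m') (n + n')),
      smult = (\<lambda>r X. \<Union>(m, n)\<in>X. loc_frac R M f (r \<odot>\<^bsub>M\<^esub> m) n),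
      mod_part = (\<lambda>\<gamma>. {loc_frac R M f m n | m n \<delta>. \<delta> \<in> carrier G \<and>
               f [^]\<^bsub>R\<^esub> n \<in> ring_part R \<delta> \<and> m \<in> mod_part M (\<gamma> \<otimes>\<^bsub>G\<^esub> \<delta>)})\<rparr>"

text \<open>The canonical map from \<open>M\<^sub>f\<close> to \<open>M\<^sub>h\<close> for \<open>h = f g\<close>, given by \<open>m / f\<^sup>n \<mapsto> g\<^sup>n m / h\<^sup>n\<close>.\<close>

definition loc_map ::
    "('a, 'v) ring_scheme \<Rightarrow> ('a, 'b, 'w) module_scheme \<Rightarrow> 'a \<Rightarrow> 'a
     \<Rightarrow> ('b \<times> nat) set \<Rightarrow> ('b \<times> nat) set" where
  "loc_map R M f g X = (\<Union>(m, n)\<in>X. loc_frac R M (f \<otimes>\<^bsub>R\<^esub> g) ((g [^]\<^bsub>R\<^esub> n) \<odot>\<^bsub>M\<^esub> m) n)"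


section \<open>Cech complex and local cohomology\<close>

text \<open>
  The term in cohomological degree \<open>p\<close> is the product of the localizations of \<open>M\<close> at
  \<open>f\<^sub>S = \<Prod>\<^bsub>k \<in> S\<^esub> f\<^sub>k\<close> over the sets \<open>S\<close> of \<open>p\<close> positions in the list \<open>fs\<close>.  For \<open>p = 0\<close> this is
  the localization at \<open>1\<close>, that is, \<open>M\<close> itself; for \<open>p\<close> negative or larger than the number of
  generators there is no such \<open>S\<close>, and the term is zero.
\<close>

definition cech_index :: "'a list \<Rightarrow> int \<Rightarrow> nat set set" where
  "cech_index fs p = {S. S \<subseteq> {..<length fs} \<and> int (card S) = p}"

definition cech_elem :: "('a, 'v) ring_scheme \<Rightarrow> 'a list \<Rightarrow> nat set \<Rightarrow> 'a" where
  "cech_elem R fs S = (\<Otimes>\<^bsub>R\<^esub>k\<in>S. fs ! k)"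

definition cech_loc ::
    "('g, 'u) monoid_scheme \<Rightarrow> ('g, 'a, 'v) graded_ring_scheme \<Rightarrow> 'a list
     \<Rightarrow> ('g, 'a, 'b) graded_module \<Rightarrow> nat set \<Rightarrow> ('g, 'a, ('b \<times> nat) set) graded_module" where
  "cech_loc G R fs M S = localization G R M (cech_elem R fs S)"

definition cech_term ::
    "('g, 'u) monoid_scheme \<Rightarrow> ('g, 'a, 'v) graded_ring_scheme \<Rightarrow> 'a list
     \<Rightarrow> ('g, 'a, 'b) graded_module \<Rightarrow> int \<Rightarrow> ('g, 'a, nat set \<Rightarrow> ('b \<times> nat) set) graded_module" where
  "cech_term G R fs M p =
     \<lparr>carrier = (\<Pi>\<^sub>E S\<in>cech_index fs p. carrier (cech_loc G R fs M S)),
      mult = undefined, one = undefined,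
      zero = (\<lambda>S\<in>cech_index fs p. \<zero>\<^bsub>cech_loc G R fs M S\<^esub>),
      add = (\<lambda>\<alpha> \<beta>. \<lambda>S\<in>cech_index fs p. \<alpha> S \<oplus>\<^bsub>cech_loc G R fs M S\<^esub> \<beta> S),
      smult = (\<lambda>r \<alpha>. \<lambda>S\<in>cech_index fs p. r \<odot>\<^bsub>cech_loc G R fs M S\<^esub> \<alpha> S),
      mod_part = (\<lambda>\<gamma>. \<Pi>\<^sub>E S\<in>cech_index fs p. mod_part (cech_loc G R fs M S) \<gamma>)\<rparr>"

definition cech_diff ::
    "('g, 'u) monoid_scheme \<Rightarrow> ('g, 'a, 'v) graded_ring_scheme \<Rightarrow> 'a list
     \<Rightarrow> ('g, 'a, 'b) graded_module \<Rightarrow> int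
     \<Rightarrow> (nat set \<Rightarrow> ('b \<times> nat) set) \<Rightarrow> (nat set \<Rightarrow> ('b \<times> nat) set)" where
  "cech_diff G R fs M p \<alpha> =
     (\<lambda>S\<in>cech_index fs (p + 1). \<Oplus>\<^bsub>cech_loc G R fs M S\<^esub>k\<in>S.
        (let x = loc_map R M (cech_elem R fs (S - {k})) (fs ! k) (\<alpha> (S - {k}))
         in if even (card {l \<in> S. l < k}) then x else \<ominus>\<^bsub>cech_loc G R fs M S\<^esub> x))"

definition local_cohomology ::
    "('g, 'u) monoid_scheme \<Rightarrow> ('g, 'a, 'v) graded_ring_scheme \<Rightarrow> 'a list \<Rightarrow> int
     \<Rightarrow> ('g, 'a, 'b) graded_module \<Rightarrow> ('g, 'a, (nat set \<Rightarrow> ('b \<times> nat) set) set) graded_module" where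
  "local_cohomology G R fs i M =
     homology_at (cech_term G R fs M (i - 1)) (cech_term G R fs M i) (cech_term G R fs M (i + 1))
       (cech_diff G R fs M (i - 1)) (cech_diff G R fs M i)"

end

theory Submission
  imports Defs
begin

text \<open>
  Let \<open>\<gamma>\<close> be a degree in which all \<open>H\<^sup>i\<^sup>+\<^sup>k\<^sub>B(C\<^sub>j\<^sub>+\<^sub>k)\<close> vanish.  The parts of degree \<open>\<gamma>\<close> of the
  Cech cochains of degree \<open>p\<close> with values in \<open>C\<^sub>q\<close> form a double complex, with the Cech differential
  \<open>\<delta>\<close> raising \<open>p\<close> and the differential \<open>D\<close> of the complex lowering \<open>q\<close>.  It is zero
  unless \<open>p\<close> is between \<open>0\<close> and the number of generators, so that both of its spectral sequences
  converge, although the complex need not be bounded.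

  The spectral sequence that starts with the \<open>\<delta>\<close>-homology has \<open>H\<^sup>p\<^sub>B(C\<^sub>q)\<^sub>\<gamma>\<close> on its first page.  By the
  choice of \<open>\<gamma>\<close> these groups vanish on the diagonal \<open>p - q = i - j\<close>, and with them the total homology
  there.  Localization is exact, so the spectral sequence that starts with the \<open>D\<close>-homology has
  \<open>H\<^sup>p\<^sub>B(H\<^sub>q(C))\<^sub>\<gamma>\<close> on its second page.  If \<open>H\<^sup>i\<^sub>B(H\<^sub>j(C))\<close> is not zero, then by assumption every
  differential from the second page on that leaves or enters the position \<open>(i, j)\<close> has target or
  source zero.  So \<open>H\<^sup>i\<^sub>B(H\<^sub>j(C))\<^sub>\<gamma>\<close> survives to the limit, which is zero.

  The proof below spells this out with elements: \<open>E2_zero_if_isolated\<close> is the comparison of the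
  two spectral sequences at one position.  The lemmas \<open>row_exact_if_not_in_Supp\<close>,
  \<open>E2_zero_if_zero_module\<close> and \<open>not_in_Supp_if_E2_zero\<close> translate between its terms and local
  cohomology.  They rest on two properties of the Cech complex.  It is exact as a functor of the
  module (\<open>cech_fun_exact\<close>), and for a graded module it has additive projections to its
  homogeneous parts that commute with all maps in sight (\<open>cech_proj_diff\<close>, \<open>cech_functor_proj\<close>),
  by which every equation between cochains can be replaced by its component of degree \<open>\<gamma>\<close>.
\<close>


section \<open>A diagram chase in a double complex\<close>

lemma additive_mapI:
  assumes "abelian_group M" "abelian_group N"
    and "\<And>x. x \<in> carrier M \<Longrightarrow> h x \<in> carrier N"
    and "\<And>x y. x \<in> carrier M \<Longrightarrow> y \<in> carrier M \<Longrightarrow> h (x \<oplus>\<^bsub>M\<^esub> y) = h x \<oplus>\<^bsub>N\<^esub> h y"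
  shows "abelian_group_hom M N h"
  using assms
  by (intro abelian_group_homI)
    (auto simp: group_hom_def group_hom_axioms_def hom_def abelian_group.a_group)

lemma (in abelian_group_hom) hom_minus:
  assumes "x \<in> carrier G" "y \<in> carrier G"
  shows "h (x \<ominus>\<^bsub>G\<^esub> y) = h x \<ominus>\<^bsub>H\<^esub> h y"
  using assms by (simp add: a_minus_def)

lemma (in abelian_group) minus_eq_zero_iff:
  assumes "x \<in> carrier G" "y \<in> carrier G"
  shows "x \<ominus> y = \<zero> \<longleftrightarrow> x = y"
  using assms by (metis a_minus_def add.inv_closed minus_equality r_neg minus_minus)

text \<open>
  The first index is confined to a strip; this is what makes the two inductions below end, without
  any bound on the second index.
\<close>

locale double_complex =
  fixes A :: "int \<Rightarrow> int \<Rightarrow> ('x, 'y) ring_scheme"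
    and \<delta> D :: "int \<Rightarrow> int \<Rightarrow> 'x \<Rightarrow> 'x"
    and n :: int
  assumes \<delta>_hom: "abelian_group_hom (A p q) (A (p + 1) q) (\<delta> p q)"
    and D_hom: "abelian_group_hom (A p q) (A p (q - 1)) (D p q)"
    and \<delta>_\<delta>: "x \<in> carrier (A p q) \<Longrightarrow> \<delta> (p + 1) q (\<delta> p q x) = \<zero>\<^bsub>A (p + 2) q\<^esub>"
    and D_D: "x \<in> carrier (A p q) \<Longrightarrow> D p (q - 1) (D p q x) = \<zero>\<^bsub>A p (q - 2)\<^esub>"
    and commute: "x \<in> carrier (A p q) \<Longrightarrow> D (p + 1) q (\<delta> p q x) = \<delta> p (q - 1) (D p q x)"
    and bounded: "p < 0 \<or> n < p \<Longrightarrow> carrier (A p q) = {\<zero>\<^bsub>A p q\<^esub>}"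
begin

definition row_exact :: "int \<Rightarrow> int \<Rightarrow> bool" where
  "row_exact p q \<longleftrightarrow>
     (\<forall>x\<in>carrier (A p q). \<delta> p q x = \<zero>\<^bsub>A (p + 1) q\<^esub> \<longrightarrow> (\<exists>w\<in>carrier (A (p - 1) q). \<delta> (p - 1) q w = x))"

text \<open>
  A class of the second page of the spectral sequence that starts with the \<open>D\<close>-homology is given
  by a \<open>D\<close>-cycle \<open>x\<close> such that \<open>\<delta> x\<close> is a \<open>D\<close>-boundary.  It is zero if \<open>x\<close> is, up to a
  \<open>D\<close>-boundary, the image under \<open>\<delta>\<close> of a \<open>D\<close>-cycle.
\<close>

definition E2_zero :: "int \<Rightarrow> int \<Rightarrow> bool" where
  "E2_zero p q \<longleftrightarrow>
     (\<forall>x\<in>carrier (A p q). \<forall>y\<in>carrier (A (p + 1) (q + 1)).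
        D p q x = \<zero>\<^bsub>A p (q - 1)\<^esub> \<and> \<delta> p q x = D (p + 1) (q + 1) y \<longrightarrow>
        (\<exists>w\<in>carrier (A p (q + 1)). \<exists>z\<in>carrier (A (p - 1) q).
           D (p - 1) q z = \<zero>\<^bsub>A (p - 1) (q - 1)\<^esub> \<and>
           x = D p (q + 1) w \<oplus>\<^bsub>A p q\<^esub> \<delta> (p - 1) q z))"

lemma E2_zeroE:
  assumes "E2_zero p q" "x \<in> carrier (A p q)" "y \<in> carrier (A (p + 1) (q + 1))"
    and "D p q x = \<zero>\<^bsub>A p (q - 1)\<^esub>" "\<delta> p q x = D (p + 1) (q + 1) y"
  obtains w z where "w \<in> carrier (A p (q + 1))" "z \<in> carrier (A (p - 1) q)"
    "D (p - 1) q z = \<zero>\<^bsub>A (p - 1) (q - 1)\<^esub>"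
    "x = D p (q + 1) w \<oplus>\<^bsub>A p q\<^esub> \<delta> (p - 1) q z"
  using assms unfolding E2_zero_def by blast

lemma \<delta>_from:
  "abelian_group_hom (A (p - 1) q) (A p q) (\<delta> (p - 1) q)"
  using \<delta>_hom[of "p - 1" q] by simp

lemma D_from:
  "abelian_group_hom (A p (q + 1)) (A p q) (D p (q + 1))"
  using D_hom[of p "q + 1"] by simp

lemma \<delta>_\<delta>_from: "x \<in> carrier (A (p - 1) q) \<Longrightarrow> \<delta> p q (\<delta> (p - 1) q x) = \<zero>\<^bsub>A (p + 1) q\<^esub>"
  using \<delta>_\<delta>[of x "p - 1" q] by (simp add: algebra_simps)

lemma D_D_from: "x \<in> carrier (A p (q + 1)) \<Longrightarrow> D p q (D p (q + 1) x) = \<zero>\<^bsub>A p (q - 1)\<^esub>"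
  using D_D[of x p "q + 1"] by (simp add: algebra_simps)

text \<open>
  The differentials leaving \<open>(p, q)\<close> on the later pages have targets where the second page
  vanishes, so a relation \<open>\<delta> y = D u\<close> extends step by step to a zigzag that ends at the right edge of
  the strip.  From there back to \<open>(p, q)\<close>, the exact rows write its members in the form \<open>D w + \<delta> z\<close>.
  The induction runs from the right edge.
\<close>

lemma total_boundary:
  assumes rows: "\<And>l. l \<ge> 0 \<Longrightarrow> row_exact (p + l) (q + l)"
    and targets: "\<And>l. l \<ge> 0 \<Longrightarrow> E2_zero (p + l + 2) (q + l + 1)"
    and y: "y \<in> carrier (A p q)" and u: "u \<in> carrier (A (p + 1) (q + 1))"
    and yu: "\<delta> p q y = D (p + 1) (q + 1) u"
  shows "\<exists>w\<in>carrier (A p (q + 1)). \<exists>z\<in>carrier (A (p - 1) q).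
           y = D p (q + 1) w \<oplus>\<^bsub>A p q\<^esub> \<delta> (p - 1) q z"
  using assms
proof (induction "nat (n + 1 - p)" arbitrary: p q y u)
  case 0
  interpret d: abelian_group_hom "A (p - 1) q" "A p q" "\<delta> (p - 1) q" by (rule \<delta>_from)
  interpret D: abelian_group_hom "A p (q + 1)" "A p q" "D p (q + 1)" by (rule D_from)
  have "y = \<zero>\<^bsub>A p q\<^esub>" using bounded[of p q] 0 by auto
  then show ?case
    by (intro bexI[of _ "\<zero>\<^bsub>A p (q + 1)\<^esub>"] bexI[of _ "\<zero>\<^bsub>A (p - 1) q\<^esub>"]) auto
next
  case (Suc k)
  note y = \<open>y \<in> carrier (A p q)\<close> and u = \<open>u \<in> carrier (A (p + 1) (q + 1))\<close>
  interpret d0: abelian_group_hom "A p q" "A (p + 1) q" "\<delta> p q" by (rule \<delta>_hom)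
  interpret D1: abelian_group_hom "A (p + 1) (q + 1)" "A (p + 1) q" "D (p + 1) (q + 1)"
    by (rule D_from)
  interpret D0: abelian_group_hom "A p (q + 1)" "A p q" "D p (q + 1)" by (rule D_from)
  interpret d1: abelian_group_hom "A (p + 1) (q + 1)" "A (p + 2) (q + 1)" "\<delta> (p + 1) (q + 1)"
    using \<delta>_hom[of "p + 1" "q + 1"] by (simp add: algebra_simps)
  interpret d2: abelian_group_hom "A (p + 2) (q + 1)" "A (p + 3) (q + 1)" "\<delta> (p + 2) (q + 1)"
    using \<delta>_hom[of "p + 2" "q + 1"] by (simp add: algebra_simps)
  interpret D2: abelian_group_hom "A (p + 2) (q + 2)" "A (p + 2) (q + 1)" "D (p + 2) (q + 2)"
    using D_from[of "p + 2" "q + 1"] by (simp add: algebra_simps)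
  interpret D3: abelian_group_hom "A (p + 3) (q + 2)" "A (p + 3) (q + 1)" "D (p + 3) (q + 2)"
    using D_from[of "p + 3" "q + 1"] by (simp add: algebra_simps)
  interpret E: abelian_group_hom "A p (q + 1)" "A (p + 1) (q + 1)" "\<delta> p (q + 1)"
    by (rule \<delta>_hom)
  have "E2_zero (p + 2) (q + 1)" using Suc.prems(2)[of 0] by simp
  moreover have "D (p + 2) (q + 1) (\<delta> (p + 1) (q + 1) u) = \<zero>\<^bsub>A (p + 2) q\<^esub>"
    using commute[of u "p + 1" "q + 1"] u Suc.prems(5) \<delta>_\<delta>[of y p q] y
    by (simp add: algebra_simps)
  moreover have "\<delta> (p + 2) (q + 1) (\<delta> (p + 1) (q + 1) u) = D (p + 3) (q + 2) \<zero>\<^bsub>A (p + 3) (q + 2)\<^esub>"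
    using \<delta>_\<delta>[of u "p + 1" "q + 1"] u by (simp add: algebra_simps)
  ultimately obtain w z where w: "w \<in> carrier (A (p + 2) (q + 2))"
    and z: "z \<in> carrier (A (p + 1) (q + 1))" and Dz: "D (p + 1) (q + 1) z = \<zero>\<^bsub>A (p + 1) q\<^esub>"
    and wz: "\<delta> (p + 1) (q + 1) u =
      D (p + 2) (q + 2) w \<oplus>\<^bsub>A (p + 2) (q + 1)\<^esub> \<delta> (p + 1) (q + 1) z"
    using E2_zeroE[of "p + 2" "q + 1" "\<delta> (p + 1) (q + 1) u" "\<zero>\<^bsub>A (p + 3) (q + 2)\<^esub>"]
      d1.hom_closed[OF u] D3.zero_closed
    by (auto simp: algebra_simps)
  \<comment> \<open>Correcting \<open>u\<close> by the \<open>D\<close>-cycle \<open>z\<close> does not change \<open>D u\<close> and lets the zigzag continue.\<close>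
  define u' where "u' = u \<ominus>\<^bsub>A (p + 1) (q + 1)\<^esub> z"
  have u': "u' \<in> carrier (A (p + 1) (q + 1))" using u z by (simp add: u'_def)
  have Du': "D (p + 1) (q + 1) u' = \<delta> p q y"
    using D1.hom_minus[OF u z] Dz Suc.prems(5) u by (simp add: u'_def a_minus_def)
  have "\<delta> (p + 1) (q + 1) u' = D (p + 2) (q + 2) w"
    using d1.hom_minus[OF u z] wz w z by (simp add: u'_def a_minus_def d1.H.a_assoc d1.H.r_neg)
  then have "\<exists>w'\<in>carrier (A (p + 1) (q + 1 + 1)). \<exists>z'\<in>carrier (A (p + 1 - 1) (q + 1)).
      u' = D (p + 1) (q + 1 + 1) w' \<oplus>\<^bsub>A (p + 1) (q + 1)\<^esub> \<delta> (p + 1 - 1) (q + 1) z'"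
    using Suc.hyps(2) Suc.prems(1)[of "l + 1" for l] Suc.prems(2)[of "l + 1" for l] u' w
    by (intro Suc.hyps(1)[of "p + 1" "q + 1" u' w]) (simp_all add: algebra_simps)
  then obtain w' z' where w': "w' \<in> carrier (A (p + 1) (q + 2))" and z': "z' \<in> carrier (A p (q + 1))"
    and uwz: "u' = D (p + 1) (q + 2) w' \<oplus>\<^bsub>A (p + 1) (q + 1)\<^esub> \<delta> p (q + 1) z'"
    by (auto simp: algebra_simps)
  interpret F: abelian_group_hom "A (p + 1) (q + 2)" "A (p + 1) (q + 1)" "D (p + 1) (q + 2)"
    using D_from[of "p + 1" "q + 1"] by (simp add: algebra_simps)
  have "\<delta> p q y = \<delta> p q (D p (q + 1) z')"
  proof -
    have "D (p + 1) (q + 1) (D (p + 1) (q + 2) w') = \<zero>\<^bsub>A (p + 1) q\<^esub>"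
      using D_D_from[of w' "p + 1" "q + 1"] w' by (simp add: algebra_simps)
    moreover have "D (p + 1) (q + 1) (\<delta> p (q + 1) z') = \<delta> p q (D p (q + 1) z')"
      using commute[OF z'] by simp
    ultimately show ?thesis using Du' uwz w' z' by simp
  qed
  then have "\<delta> p q (y \<ominus>\<^bsub>A p q\<^esub> D p (q + 1) z') = \<zero>\<^bsub>A (p + 1) q\<^esub>"
    using d0.hom_minus[OF y D0.hom_closed[OF z']] d0.hom_closed[OF D0.hom_closed[OF z']]
    by (simp add: a_minus_def d0.H.r_neg)
  moreover have "row_exact p q" using Suc.prems(1)[of 0] by simp
  moreover have "y \<ominus>\<^bsub>A p q\<^esub> D p (q + 1) z' \<in> carrier (A p q)" using y z' by simp
  ultimately obtain z'' where z'': "z'' \<in> carrier (A (p - 1) q)"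
      "\<delta> (p - 1) q z'' = y \<ominus>\<^bsub>A p q\<^esub> D p (q + 1) z'"
    unfolding row_exact_def by blast
  have "y = D p (q + 1) z' \<oplus>\<^bsub>A p q\<^esub> \<delta> (p - 1) q z''"
    using y z''(2) D0.hom_closed[OF z']
      d0.G.a_lcomm[of "D p (q + 1) z'" y "\<ominus>\<^bsub>A p q\<^esub> D p (q + 1) z'"]
    by (simp add: a_minus_def d0.G.r_neg)
  then show ?case using z' z'' by blast
qed

text \<open>
  Dually, the differentials entering \<open>(p + 1, q)\<close> on the later pages have sources where the second
  page vanishes.  So the equation \<open>D w = \<delta> v\<close> provided by the exact rows can be solved with \<open>D v = 0\<close>,
  and \<open>w\<close> can be corrected to a \<open>D\<close>-cycle without a change of \<open>\<delta> w\<close>.  The induction runs from the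
  left edge.
\<close>

lemma correct_to_cycle:
  assumes rows: "\<And>l. l \<ge> 0 \<Longrightarrow> row_exact (p - l) (q - l - 1)"
    and sources: "\<And>l. l \<ge> 0 \<Longrightarrow> E2_zero (p - l - 1) (q - l - 1)"
    and w: "w \<in> carrier (A p q)"
    and \<delta>Dw: "\<delta> p (q - 1) (D p q w) = \<zero>\<^bsub>A (p + 1) (q - 1)\<^esub>"
  shows "\<exists>w'\<in>carrier (A p q). D p q w' = \<zero>\<^bsub>A p (q - 1)\<^esub> \<and> \<delta> p q w' = \<delta> p q w"
  using assms
proof (induction "nat (p + 1)" arbitrary: p q w)
  case 0
  interpret D: abelian_group_hom "A p q" "A p (q - 1)" "D p q" by (rule D_hom)
  have "w = \<zero>\<^bsub>A p q\<^esub>" using bounded[of p q] 0 by auto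
  then show ?case using D.hom_zero D.G.zero_closed by metis
next
  case (Suc k)
  note w = \<open>w \<in> carrier (A p q)\<close>
  interpret D0: abelian_group_hom "A p q" "A p (q - 1)" "D p q" by (rule D_hom)
  interpret d0: abelian_group_hom "A p q" "A (p + 1) q" "\<delta> p q" by (rule \<delta>_hom)
  interpret d1: abelian_group_hom "A (p - 1) (q - 1)" "A p (q - 1)" "\<delta> (p - 1) (q - 1)"
    by (rule \<delta>_from)
  interpret d2: abelian_group_hom "A (p - 1) q" "A p q" "\<delta> (p - 1) q" by (rule \<delta>_from)
  interpret D1: abelian_group_hom "A (p - 1) q" "A (p - 1) (q - 1)" "D (p - 1) q" by (rule D_hom)
  interpret d3: abelian_group_hom "A (p - 2) (q - 1)" "A (p - 1) (q - 1)" "\<delta> (p - 2) (q - 1)"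
    using \<delta>_from[of "p - 1" "q - 1"] by (simp add: algebra_simps)
  obtain v where v: "v \<in> carrier (A (p - 1) (q - 1))" "\<delta> (p - 1) (q - 1) v = D p q w"
    using Suc.prems(1)[of 0] Suc.prems(4) w unfolding row_exact_def by auto
  have "\<delta> (p - 1) (q - 2) (D (p - 1) (q - 1) v) = D p (q - 1) (\<delta> (p - 1) (q - 1) v)"
    using commute[of v "p - 1" "q - 1"] v by (simp add: algebra_simps)
  also have "\<dots> = \<zero>\<^bsub>A p (q - 2)\<^esub>" using v D_D w by simp
  finally have "\<exists>v'\<in>carrier (A (p - 1) (q - 1)). D (p - 1) (q - 1) v' = \<zero>\<^bsub>A (p - 1) (q - 1 - 1)\<^esub> \<and>
      \<delta> (p - 1) (q - 1) v' = \<delta> (p - 1) (q - 1) v"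
    using Suc.hyps(2) Suc.prems(1)[of "l + 1" for l] Suc.prems(2)[of "l + 1" for l] v
    by (intro Suc.hyps(1)[of "p - 1" "q - 1" v]) (simp_all add: algebra_simps)
  then obtain v' where v': "v' \<in> carrier (A (p - 1) (q - 1))"
      "D (p - 1) (q - 1) v' = \<zero>\<^bsub>A (p - 1) (q - 2)\<^esub>" "\<delta> (p - 1) (q - 1) v' = D p q w"
    using v by (auto simp: algebra_simps)
  have "E2_zero (p - 1) (q - 1)" using Suc.prems(2)[of 0] by simp
  then obtain s t where s: "s \<in> carrier (A (p - 1) q)" and t: "t \<in> carrier (A (p - 2) (q - 1))"
    and vst: "v' = D (p - 1) q s \<oplus>\<^bsub>A (p - 1) (q - 1)\<^esub> \<delta> (p - 2) (q - 1) t"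
    unfolding E2_zero_def using v' w by (auto simp: algebra_simps)
  have \<delta>\<delta>t: "\<delta> (p - 1) (q - 1) (\<delta> (p - 2) (q - 1) t) = \<zero>\<^bsub>A p (q - 1)\<^esub>"
    using \<delta>_\<delta>_from[of t "p - 1" "q - 1"] t by (simp add: algebra_simps)
  have "D p q w = \<delta> (p - 1) (q - 1) (D (p - 1) q s)"
    using v'(3) vst s t \<delta>\<delta>t by (metis D1.hom_closed d0.abelian_group_hom_axioms D0.H.r_zero d1.hom_add d1.hom_closed d3.hom_closed)
  also have "\<dots> = D p q (\<delta> (p - 1) q s)"
    using commute[of s "p - 1" q] s by simp
  finally have "D p q (w \<ominus>\<^bsub>A p q\<^esub> \<delta> (p - 1) q s) = \<zero>\<^bsub>A p (q - 1)\<^esub>"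
    using D0.hom_minus[OF w d2.hom_closed[OF s]] D0.hom_closed[OF d2.hom_closed[OF s]]
    by (simp add: a_minus_def D0.H.r_neg)
  moreover have "\<delta> p q (w \<ominus>\<^bsub>A p q\<^esub> \<delta> (p - 1) q s) = \<delta> p q w"
    using d0.hom_minus[OF w d2.hom_closed[OF s]] d0.hom_closed[OF w] \<delta>_\<delta>_from[OF s] by (simp add: a_minus_def)
  ultimately show ?case using D0.G.minus_closed[OF w d2.hom_closed[OF s]] by blast
qed

text \<open>
  Exact rows kill the total homology of a bounded strip, and no differential of the later pages
  enters or leaves \<open>(i, j)\<close>; so the second page vanishes there.
\<close>

theorem E2_zero_if_isolated:
  assumes rows: "\<And>k. row_exact (i + k) (j + k)"
    and targets: "\<And>l. l \<ge> 1 \<Longrightarrow> E2_zero (i + l + 1) (j + l)"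
    and sources: "\<And>l. l \<ge> 1 \<Longrightarrow> E2_zero (i - l - 1) (j - l)"
  shows "E2_zero i j"
  unfolding E2_zero_def
proof (intro ballI impI, elim conjE)
  fix x y
  assume x: "x \<in> carrier (A i j)" and y: "y \<in> carrier (A (i + 1) (j + 1))"
    and Dx: "D i j x = \<zero>\<^bsub>A i (j - 1)\<^esub>" and xy: "\<delta> i j x = D (i + 1) (j + 1) y"
  interpret D0: abelian_group_hom "A i j" "A i (j - 1)" "D i j" by (rule D_hom)
  interpret D1: abelian_group_hom "A i (j + 1)" "A i j" "D i (j + 1)" by (rule D_from)
  interpret d0: abelian_group_hom "A (i - 1) j" "A i j" "\<delta> (i - 1) j" by (rule \<delta>_from)
  obtain w z where w: "w \<in> carrier (A i (j + 1))" and z: "z \<in> carrier (A (i - 1) j)"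
    and wz: "x = D i (j + 1) w \<oplus>\<^bsub>A i j\<^esub> \<delta> (i - 1) j z"
    using total_boundary[of i j x y] rows targets[of "l + 1" for l] x y xy
    by (auto simp: algebra_simps)
  have "\<delta> (i - 1) (j - 1) (D (i - 1) j z) = D i j (\<delta> (i - 1) j z)"
    using commute[of z "i - 1" j] z by simp
  also have "\<dots> = \<zero>\<^bsub>A i (j - 1)\<^esub>"
    using Dx wz D_D_from[OF w] w z by simp
  finally obtain z' where "z' \<in> carrier (A (i - 1) j)" "D (i - 1) j z' = \<zero>\<^bsub>A (i - 1) (j - 1)\<^esub>"
      "\<delta> (i - 1) j z' = \<delta> (i - 1) j z"
    using correct_to_cycle[of "i - 1" j z] rows[of "- l - 1" for l] sources[of "l + 1" for l] z
    by (auto simp: algebra_simps)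
  then show "\<exists>w\<in>carrier (A i (j + 1)). \<exists>z\<in>carrier (A (i - 1) j).
      D (i - 1) j z = \<zero>\<^bsub>A (i - 1) (j - 1)\<^esub> \<and> x = D i (j + 1) w \<oplus>\<^bsub>A i j\<^esub> \<delta> (i - 1) j z"
    using w wz by metis
qed

end


section \<open>Homogeneous components\<close>

definition homogeneous_part ::
    "'g set \<Rightarrow> ('b, 'v) ring_scheme \<Rightarrow> ('g \<Rightarrow> 'b set) \<Rightarrow> 'g \<Rightarrow> 'b \<Rightarrow> 'b" where
  "homogeneous_part I M P \<gamma> x =
     (THE c. c \<in> (\<Pi>\<^sub>E \<gamma>\<in>I. P \<gamma>) \<and> finite {\<gamma>\<in>I. c \<gamma> \<noteq> \<zero>\<^bsub>M\<^esub>} \<and>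
        x = (\<Oplus>\<^bsub>M\<^esub>\<gamma>\<in>{\<gamma>\<in>I. c \<gamma> \<noteq> \<zero>\<^bsub>M\<^esub>}. c \<gamma>)) \<gamma>"

locale direct_sum = abelian_group M for M :: "('b, 'v) ring_scheme" (structure) +
  fixes I :: "'g set" and P :: "'g \<Rightarrow> 'b set"
  assumes decomposition: "internal_direct_sum I M P"
begin

abbreviation part :: "'g \<Rightarrow> 'b \<Rightarrow> 'b" where
  "part \<equiv> homogeneous_part I M P"

lemma subgroup_part: "\<gamma> \<in> I \<Longrightarrow> additive_subgroup (P \<gamma>) M"
  using decomposition by (simp add: internal_direct_sum_def)

lemma P_closed: "\<gamma> \<in> I \<Longrightarrow> x \<in> P \<gamma> \<Longrightarrow> x \<in> carrier M"
  using subgroup_part additive_subgroup.a_subset by blast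

lemma P_zero: "\<gamma> \<in> I \<Longrightarrow> \<zero> \<in> P \<gamma>"
  by (simp add: additive_subgroup.zero_closed subgroup_part)

lemma P_add: "\<gamma> \<in> I \<Longrightarrow> x \<in> P \<gamma> \<Longrightarrow> y \<in> P \<gamma> \<Longrightarrow> x \<oplus> y \<in> P \<gamma>"
  by (simp add: additive_subgroup.a_closed subgroup_part)

text \<open>
  By uniqueness of the decomposition: the family \<open>c\<close>, extended by zero, is the one that defines the
  components.
\<close>

lemma part_sum:
  assumes "finite F" "F \<subseteq> I" and c: "\<And>\<gamma>. \<gamma> \<in> F \<Longrightarrow> c \<gamma> \<in> P \<gamma>" and "\<gamma> \<in> I"
  shows "part \<gamma> (\<Oplus>\<^bsub>M\<^esub>\<gamma>\<in>F. c \<gamma>) = (if \<gamma> \<in> F then c \<gamma> else \<zero>)"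
proof -
  define c' where "c' = (\<lambda>\<gamma>\<in>I. if \<gamma> \<in> F then c \<gamma> else \<zero>)"
  have cM: "c \<gamma> \<in> carrier M" if "\<gamma> \<in> F" for \<gamma> using that assms P_closed by blast
  have c': "c' \<in> (\<Pi>\<^sub>E \<gamma>\<in>I. P \<gamma>)" using c P_zero by (auto simp: c'_def)
  have fin: "finite {\<gamma>\<in>I. c' \<gamma> \<noteq> \<zero>}"
    by (rule finite_subset[OF _ \<open>finite F\<close>]) (auto simp: c'_def)
  define x where "x = (\<Oplus>\<^bsub>M\<^esub>\<gamma>\<in>F. c \<gamma>)"
  have "x = (\<Oplus>\<^bsub>M\<^esub>\<gamma>\<in>{\<gamma>\<in>I. c' \<gamma> \<noteq> \<zero>}. c' \<gamma>)"
    unfolding x_def using assms(1,2) cM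
    by (intro add.finprod_mono_neutral_cong_right) (auto simp: c'_def split: if_splits)
  moreover have "x \<in> carrier M" unfolding x_def using cM by (intro finsum_closed) auto
  moreover from this have "\<exists>!c. c \<in> (\<Pi>\<^sub>E \<gamma>\<in>I. P \<gamma>) \<and> finite {\<gamma>\<in>I. c \<gamma> \<noteq> \<zero>} \<and>
      x = (\<Oplus>\<^bsub>M\<^esub>\<gamma>\<in>{\<gamma>\<in>I. c \<gamma> \<noteq> \<zero>}. c \<gamma>)"
    using decomposition unfolding internal_direct_sum_def by blast
  ultimately have "(THE c. c \<in> (\<Pi>\<^sub>E \<gamma>\<in>I. P \<gamma>) \<and> finite {\<gamma>\<in>I. c \<gamma> \<noteq> \<zero>} \<and>
      x = (\<Oplus>\<^bsub>M\<^esub>\<gamma>\<in>{\<gamma>\<in>I. c \<gamma> \<noteq> \<zero>}. c \<gamma>)) = c'"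
    using c' fin by (intro the1_equality) auto
  then show ?thesis using \<open>\<gamma> \<in> I\<close> by (simp add: homogeneous_part_def c'_def x_def)
qed

lemma sum_expansion:
  assumes "x \<in> carrier M"
  obtains F c where "finite F" "F \<subseteq> I" "\<And>\<gamma>. \<gamma> \<in> I \<Longrightarrow> c \<gamma> \<in> P \<gamma>" 
    "\<And>\<gamma>. \<gamma> \<in> I - F \<Longrightarrow> c \<gamma> = \<zero>" "x = (\<Oplus>\<^bsub>M\<^esub>\<gamma>\<in>F. c \<gamma>)"
proof -
  obtain c where c: "c \<in> (\<Pi>\<^sub>E \<gamma>\<in>I. P \<gamma>)" "finite {\<gamma>\<in>I. c \<gamma> \<noteq> \<zero>}"
      "x = (\<Oplus>\<^bsub>M\<^esub>\<gamma>\<in>{\<gamma>\<in>I. c \<gamma> \<noteq> \<zero>}. c \<gamma>)"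
    using decomposition assms unfolding internal_direct_sum_def by blast
  show thesis
    by (rule that[of "{\<gamma>\<in>I. c \<gamma> \<noteq> \<zero>}" c]) (use c in \<open>auto dest: PiE_mem\<close>)
qed

lemma homogeneous_induct [consumes 1, case_names zero homogeneous add]:
  assumes "x \<in> carrier M"
    and zero: "Q \<zero>"
    and homogeneous: "\<And>\<gamma> y. \<gamma> \<in> I \<Longrightarrow> y \<in> P \<gamma> \<Longrightarrow> Q y"
    and add: "\<And>y z. y \<in> carrier M \<Longrightarrow> z \<in> carrier M \<Longrightarrow> Q y \<Longrightarrow> Q z \<Longrightarrow> Q (y \<oplus> z)"
  shows "Q x"
proof -
  obtain F c where "finite F" "F \<subseteq> I" and cP: "\<And>\<gamma>. \<gamma> \<in> I \<Longrightarrow> c \<gamma> \<in> P \<gamma>"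
      and "\<And>\<gamma>. \<gamma> \<in> I - F \<Longrightarrow> c \<gamma> = \<zero>" and x: "x = (\<Oplus>\<^bsub>M\<^esub>\<gamma>\<in>F. c \<gamma>)"
    using sum_expansion[OF assms(1)] by blast
  from \<open>finite F\<close> \<open>F \<subseteq> I\<close> have "Q (\<Oplus>\<^bsub>M\<^esub>\<gamma>\<in>F. c \<gamma>)"
  proof (induction F rule: finite_induct)
    case (insert \<gamma> F)
    then have c: "c \<gamma> \<in> P \<gamma>" "c \<in> F \<rightarrow> carrier M" "c \<gamma> \<in> carrier M"
      using cP P_closed by blast+
    then have "Q (c \<gamma> \<oplus> (\<Oplus>\<^bsub>M\<^esub>\<gamma>\<in>F. c \<gamma>))"
      using insert by (intro add homogeneous[of \<gamma> "c \<gamma>"]) auto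
    then show ?case using insert c by simp
  qed (simp add: zero)
  then show ?thesis using x by simp
qed

lemma part_homogeneous:
  assumes "\<delta> \<in> I" "x \<in> P \<delta>" "\<gamma> \<in> I"
  shows "part \<gamma> x = (if \<gamma> = \<delta> then x else \<zero>)"
  using part_sum[of "{\<delta>}" "\<lambda>_. x" \<gamma>] assms P_closed[of \<delta> x] by simp

lemma homogeneous_degree_unique:
  assumes "x \<in> P \<gamma>" "x \<in> P \<delta>" "\<gamma> \<in> I" "\<delta> \<in> I" "x \<noteq> \<zero>"
  shows "\<gamma> = \<delta>"
  using part_homogeneous[of \<gamma> x \<gamma>] part_homogeneous[of \<delta> x \<gamma>] assms by (auto split: if_splits)

lemma part_in_P:
  assumes "x \<in> carrier M" "\<gamma> \<in> I"
  shows "part \<gamma> x \<in> P \<gamma>"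
proof -
  obtain F c where "finite F" "F \<subseteq> I" and cP: "\<And>\<gamma>. \<gamma> \<in> I \<Longrightarrow> c \<gamma> \<in> P \<gamma>"
      and "\<And>\<gamma>. \<gamma> \<in> I - F \<Longrightarrow> c \<gamma> = \<zero>" and x: "x = (\<Oplus>\<^bsub>M\<^esub>\<gamma>\<in>F. c \<gamma>)"
    using sum_expansion[OF assms(1)] by blast
  then have "part \<gamma> x = (if \<gamma> \<in> F then c \<gamma> else \<zero>)"
    unfolding x using assms(2) by (intro part_sum) auto
  then show ?thesis using assms(2) cP P_zero by simp
qed

lemma part_add:
  assumes "x \<in> carrier M" "y \<in> carrier M" "\<gamma> \<in> I"
  shows "part \<gamma> (x \<oplus> y) = part \<gamma> x \<oplus> part \<gamma> y"
proof -
  obtain F c where c: "finite F" "F \<subseteq> I" "\<And>\<gamma>. \<gamma> \<in> I \<Longrightarrow> c \<gamma> \<in> P \<gamma>" "\<And>\<gamma>. \<gamma> \<in> I - F \<Longrightarrow> c \<gamma> = \<zero>"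
      "x = (\<Oplus>\<^bsub>M\<^esub>\<gamma>\<in>F. c \<gamma>)"
    using sum_expansion[OF assms(1)] by blast
  obtain E e where e: "finite E" "E \<subseteq> I" "\<And>\<gamma>. \<gamma> \<in> I \<Longrightarrow> e \<gamma> \<in> P \<gamma>" "\<And>\<gamma>. \<gamma> \<in> I - E \<Longrightarrow> e \<gamma> = \<zero>"
      "y = (\<Oplus>\<^bsub>M\<^esub>\<gamma>\<in>E. e \<gamma>)"
    using sum_expansion[OF assms(2)] by blast
  let ?U = "F \<union> E"
  have U: "finite ?U" "?U \<subseteq> I" using c e by auto
  have cM: "c \<gamma> \<in> carrier M" and eM: "e \<gamma> \<in> carrier M" if "\<gamma> \<in> I" for \<gamma>
    using that c(3) e(3) P_closed by blast+
  have x: "x = (\<Oplus>\<^bsub>M\<^esub>\<gamma>\<in>?U. c \<gamma>)"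
    unfolding c(5) using U c cM by (intro add.finprod_mono_neutral_cong_left) auto
  have y: "y = (\<Oplus>\<^bsub>M\<^esub>\<gamma>\<in>?U. e \<gamma>)"
    unfolding e(5) using U e eM by (intro add.finprod_mono_neutral_cong_left) auto
  have "x \<oplus> y = (\<Oplus>\<^bsub>M\<^esub>\<gamma>\<in>?U. c \<gamma> \<oplus> e \<gamma>)"
    unfolding x y using U cM eM by (subst finsum_addf) auto
  moreover have "part \<gamma> (\<Oplus>\<^bsub>M\<^esub>\<gamma>\<in>?U. c \<gamma> \<oplus> e \<gamma>) = (if \<gamma> \<in> ?U then c \<gamma> \<oplus> e \<gamma> else \<zero>)"
    using U c e assms(3) by (intro part_sum) (auto intro!: P_add)
  moreover have "part \<gamma> x = (if \<gamma> \<in> ?U then c \<gamma> else \<zero>)"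
    unfolding x using U c assms(3) by (intro part_sum) auto
  moreover have "part \<gamma> y = (if \<gamma> \<in> ?U then e \<gamma> else \<zero>)"
    unfolding y using U e assms(3) by (intro part_sum) auto
  ultimately show ?thesis by simp
qed

lemma part_hom: "\<gamma> \<in> I \<Longrightarrow> abelian_group_hom M M (part \<gamma>)"
  by (intro additive_mapI) (auto intro!: part_add P_closed part_in_P abelian_group_axioms)

end

text \<open>
  It suffices to compare the two sides on homogeneous elements, where injectivity of \<open>\<sigma>\<close> ensures that
  no other part is sent to the degree \<open>\<sigma> \<gamma>\<close>.  The lemma applies to maps of degree \<open>0\<close> and to the
  multiplication by a homogeneous ring element.
\<close>

lemma part_commute:
  assumes M: "direct_sum M I P" and N: "direct_sum N I Q"
    and T: "abelian_group_hom M N T"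
    and \<sigma>: "inj_on \<sigma> I" "\<sigma> ` I \<subseteq> I"
    and TP: "\<And>\<gamma> x. \<gamma> \<in> I \<Longrightarrow> x \<in> P \<gamma> \<Longrightarrow> T x \<in> Q (\<sigma> \<gamma>)"
    and "\<gamma> \<in> I" "x \<in> carrier M"
  shows "homogeneous_part I N Q (\<sigma> \<gamma>) (T x) = T (homogeneous_part I M P \<gamma> x)"
proof -
  interpret M: direct_sum M I P by (rule M)
  interpret N: direct_sum N I Q by (rule N)
  interpret T: abelian_group_hom M N T by (rule T)
  interpret M': abelian_group_hom M M "M.part \<gamma>" by (rule M.part_hom) fact
  have \<sigma>\<gamma>: "\<sigma> \<gamma> \<in> I" using \<sigma>(2) \<open>\<gamma> \<in> I\<close> by blast
  interpret N': abelian_group_hom N N "N.part (\<sigma> \<gamma>)" by (rule N.part_hom[OF \<sigma>\<gamma>])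
  show ?thesis using \<open>x \<in> carrier M\<close>
  proof (induction x rule: M.homogeneous_induct)
    case (homogeneous \<delta> y)
    have "\<sigma> \<gamma> = \<sigma> \<delta> \<longleftrightarrow> \<gamma> = \<delta>" using \<sigma>(1) homogeneous(1) \<open>\<gamma> \<in> I\<close> by (auto dest: inj_onD)
    moreover have "\<sigma> \<delta> \<in> I" using \<sigma>(2) homogeneous(1) by blast
    ultimately show ?case
      using homogeneous TP \<sigma>\<gamma> \<open>\<gamma> \<in> I\<close>
      by (simp add: M.part_homogeneous[of \<delta> y \<gamma>] N.part_homogeneous[of "\<sigma> \<delta>" "T y" "\<sigma> \<gamma>"])
  qed simp_all
qed

context graded_ring
begin

lemma ring_direct_sum': "direct_sum R (carrier G) (ring_part R)"
  by (simp add: direct_sum_def direct_sum_axioms_def R.is_abelian_group ring_direct_sum)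

sublocale grading: direct_sum R "carrier G" "ring_part R"
  by (rule ring_direct_sum')

lemma mult_hom: "r \<in> carrier R \<Longrightarrow> abelian_group_hom R R (\<lambda>x. r \<otimes>\<^bsub>R\<^esub> x)"
  by (intro additive_mapI) (auto simp: R.r_distr R.is_abelian_group)

text \<open>
  The component \<open>e\<close> of \<open>1\<close> in degree \<open>1\<close> satisfies \<open>r e = r\<close> for homogeneous \<open>r\<close>, as one sees by
  comparing the components of \<open>r 1 = r\<close> in the degree of \<open>r\<close>.  Hence \<open>e = 1\<close>.
\<close>

lemma one_homogeneous: "\<one>\<^bsub>R\<^esub> \<in> ring_part R \<one>\<^bsub>G\<^esub>"
proof -
  define e where "e = grading.part \<one>\<^bsub>G\<^esub> \<one>\<^bsub>R\<^esub>"
  have e: "e \<in> ring_part R \<one>\<^bsub>G\<^esub>" unfolding e_def by (intro grading.part_in_P) auto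
  then have eR: "e \<in> carrier R" by (rule grading.P_closed[rotated]) simp
  have "r \<otimes>\<^bsub>R\<^esub> e = r" if "r \<in> carrier R" for r
    using that
  proof (induction r rule: grading.homogeneous_induct)
    case (homogeneous \<delta> r)
    then have r: "r \<in> carrier R" using grading.P_closed by blast
    have "grading.part (\<delta> \<otimes>\<^bsub>G\<^esub> \<one>\<^bsub>G\<^esub>) (r \<otimes>\<^bsub>R\<^esub> \<one>\<^bsub>R\<^esub>) = r \<otimes>\<^bsub>R\<^esub> e"
      unfolding e_def using homogeneous
      by (intro part_commute[OF ring_direct_sum' ring_direct_sum' mult_hom[OF r], where \<sigma> = "\<lambda>\<gamma>. \<delta> \<otimes>\<^bsub>G\<^esub> \<gamma>"])
        (auto intro!: inj_onI ring_part_mult)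
    then show ?case using homogeneous r by (simp add: grading.part_homogeneous)
  qed (use eR in \<open>simp_all add: R.l_distr\<close>)
  from this[of "\<one>\<^bsub>R\<^esub>"] eR have "e = \<one>\<^bsub>R\<^esub>" by simp
  then show ?thesis using e by simp
qed

lemma pow_homogeneous:
  assumes "r \<in> ring_part R \<delta>" "\<delta> \<in> carrier G"
  shows "r [^]\<^bsub>R\<^esub> (n::nat) \<in> ring_part R (\<delta> [^]\<^bsub>G\<^esub> n)"
  by (induction n) (use assms in \<open>auto intro: one_homogeneous ring_part_mult\<close>)

lemma finprod_homogeneous:
  assumes "finite S" "\<And>k. k \<in> S \<Longrightarrow> a k \<in> ring_part R (\<delta> k)" "\<And>k. k \<in> S \<Longrightarrow> \<delta> k \<in> carrier G"
  shows "finprod R a S \<in> ring_part R (finprod G \<delta> S)"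
  using assms
proof (induction S rule: finite_induct)
  case (insert k S)
  then have "a \<in> S \<rightarrow> carrier R" "a k \<in> carrier R" using grading.P_closed by (auto 4 3)
  with insert show ?case by (auto intro!: ring_part_mult G.finprod_closed)
qed (simp add: one_homogeneous)

end

context graded_module
begin

lemma mod_direct_sum': "direct_sum M (carrier G) (mod_part M)"
  by (simp add: direct_sum_def direct_sum_axioms_def M.abelian_group_axioms mod_direct_sum)

sublocale mod_grading: direct_sum M "carrier G" "mod_part M"
  by (rule mod_direct_sum')

lemma smult_hom: "r \<in> carrier R \<Longrightarrow> abelian_group_hom M M (\<lambda>x. r \<odot>\<^bsub>M\<^esub> x)"
  by (intro additive_mapI) (auto simp: smult_r_distr M.abelian_group_axioms)

lemma part_smult:
  assumes "r \<in> ring_part R \<delta>" "\<delta> \<in> carrier G" "\<gamma> \<in> carrier G" "x \<in> carrier M"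
  shows "mod_grading.part (\<gamma> \<otimes>\<^bsub>G\<^esub> \<delta>) (r \<odot>\<^bsub>M\<^esub> x) = r \<odot>\<^bsub>M\<^esub> mod_grading.part \<gamma> x"
proof -
  have "r \<in> carrier R" using assms grading.P_closed by blast
  then show ?thesis
    using assms
    by (intro part_commute[OF mod_direct_sum' mod_direct_sum' smult_hom, where \<sigma> = "\<lambda>\<gamma>. \<gamma> \<otimes>\<^bsub>G\<^esub> \<delta>"])
      (auto intro!: inj_onI simp: G.m_comm[of _ \<delta>] mod_part_smult)
qed

end


section \<open>Localization as a functor\<close>

locale module_at = module R M
  for R :: "('g, 'a, 'v) graded_ring_scheme" (structure)
  and M :: "('g, 'a, 'b) graded_module" (structure) +
  fixes G :: "('g, 'u) monoid_scheme" and f :: 'a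
  assumes f_closed [simp, intro]: "f \<in> carrier R"
begin

abbreviation frac :: "'b \<Rightarrow> nat \<Rightarrow> ('b \<times> nat) set" where
  "frac \<equiv> loc_frac R M f"

abbreviation Loc :: "('g, 'a, ('b \<times> nat) set) graded_module" where
  "Loc \<equiv> localization G R M f"

lemma smult_pow_pow:
  "m \<in> carrier M \<Longrightarrow> (f [^] (k::nat)) \<odot>\<^bsub>M\<^esub> ((f [^] (l::nat)) \<odot>\<^bsub>M\<^esub> m) = (f [^] (k + l)) \<odot>\<^bsub>M\<^esub> m"
  by (simp add: smult_assoc1[symmetric] R.nat_pow_mult)

lemma equiv_loc_rel: "equiv (carrier M \<times> UNIV) (loc_rel R M f)"
proof (rule equivI)
  show "loc_rel R M f \<subseteq> (carrier M \<times> UNIV) \<times> (carrier M \<times> UNIV)" by (auto simp: loc_rel_def)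
  show "refl_on (carrier M \<times> UNIV) (loc_rel R M f)" by (auto simp: loc_rel_def refl_on_def)
  show "sym (loc_rel R M f)" unfolding sym_def loc_rel_def by (clarsimp, metis)
  show "trans (loc_rel R M f)"
  proof (rule transI)
    fix x y z assume "(x, y) \<in> loc_rel R M f" "(y, z) \<in> loc_rel R M f"
    then obtain m n m' n' m'' n'' k l where xyz: "x = (m, n)" "y = (m', n')" "z = (m'', n'')"
      and m: "m \<in> carrier M" "m' \<in> carrier M" "m'' \<in> carrier M"
      and k: "(f [^] (k + n')) \<odot>\<^bsub>M\<^esub> m = (f [^] (k + n)) \<odot>\<^bsub>M\<^esub> m'"
      and l: "(f [^] (l + n'')) \<odot>\<^bsub>M\<^esub> m' = (f [^] (l + n')) \<odot>\<^bsub>M\<^esub> m''"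
      by (cases x, cases y, cases z) (auto simp: loc_rel_def)
    have "(f [^] ((k + l + n') + n'')) \<odot>\<^bsub>M\<^esub> m = (f [^] (l + n'')) \<odot>\<^bsub>M\<^esub> ((f [^] (k + n')) \<odot>\<^bsub>M\<^esub> m)"
      using m by (simp add: smult_pow_pow ac_simps)
    also have "\<dots> = (f [^] (k + n)) \<odot>\<^bsub>M\<^esub> ((f [^] (l + n'')) \<odot>\<^bsub>M\<^esub> m')"
      unfolding k using m by (simp add: smult_pow_pow ac_simps)
    also have "\<dots> = (f [^] ((k + l + n') + n)) \<odot>\<^bsub>M\<^esub> m''"
      unfolding l using m by (simp add: smult_pow_pow ac_simps)
    finally show "(x, z) \<in> loc_rel R M f"
      using m unfolding xyz by (auto simp: loc_rel_def)
  qed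
qed

lemma frac_eq_iff:
  assumes "m \<in> carrier M" "m' \<in> carrier M"
  shows "frac m n = frac m' n' \<longleftrightarrow>
    (\<exists>k::nat. (f [^] (k + n')) \<odot>\<^bsub>M\<^esub> m = (f [^] (k + n)) \<odot>\<^bsub>M\<^esub> m')"
  unfolding loc_frac_def using assms
  by (subst eq_equiv_class_iff[OF equiv_loc_rel]) (auto simp: loc_rel_def)

lemma frac_expand: "m \<in> carrier M \<Longrightarrow> frac ((f [^] k) \<odot>\<^bsub>M\<^esub> m) (n + k) = frac m n"
  by (subst frac_eq_iff) (auto simp: smult_pow_pow ac_simps intro!: exI[of _ 0])

lemma frac_closed [simp, intro]: "m \<in> carrier M \<Longrightarrow> frac m n \<in> carrier Loc"
  by (auto simp: localization_def loc_frac_def intro!: quotientI)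

lemma frac_cases [consumes 1, case_names frac]:
  assumes "X \<in> carrier Loc"
  obtains m n where "m \<in> carrier M" "X = frac m n"
  using assms by (auto simp: localization_def loc_frac_def elim!: quotientE)

text \<open>
  Operations on fractions are defined as unions over all representatives.  Such a union is the value
  at any representative, if this value does not depend on the choice.
\<close>

lemma UN_frac:
  assumes m: "m \<in> carrier M"
    and resp: "\<And>m n m' n' k. m \<in> carrier M \<Longrightarrow> m' \<in> carrier M \<Longrightarrow>
      (f [^] (k + n')) \<odot>\<^bsub>M\<^esub> m = (f [^] ((k::nat) + n)) \<odot>\<^bsub>M\<^esub> m' \<Longrightarrow> F m n = F m' n'"
  shows "(\<Union>(m, n)\<in>frac m n. F m n) = F m n"
proof -
  have "(\<lambda>(m, n). F m n) respects loc_rel R M f"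
    by (rule congruentI) (clarsimp simp: loc_rel_def, rule resp)
  from UN_equiv_class[OF equiv_loc_rel this, of "(m, n)"] m show ?thesis
    by (simp add: loc_frac_def)
qed

lemma zero_Loc: "\<zero>\<^bsub>Loc\<^esub> = frac \<zero>\<^bsub>M\<^esub> 0"
  by (simp add: localization_def)

lemma frac_eq_zero_iff:
  "m \<in> carrier M \<Longrightarrow> frac m n = \<zero>\<^bsub>Loc\<^esub> \<longleftrightarrow> (\<exists>k::nat. (f [^] k) \<odot>\<^bsub>M\<^esub> m = \<zero>\<^bsub>M\<^esub>)"
  by (simp add: zero_Loc frac_eq_iff)

lemma frac_zero: "frac \<zero>\<^bsub>M\<^esub> n = \<zero>\<^bsub>Loc\<^esub>"
  by (simp add: frac_eq_zero_iff)

text \<open>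
  As any two fractions have a common denominator, this case of the addition suffices below.  The
  definition gives the denominator \<open>f\<^sup>n\<^sup>+\<^sup>n\<close>, and one factor \<open>f\<^sup>n\<close> cancels.
\<close>

lemma add_frac:
  assumes m: "m \<in> carrier M" "m' \<in> carrier M"
  shows "frac m n \<oplus>\<^bsub>Loc\<^esub> frac m' n =  frac (m \<oplus>\<^bsub>M\<^esub> m') n"
proof -
  define F where "F = (\<lambda>m n m' n'. frac ((f [^] n') \<odot>\<^bsub>M\<^esub> m \<oplus>\<^bsub>M\<^esub> (f [^] n) \<odot>\<^bsub>M\<^esub> m') (n + n'))"
  have F_left: "F a l b j = F a' l' b j"
    if "a \<in> carrier M" "a' \<in> carrier M" "b \<in> carrier M"
      and eq: "(f [^] (k + l')) \<odot>\<^bsub>M\<^esub> a = (f [^] ((k::nat) + l)) \<odot>\<^bsub>M\<^esub> a'" for a l a' l' b j k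
  proof -
    have "(f [^] (k + (l' + j) + j)) \<odot>\<^bsub>M\<^esub> a = (f [^] (j + j)) \<odot>\<^bsub>M\<^esub> ((f [^] (k + l')) \<odot>\<^bsub>M\<^esub> a)"
      using that(1-3) by (simp add: smult_pow_pow ac_simps)
    also have "\<dots> = (f [^] (k + (l + j) + j)) \<odot>\<^bsub>M\<^esub> a'"
      unfolding eq using that(1-3) by (simp add: smult_pow_pow ac_simps)
    finally have 1: "(f [^] (k + (l' + j) + j)) \<odot>\<^bsub>M\<^esub> a = (f [^] (k + (l + j) + j)) \<odot>\<^bsub>M\<^esub> a'" .
    have "(f [^] (k + (l' + j))) \<odot>\<^bsub>M\<^esub> ((f [^] j) \<odot>\<^bsub>M\<^esub> a \<oplus>\<^bsub>M\<^esub> (f [^] l) \<odot>\<^bsub>M\<^esub> b) =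
        (f [^] (k + (l' + j) + j)) \<odot>\<^bsub>M\<^esub> a \<oplus>\<^bsub>M\<^esub> (f [^] (k + l + l' + j)) \<odot>\<^bsub>M\<^esub> b"
      using that(1-3) by (simp add: smult_r_distr smult_pow_pow ac_simps)
    also have "\<dots> = (f [^] (k + (l + j))) \<odot>\<^bsub>M\<^esub> ((f [^] j) \<odot>\<^bsub>M\<^esub> a' \<oplus>\<^bsub>M\<^esub> (f [^] l') \<odot>\<^bsub>M\<^esub> b)"
      unfolding 1 using that(1-3) by (simp add: smult_r_distr smult_pow_pow ac_simps)
    finally have "(f [^] (k + (l' + j))) \<odot>\<^bsub>M\<^esub> ((f [^] j) \<odot>\<^bsub>M\<^esub> a \<oplus>\<^bsub>M\<^esub> (f [^] l) \<odot>\<^bsub>M\<^esub> b) =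
        (f [^] (k + (l + j))) \<odot>\<^bsub>M\<^esub> ((f [^] j) \<odot>\<^bsub>M\<^esub> a' \<oplus>\<^bsub>M\<^esub> (f [^] l') \<odot>\<^bsub>M\<^esub> b)" .
    then show ?thesis unfolding F_def using that by (subst frac_eq_iff) auto
  qed
  have F_comm: "F a l b j = F b j a l" if "a \<in> carrier M" "b \<in> carrier M" for a l b j
    using that by (simp add: F_def M.a_comm add.commute)
  have "frac m n \<oplus>\<^bsub>Loc\<^esub> frac m' n = (\<Union>(a, l)\<in>frac m n. \<Union>(b, j)\<in>frac m' n. F a l b j)"
    by (simp add: localization_def F_def)
  also have "\<dots> = (\<Union>(a, l)\<in>frac m n. F a l m' n)"
  proof (rule SUP_cong[OF refl])
    fix x assume "x \<in> frac m n"
    then obtain a l where x: "x = (a, l)" "a \<in> carrier M"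
      by (auto simp: loc_frac_def loc_rel_def)
    have "(\<Union>(b, j)\<in>frac m' n. F a l b j) = F a l m' n"
      using m(2) by (rule UN_frac) (use F_left F_comm x in metis)
    then show "(case x of (a, l) \<Rightarrow> \<Union>(b, j)\<in>frac m' n. F a l b j) = (case x of (a, l) \<Rightarrow> F a l m' n)"
      by (simp add: x)
  qed
  also have "\<dots> = F m n m' n"
    using m(1) by (rule UN_frac) (use F_left m in metis)
  also have "\<dots> = frac ((f [^] n) \<odot>\<^bsub>M\<^esub> (m \<oplus>\<^bsub>M\<^esub> m')) (n + n)"
    using m by (simp add: F_def smult_r_distr)
  finally show ?thesis using m by (simp add: frac_expand)
qed

lemma common_denominator:
  assumes "X \<in> carrier Loc" "Y \<in> carrier Loc"
  obtains m m' n where "m \<in> carrier M" "m' \<in> carrier M" "X = frac m n" "Y = frac m' n"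
proof -
  obtain m n where m: "m \<in> carrier M" "X = frac m n" using assms(1) by (rule frac_cases)
  obtain m' n' where m': "m' \<in> carrier M" "Y = frac m' n'" using assms(2) by (rule frac_cases)
  show thesis
    using that[of "(f [^] n') \<odot>\<^bsub>M\<^esub> m" "(f [^] n) \<odot>\<^bsub>M\<^esub> m'" "n + n'"] m m'
      frac_expand[of m n' n] frac_expand[of m' n n'] by (simp add: add.commute)
qed

lemma abelian_group_Loc: "abelian_group Loc"
proof (rule abelian_groupI)
  fix X Y assume X: "X \<in> carrier Loc" and Y: "Y \<in> carrier Loc"
  from X Y obtain m m' n where m: "m \<in> carrier M" "m' \<in> carrier M" "X = frac m n" "Y = frac m' n"
    by (rule common_denominator)
  show "X \<oplus>\<^bsub>Loc\<^esub> Y \<in> carrier Loc" using m by (simp add: add_frac)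
  show "X \<oplus>\<^bsub>Loc\<^esub> Y = Y \<oplus>\<^bsub>Loc\<^esub> X" using m by (simp add: add_frac M.a_comm)
  fix Z assume "Z \<in> carrier Loc"
  then obtain m'' n'' where m'': "m'' \<in> carrier M" "Z = frac m'' n''" by (rule frac_cases)
  define a b c where "a = (f [^] n'') \<odot>\<^bsub>M\<^esub> m" and "b = (f [^] n'') \<odot>\<^bsub>M\<^esub> m'"
    and "c = (f [^] n) \<odot>\<^bsub>M\<^esub> m''"
  have abc: "a \<in> carrier M" "b \<in> carrier M" "c \<in> carrier M"
      "X = frac a (n + n'')" "Y = frac b (n + n'')" "Z = frac c (n + n'')"
    using m m'' frac_expand[of m n'' n] frac_expand[of m' n'' n] frac_expand[of m'' n n'']
    by (simp_all add: a_def b_def c_def add.commute)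
  show "X \<oplus>\<^bsub>Loc\<^esub> Y \<oplus>\<^bsub>Loc\<^esub> Z = X \<oplus>\<^bsub>Loc\<^esub> (Y \<oplus>\<^bsub>Loc\<^esub> Z)"
    using abc by (simp add: add_frac M.a_assoc)
next
  fix X assume "X \<in> carrier Loc"
  then obtain m n where m: "m \<in> carrier M" "X = frac m n" by (rule frac_cases)
  show "\<zero>\<^bsub>Loc\<^esub> \<oplus>\<^bsub>Loc\<^esub> X = X"
    using m add_frac[of "\<zero>\<^bsub>M\<^esub>" m n] by (simp add: frac_zero)
  show "\<exists>Y\<in>carrier Loc. Y \<oplus>\<^bsub>Loc\<^esub> X = \<zero>\<^bsub>Loc\<^esub>"
    using m by (intro bexI[of _ "frac (\<ominus>\<^bsub>M\<^esub> m) n"]) (auto simp: add_frac M.l_neg frac_zero)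
qed (simp add: zero_Loc)

sublocale Loc: abelian_group Loc
  by (rule abelian_group_Loc)

end

text \<open>
  All maps between localizations that occur below have the form \<open>m / f\<^sup>n \<mapsto> \<Phi>\<^sub>n m / h\<^sup>n\<close>: the maps induced
  by linear maps (\<open>\<Phi>\<^sub>n\<close> does not depend on \<open>n\<close>), the restriction maps of the Cech complex (\<open>\<Phi>\<^sub>n\<close> is
  the multiplication by the \<open>n\<close>-th power of an element) and the projections to a homogeneous part
  (\<open>\<Phi>\<^sub>n\<close> is a projection whose degree varies with \<open>n\<close>).
\<close>

definition frac_map ::
    "('a, 'v) ring_scheme \<Rightarrow> ('a, 'c, 'w) module_scheme \<Rightarrow> 'a \<Rightarrow> (nat \<Rightarrow> 'b \<Rightarrow> 'c)
     \<Rightarrow> ('b \<times> nat) set \<Rightarrow> ('c \<times> nat) set" where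
  "frac_map R N h \<Phi> X = (\<Union>(m, n)\<in>X. loc_frac R N h (\<Phi> n m) n)"

text \<open>
  Expanding \<open>m / f\<^sup>n\<close> by \<open>f\<^sup>k\<close> has to expand the image by \<open>h\<^sup>k\<close>, so that the image does not depend on
  the fraction that represents an element.
\<close>

locale fraction_map = M: module_at R M G f + N: module_at R N G h
  for R :: "('g, 'a, 'v) graded_ring_scheme"
  and M :: "('g, 'a, 'b) graded_module"
  and N :: "('g, 'a, 'c) graded_module"
  and G :: "('g, 'u) monoid_scheme" and f h +
  fixes \<Phi> :: "nat \<Rightarrow> 'b \<Rightarrow> 'c"
  assumes additive: "abelian_group_hom M N (\<Phi> n)"
    and compatible: "m \<in> carrier M \<Longrightarrow>
      (h [^]\<^bsub>R\<^esub> (k::nat)) \<odot>\<^bsub>N\<^esub> \<Phi> n m = \<Phi> (n + k) ((f [^]\<^bsub>R\<^esub> k) \<odot>\<^bsub>M\<^esub> m)"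
begin

lemma \<Phi>_closed: "m \<in> carrier M \<Longrightarrow> \<Phi> n m \<in> carrier N"
  using abelian_group_hom.hom_closed[OF additive] .

lemma frac_map_frac:
  assumes "m \<in> carrier M"
  shows "frac_map R N h \<Phi> (M.frac m n) = N.frac (\<Phi> n m) n"
  unfolding frac_map_def
proof (rule M.UN_frac[OF assms])
  fix m n m' n' and k :: nat assume m: "m \<in> carrier M" "m' \<in> carrier M"
    and eq: "(f [^]\<^bsub>R\<^esub> (k + n')) \<odot>\<^bsub>M\<^esub> m = (f [^]\<^bsub>R\<^esub> (k + n)) \<odot>\<^bsub>M\<^esub> m'"
  have "(h [^]\<^bsub>R\<^esub> (k + n')) \<odot>\<^bsub>N\<^esub> \<Phi> n m = (h [^]\<^bsub>R\<^esub> (k + n)) \<odot>\<^bsub>N\<^esub> \<Phi> n' m'"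
    using m compatible[of m "k + n'" n] compatible[of m' "k + n" n'] eq by (simp add: ac_simps)
  then show "N.frac (\<Phi> n m) n = N.frac (\<Phi> n' m') n'"
    using m \<Phi>_closed by (subst N.frac_eq_iff) auto
qed

lemma frac_map_hom: "abelian_group_hom M.Loc N.Loc (frac_map R N h \<Phi>)"
proof (rule additive_mapI)
  fix X assume "X \<in> carrier M.Loc"
  then show "frac_map R N h \<Phi> X \<in> carrier N.Loc"
    by (cases rule: M.frac_cases) (auto simp: frac_map_frac \<Phi>_closed)
  fix Y assume "Y \<in> carrier M.Loc"
  with \<open>X \<in> carrier M.Loc\<close> obtain m m' n where
    "m \<in> carrier M" "m' \<in> carrier M" "X = M.frac m n" "Y = M.frac m' n"
    by (rule M.common_denominator)
  then show "frac_map R N h \<Phi> (X \<oplus>\<^bsub>M.Loc\<^esub> Y) = frac_map R N h \<Phi> X \<oplus>\<^bsub>N.Loc\<^esub> frac_map R N h \<Phi> Y"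
    using abelian_group_hom.hom_add[OF additive]
    by (simp add: M.add_frac N.add_frac frac_map_frac \<Phi>_closed)
qed (rule M.abelian_group_Loc N.abelian_group_Loc)+

end

locale linear_map = M: module R M + N: module R N + abelian_group_hom M N \<phi>
  for R :: "('g, 'a, 'v) graded_ring_scheme"
  and M :: "('g, 'a, 'b) graded_module"
  and N :: "('g, 'a, 'c) graded_module"
  and \<phi> :: "'b \<Rightarrow> 'c" +
  assumes smult: "r \<in> carrier R \<Longrightarrow> x \<in> carrier M \<Longrightarrow> \<phi> (r \<odot>\<^bsub>M\<^esub> x) = r \<odot>\<^bsub>N\<^esub> \<phi> x"
begin

lemma fraction_map: "f \<in> carrier R \<Longrightarrow> fraction_map R M N f f (\<lambda>_. \<phi>)"
  by unfold_locales (auto simp: smult M.R.nat_pow_closed)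

lemma frac_map_frac:
  "f \<in> carrier R \<Longrightarrow> m \<in> carrier M \<Longrightarrow>
    frac_map R N f (\<lambda>_. \<phi>) (loc_frac R M f m n) = loc_frac R N f (\<phi> m) n"
  by (rule fraction_map.frac_map_frac[OF fraction_map])

end

text \<open>
  If \<open>\<beta> m / f\<^sup>n = 0\<close>, then \<open>\<beta> (f\<^sup>k m) = 0\<close> for some \<open>k\<close>, so \<open>f\<^sup>k m = \<alpha> l\<close> and \<open>m / f\<^sup>n\<close> is the image of
  \<open>l / f\<^sup>n\<^sup>+\<^sup>k\<close>.
\<close>

lemma localization_exact:
  assumes \<alpha>: "linear_map R L M \<alpha>" and \<beta>: "linear_map R M N \<beta>" and f: "f \<in> carrier R"
    and exact: "\<And>m. m \<in> carrier M \<Longrightarrow> \<beta> m = \<zero>\<^bsub>N\<^esub> \<Longrightarrow> m \<in> \<alpha> ` carrier L"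
    and X: "X \<in> carrier (localization G R M f)"
    and zero: "frac_map R N f (\<lambda>_. \<beta>) X = \<zero>\<^bsub>localization G R N f\<^esub>"
  shows "X \<in> frac_map R M f (\<lambda>_. \<alpha>) ` carrier (localization G R L f)"
proof -
  interpret \<alpha>: linear_map R L M \<alpha> by (rule \<alpha>)
  interpret \<beta>: linear_map R M N \<beta> by (rule \<beta>)
  interpret L: module_at R L G f by unfold_locales (rule f)
  interpret M: module_at R M G f by unfold_locales (rule f)
  interpret N: module_at R N G f by unfold_locales (rule f)
  obtain m n where m: "m \<in> carrier M" "X = M.frac m n" using X by (rule M.frac_cases)
  then obtain k :: nat where "(f [^]\<^bsub>R\<^esub> k) \<odot>\<^bsub>N\<^esub> \<beta> m = \<zero>\<^bsub>N\<^esub>"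
    using zero f by (auto simp: \<beta>.frac_map_frac N.frac_eq_zero_iff)
  then have "\<beta> ((f [^]\<^bsub>R\<^esub> k) \<odot>\<^bsub>M\<^esub> m) = \<zero>\<^bsub>N\<^esub>" using m f by (simp add: \<beta>.smult)
  then obtain l where l: "l \<in> carrier L" "(f [^]\<^bsub>R\<^esub> k) \<odot>\<^bsub>M\<^esub> m = \<alpha> l"
    using exact[of "(f [^]\<^bsub>R\<^esub> k) \<odot>\<^bsub>M\<^esub> m"] m f by auto
  have "X = frac_map R M f (\<lambda>_. \<alpha>) (L.frac l (n + k))"
    using M.frac_expand[of m k n] m l f by (simp add: \<alpha>.frac_map_frac)
  then show ?thesis using l by auto
qed


section \<open>The Cech complex\<close>

lemma (in abelian_group_hom) hom_finsum:
  assumes "finite A" "g \<in> A \<rightarrow> carrier G"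
  shows "h (\<Oplus>\<^bsub>G\<^esub>k\<in>A. g k) = (\<Oplus>\<^bsub>H\<^esub>k\<in>A. h (g k))"
  using assms
proof (induction A rule: finite_induct)
  case (insert k A)
  then have g: "g k \<in> carrier G" "g \<in> A \<rightarrow> carrier G" by auto
  then have hg: "h (g k) \<in> carrier H" "(\<lambda>k. h (g k)) \<in> A \<rightarrow> carrier H"
    by (auto simp: Pi_iff)
  have "h (\<Oplus>\<^bsub>G\<^esub>k\<in>insert k A. g k) = h (g k \<oplus>\<^bsub>G\<^esub> (\<Oplus>\<^bsub>G\<^esub>k\<in>A. g k))"
    by (subst G.finsum_insert) (fact insert.hyps g refl)+
  also have "\<dots> = h (g k) \<oplus>\<^bsub>H\<^esub> (\<Oplus>\<^bsub>H\<^esub>k\<in>A. h (g k))"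
    using g insert.IH by (simp add: G.finsum_closed)
  also have "\<dots> = (\<Oplus>\<^bsub>H\<^esub>k\<in>insert k A. h (g k))"
    by (subst H.finsum_insert) (fact insert.hyps hg refl)+
  finally show ?case .
qed simp

text \<open>
  The terms at \<open>(k, l)\<close> and \<open>(l, k)\<close> cancel.  The diagonal is left out, as antisymmetry only gives
  \<open>2 F k k = 0\<close> there.
\<close>

lemma (in abelian_group) finsum_antisymmetric:
  assumes "finite S" and F: "\<And>k l. k \<in> S \<Longrightarrow> l \<in> S \<Longrightarrow> k \<noteq> l \<Longrightarrow> F k l \<in> carrier G"
    and antisym: "\<And>k l. k \<in> S \<Longrightarrow> l \<in> S \<Longrightarrow> k \<noteq> l \<Longrightarrow> F k l = \<ominus> F l k"
  shows "(\<Oplus>k\<in>S. \<Oplus>l\<in>S - {k}. F k l) = \<zero>"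
  using assms
proof (induction S rule: finite_induct)
  case (insert x S)
  have F: "F k l \<in> carrier G" if "k \<in> insert x S" "l \<in> insert x S" "k \<noteq> l" for k l
    using insert that by blast
  have inner: "(\<Oplus>l\<in>S - {k}. F k l) \<in> carrier G" if "k \<in> S" for k
    using F that by (intro finsum_closed) auto
  have "(\<Oplus>k\<in>insert x S. \<Oplus>l\<in>insert x S - {k}. F k l) =
      (\<Oplus>l\<in>insert x S - {x}. F x l) \<oplus> (\<Oplus>k\<in>S. \<Oplus>l\<in>insert x S - {k}. F k l)"
    using insert.hyps F by (intro finsum_insert) (auto intro!: finsum_closed)
  also have "insert x S - {x} = S" using insert.hyps by auto
  also have "(\<Oplus>k\<in>S. \<Oplus>l\<in>insert x S - {k}. F k l) = (\<Oplus>k\<in>S. F k x \<oplus> (\<Oplus>l\<in>S - {k}. F k l))"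
  proof (rule finsum_cong')
    fix k assume k: "k \<in> S"
    then have eq: "insert x S - {k} = insert x (S - {k})" using insert.hyps by auto
    show "(\<Oplus>l\<in>insert x S - {k}. F k l) = F k x \<oplus> (\<Oplus>l\<in>S - {k}. F k l)"
      unfolding eq using insert.hyps k F by (intro finsum_insert) auto
  qed (use insert.hyps F inner in auto)
  also have "\<dots> = (\<Oplus>k\<in>S. F k x) \<oplus> (\<Oplus>k\<in>S. \<Oplus>l\<in>S - {k}. F k l)"
    using insert.hyps F inner by (intro finsum_addf) auto
  also have "(\<Oplus>k\<in>S. \<Oplus>l\<in>S - {k}. F k l) = \<zero>"
    by (rule insert.IH) (blast intro: insert.prems)+
  also have "(\<Oplus>l\<in>S. F x l) \<oplus> ((\<Oplus>k\<in>S. F k x) \<oplus> \<zero>) = (\<Oplus>l\<in>S. F x l \<oplus> F l x)"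
  proof -
    have "(\<lambda>l. F x l) \<in> S \<rightarrow> carrier G" "(\<lambda>l. F l x) \<in> S \<rightarrow> carrier G"
      using insert.hyps F by auto
    then show ?thesis by (simp add: finsum_addf finsum_closed)
  qed
  also have "\<dots> = \<zero>"
  proof (rule add.finprod_one_eqI)
    fix l assume "l \<in> S"
    then have "F x l = \<ominus> F l x" "F l x \<in> carrier G"
      using insert.hyps insert.prems(2)[of x l] F[of l x] by auto
    then show "F x l \<oplus> F l x = \<zero>" by (simp add: l_neg)
  qed
  finally show ?case .
next
  case empty
  show ?case by (rule finsum_empty)
qed

definition cech_map :: "'a list \<Rightarrow> int \<Rightarrow> (nat set \<Rightarrow> 'x \<Rightarrow> 'y) \<Rightarrow> (nat set \<Rightarrow> 'x) \<Rightarrow> (nat set \<Rightarrow> 'y)" where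
  "cech_map fs p T \<alpha> = (\<lambda>S\<in>cech_index fs p. T S (\<alpha> S))"

lemma cech_index_finite: "S \<in> cech_index fs p \<Longrightarrow> finite S"
  by (auto simp: cech_index_def intro: finite_subset[OF _ finite_lessThan])

lemma cech_index_Diff:
  assumes "S \<in> cech_index fs (p + 1)" "k \<in> S"
  shows "S - {k} \<in> cech_index fs p"
proof -
  have "finite S" using assms cech_index_finite by blast
  then have "Suc (card (S - {k})) = card S" using assms(2) by (intro card_Suc_Diff1)
  moreover have "int (card S) = p + 1" "S \<subseteq> {..<length fs}"
    using assms(1) by (simp_all add: cech_index_def)
  ultimately have "int (card (S - {k})) = p \<and> S - {k} \<subseteq> {..<length fs}"
    by (intro conjI) (linarith, blast)
  then show ?thesis by (simp add: cech_index_def)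
qed

lemma cech_index_empty:
  assumes "p < 0 \<or> int (length fs) < p"
  shows "cech_index fs p = {}"
proof -
  have "S \<notin> cech_index fs p" for S
  proof
    assume "S \<in> cech_index fs p"
    then have S: "S \<subseteq> {..<length fs}" "int (card S) = p" by (simp_all add: cech_index_def)
    have "card S \<le> length fs" using card_mono[OF _ S(1)] by simp
    with S assms show False by linarith
  qed
  then show ?thesis by blast
qed

locale cech_module = module R M
  for R :: "('g, 'a, 'v) graded_ring_scheme" (structure)
  and M :: "('g, 'a, 'b) graded_module" (structure) +
  fixes G :: "('g, 'u) monoid_scheme" and fs :: "'a list"
  assumes fs_closed: "set fs \<subseteq> carrier R"
begin

abbreviation Loc :: "nat set \<Rightarrow> ('g, 'a, ('b \<times> nat) set) graded_module" where
  "Loc \<equiv> cech_loc G R fs M"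

abbreviation Cech :: "int \<Rightarrow> ('g, 'a, nat set \<Rightarrow> ('b \<times> nat) set) graded_module" where
  "Cech \<equiv> cech_term G R fs M"

abbreviation restriction :: "nat set \<Rightarrow> nat \<Rightarrow> ('b \<times> nat) set \<Rightarrow> ('b \<times> nat) set" where
  "restriction S k \<equiv> loc_map R M (cech_elem R fs (S - {k})) (fs ! k)"

abbreviation signed :: "nat set \<Rightarrow> nat \<Rightarrow> ('b \<times> nat) set \<Rightarrow> ('b \<times> nat) set" where
  "signed S k x \<equiv> (if even (card {l \<in> S. l < k}) then x else \<ominus>\<^bsub>Loc S\<^esub> x)"

lemma nth_closed: "k < length fs \<Longrightarrow> fs ! k \<in> carrier R"
  using fs_closed nth_mem by blast

lemma cech_elem_closed: "S \<in> cech_index fs p \<Longrightarrow> cech_elem R fs S \<in> carrier R"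
  unfolding cech_elem_def by (intro R.finprod_closed) (auto simp: cech_index_def intro!: nth_closed)

lemma module_at: "S \<in> cech_index fs p \<Longrightarrow> module_at R M (cech_elem R fs S)"
  by unfold_locales (rule cech_elem_closed)

lemma abelian_group_Loc: "S \<in> cech_index fs p \<Longrightarrow> abelian_group (Loc S)"
  unfolding cech_loc_def by (rule module_at.abelian_group_Loc[OF module_at])

lemma cech_elem_remove:
  assumes "S \<in> cech_index fs p" "k \<in> S"
  shows "cech_elem R fs S = cech_elem R fs (S - {k}) \<otimes> fs ! k"
proof -
  have S: "(!) fs \<in> S \<rightarrow> carrier R" "finite S"
    using assms nth_closed by (auto simp: cech_index_def intro: finite_subset[OF _ finite_lessThan])
  have "cech_elem R fs (insert k (S - {k})) = fs ! k \<otimes> cech_elem R fs (S - {k})"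
    unfolding cech_elem_def using S assms by (intro R.finprod_insert) auto
  moreover have "insert k (S - {k}) = S" using assms by auto
  ultimately show ?thesis
    using S assms by (auto simp: cech_elem_def intro!: R.m_comm R.finprod_closed)
qed

lemma restriction_eq_frac_map:
  assumes "S \<in> cech_index fs (p + 1)" "k \<in> S"
  shows "restriction S k = frac_map R M (cech_elem R fs S) (\<lambda>n m. ((fs ! k) [^] n) \<odot>\<^bsub>M\<^esub> m)"
  unfolding cech_elem_remove[OF assms] loc_map_def frac_map_def ..

lemma restriction_fraction_map:
  assumes S: "S \<in> cech_index fs (p + 1)" and k: "k \<in> S"
  shows "fraction_map R M M (cech_elem R fs (S - {k})) (cech_elem R fs S)
    (\<lambda>n m. ((fs ! k) [^] n) \<odot>\<^bsub>M\<^esub> m)"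
proof (intro fraction_map.intro fraction_map_axioms.intro module_at)
  show "S \<in> cech_index fs (p + 1)" by (rule S)
  show S': "S - {k} \<in> cech_index fs p" using S k by (rule cech_index_Diff)
  have g: "fs ! k \<in> carrier R" using S k nth_closed by (auto simp: cech_index_def)
  note f = cech_elem_closed[OF S']
  show "abelian_group_hom M M ((\<odot>\<^bsub>M\<^esub>) (fs ! k [^] n))" for n :: nat
    using g by (intro additive_mapI) (auto simp: smult_r_distr M.abelian_group_axioms)
  show "(cech_elem R fs S [^] j) \<odot>\<^bsub>M\<^esub> ((fs ! k [^] n) \<odot>\<^bsub>M\<^esub> m) =
      (fs ! k [^] (n + j)) \<odot>\<^bsub>M\<^esub> ((cech_elem R fs (S - {k}) [^] j) \<odot>\<^bsub>M\<^esub> m)"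
    if "m \<in> carrier M" for m and j n :: nat
    unfolding cech_elem_remove[OF S k] using g f that
    by (simp add: R.nat_pow_distrib smult_assoc1[symmetric] R.nat_pow_mult[symmetric] R.m_ac)
qed

lemma restriction_frac:
  assumes "S \<in> cech_index fs (p + 1)" "k \<in> S" "m \<in> carrier M"
  shows "restriction S k (loc_frac R M (cech_elem R fs (S - {k})) m n) =
    loc_frac R M (cech_elem R fs S) (((fs ! k) [^] n) \<odot>\<^bsub>M\<^esub> m) n"
  unfolding restriction_eq_frac_map[OF assms(1,2)]
  using fraction_map.frac_map_frac[OF restriction_fraction_map[OF assms(1,2)] assms(3)] .

lemma restriction_hom:
  assumes "S \<in> cech_index fs (p + 1)" "k \<in> S"
  shows "abelian_group_hom (Loc (S - {k})) (Loc S) (restriction S k)"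
  unfolding restriction_eq_frac_map[OF assms] cech_loc_def
  using fraction_map.frac_map_hom[OF restriction_fraction_map[OF assms]] .

lemma signed_restriction_hom:
  assumes "S \<in> cech_index fs (p + 1)" "k \<in> S"
  shows "abelian_group_hom (Loc (S - {k})) (Loc S) (\<lambda>x. signed S k (restriction S k x))"
proof -
  interpret abelian_group_hom "Loc (S - {k})" "Loc S" "restriction S k"
    by (rule restriction_hom) fact+
  show ?thesis
    by (rule additive_mapI) (auto simp: G.abelian_group_axioms H.abelian_group_axioms H.minus_add)
qed

text \<open>
  In both orders the numerator of a fraction with exponent \<open>n\<close> is multiplied by the \<open>n\<close>-th powers of
  the two generators.
\<close>

lemma restriction_commute:
  assumes S: "S \<in> cech_index fs (p + 2)" and kl: "k \<in> S" "l \<in> S" "k \<noteq> l"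
    and X: "X \<in> carrier (Loc (S - {k} - {l}))"
  shows "restriction S k (restriction (S - {k}) l X) = restriction S l (restriction (S - {l}) k X)"
proof -
  have S2: "S \<in> cech_index fs ((p + 1) + 1)" using S by (simp add: algebra_simps)
  have Sk: "S - {k} \<in> cech_index fs (p + 1)" and Sl: "S - {l} \<in> cech_index fs (p + 1)"
    using S2 kl cech_index_Diff by blast+
  have Skl: "S - {k} - {l} \<in> cech_index fs p" using Sk kl cech_index_Diff by blast
  have eq: "S - {l} - {k} = S - {k} - {l}" by blast
  have g: "fs ! k \<in> carrier R" "fs ! l \<in> carrier R"
    using S kl nth_closed by (auto simp: cech_index_def)
  obtain m n where m: "m \<in> carrier M" "X = loc_frac R M (cech_elem R fs (S - {k} - {l})) m n"
    using X unfolding cech_loc_def by (rule module_at.frac_cases[OF module_at[OF Skl]])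
  have "restriction S k (restriction (S - {k}) l X) =
      loc_frac R M (cech_elem R fs S) ((fs ! k [^] n) \<odot>\<^bsub>M\<^esub> ((fs ! l [^] n) \<odot>\<^bsub>M\<^esub> m)) n"
    using m g kl restriction_frac[OF Sk, of l m n] restriction_frac[OF S2 kl(1)] by simp
  moreover have "restriction S l (restriction (S - {l}) k X) =
      loc_frac R M (cech_elem R fs S) ((fs ! l [^] n) \<odot>\<^bsub>M\<^esub> ((fs ! k [^] n) \<odot>\<^bsub>M\<^esub> m)) n"
    using m g kl restriction_frac[OF Sl, of k m n] restriction_frac[OF S2 kl(2)] by (simp add: eq)
  ultimately show ?thesis
    using m g by (simp add: smult_assoc1[symmetric] R.m_comm)
qed

lemma Cech_simps:
  "carrier (Cech p) = (\<Pi>\<^sub>E S\<in>cech_index fs p. carrier (Loc S))"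
  "\<zero>\<^bsub>Cech p\<^esub> = (\<lambda>S\<in>cech_index fs p. \<zero>\<^bsub>Loc S\<^esub>)"
  "\<alpha> \<oplus>\<^bsub>Cech p\<^esub> \<beta> = (\<lambda>S\<in>cech_index fs p. \<alpha> S \<oplus>\<^bsub>Loc S\<^esub> \<beta> S)"
  by (simp_all add: cech_term_def)

lemma abelian_group_Cech: "abelian_group (Cech p)"
proof -
  note [simp] = abelian_groupE(1,2,5)[OF abelian_group_Loc[where p = p]]
  show ?thesis
  proof (rule abelian_groupI)
    fix \<alpha> assume "\<alpha> \<in> carrier (Cech p)"
    then have \<alpha>: "\<alpha> \<in> (\<Pi>\<^sub>E S\<in>cech_index fs p. carrier (Loc S))" by (simp add: Cech_simps)
    then show "\<zero>\<^bsub>Cech p\<^esub> \<oplus>\<^bsub>Cech p\<^esub> \<alpha> = \<alpha>"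
      by (auto simp: Cech_simps fun_eq_iff PiE_iff extensional_def)
    show "\<exists>\<beta>\<in>carrier (Cech p). \<beta> \<oplus>\<^bsub>Cech p\<^esub> \<alpha> = \<zero>\<^bsub>Cech p\<^esub>"
      using \<alpha> abelian_group.a_inv_closed[OF abelian_group_Loc] abelian_group.l_neg[OF abelian_group_Loc]
      by (intro bexI[of _ "\<lambda>S\<in>cech_index fs p. \<ominus>\<^bsub>Loc S\<^esub> \<alpha> S"])
        (auto simp: Cech_simps fun_eq_iff PiE_iff)
    fix \<beta> assume "\<beta> \<in> carrier (Cech p)"
    then have \<beta>: "\<beta> \<in> (\<Pi>\<^sub>E S\<in>cech_index fs p. carrier (Loc S))" by (simp add: Cech_simps)
    show "\<alpha> \<oplus>\<^bsub>Cech p\<^esub> \<beta> \<in> carrier (Cech p)" using \<alpha> \<beta> by (auto simp: Cech_simps PiE_iff)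
    show "\<alpha> \<oplus>\<^bsub>Cech p\<^esub> \<beta> = \<beta> \<oplus>\<^bsub>Cech p\<^esub> \<alpha>"
      using \<alpha> \<beta> abelian_groupE(4)[OF abelian_group_Loc] by (auto simp: Cech_simps PiE_iff fun_eq_iff)
    fix \<gamma> assume "\<gamma> \<in> carrier (Cech p)"
    then have \<gamma>: "\<gamma> \<in> (\<Pi>\<^sub>E S\<in>cech_index fs p. carrier (Loc S))" by (simp add: Cech_simps)
    show "\<alpha> \<oplus>\<^bsub>Cech p\<^esub> \<beta> \<oplus>\<^bsub>Cech p\<^esub> \<gamma> = \<alpha> \<oplus>\<^bsub>Cech p\<^esub> (\<beta> \<oplus>\<^bsub>Cech p\<^esub> \<gamma>)"
      using \<alpha> \<beta> \<gamma> abelian_groupE(3)[OF abelian_group_Loc] by (auto simp: Cech_simps PiE_iff fun_eq_iff)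
  qed (auto simp: Cech_simps)
qed

lemma cech_diff_at:
  assumes "S \<in> cech_index fs (p + 1)"
  shows "cech_diff G R fs M p \<alpha> S = (\<Oplus>\<^bsub>Loc S\<^esub>k\<in>S. signed S k (restriction S k (\<alpha> (S - {k}))))"
  using assms by (simp add: cech_diff_def Let_def)

lemma signed_restriction_closed:
  assumes "\<alpha> \<in> carrier (Cech p)" "S \<in> cech_index fs (p + 1)" "k \<in> S"
  shows "signed S k (restriction S k (\<alpha> (S - {k}))) \<in> carrier (Loc S)"
  using abelian_group_hom.hom_closed[OF signed_restriction_hom[OF assms(2,3)]] assms
    cech_index_Diff[OF assms(2,3)]
  by (auto simp: Cech_simps PiE_iff)

lemma cech_diff_hom: "abelian_group_hom (Cech p) (Cech (p + 1)) (cech_diff G R fs M p)"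
proof (rule additive_mapI)
  fix \<alpha> assume \<alpha>: "\<alpha> \<in> carrier (Cech p)"
  have closed: "cech_diff G R fs M p \<alpha> S \<in> carrier (Loc S)"
    if "S \<in> cech_index fs (p + 1)" "\<alpha> \<in> carrier (Cech p)" for S \<alpha>
    unfolding cech_diff_at[OF that(1)] 
    using that signed_restriction_closed
    by (intro abelian_monoid.finsum_closed abelian_group.axioms(1) abelian_group_Loc Pi_I)
  then show "cech_diff G R fs M p \<alpha> \<in> carrier (Cech (p + 1))"
    using \<alpha> by (auto simp: Cech_simps(1) PiE_iff cech_diff_def)
  fix \<beta> assume \<beta>: "\<beta> \<in> carrier (Cech p)"
  have "cech_diff G R fs M p (\<alpha> \<oplus>\<^bsub>Cech p\<^esub> \<beta>) S = cech_diff G R fs M p \<alpha> S \<oplus>\<^bsub>Loc S\<^esub> cech_diff G R fs M p \<beta> S"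
    if S: "S \<in> cech_index fs (p + 1)" for S
  proof -
    interpret L: abelian_group "Loc S" using S by (rule abelian_group_Loc)
    have "signed S k (restriction S k ((\<alpha> \<oplus>\<^bsub>Cech p\<^esub> \<beta>) (S - {k}))) =
        signed S k (restriction S k (\<alpha> (S - {k}))) \<oplus>\<^bsub>Loc S\<^esub> signed S k (restriction S k (\<beta> (S - {k})))"
      if "k \<in> S" for k
      using abelian_group_hom.hom_add[OF signed_restriction_hom[OF S that], of "\<alpha> (S - {k})" "\<beta> (S - {k})"]
        cech_index_Diff[OF S that] \<alpha> \<beta> by (auto simp: Cech_simps PiE_iff)
    then have "cech_diff G R fs M p (\<alpha> \<oplus>\<^bsub>Cech p\<^esub> \<beta>) S =
        (\<Oplus>\<^bsub>Loc S\<^esub>k\<in>S. signed S k (restriction S k (\<alpha> (S - {k}))) \<oplus>\<^bsub>Loc S\<^esub>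
          signed S k (restriction S k (\<beta> (S - {k}))))"
      unfolding cech_diff_at[OF S]
      using signed_restriction_closed[OF \<alpha> S] signed_restriction_closed[OF \<beta> S]
      by (intro L.finsum_cong' L.a_closed Pi_I) simp_all
    also have "\<dots> = cech_diff G R fs M p \<alpha> S \<oplus>\<^bsub>Loc S\<^esub> cech_diff G R fs M p \<beta> S"
      unfolding cech_diff_at[OF S]
      using signed_restriction_closed[OF \<alpha> S] signed_restriction_closed[OF \<beta> S]
      by (intro L.finsum_addf Pi_I)
    finally show ?thesis .
  qed
  then show "cech_diff G R fs M p (\<alpha> \<oplus>\<^bsub>Cech p\<^esub> \<beta>) =
      cech_diff G R fs M p \<alpha> \<oplus>\<^bsub>Cech (p + 1)\<^esub> cech_diff G R fs M p \<beta>"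
    by (auto simp: Cech_simps(3)[of "p + 1"] cech_diff_def fun_eq_iff)
qed (rule abelian_group_Cech)+

text \<open>
  Removing \<open>k\<close> and \<open>l\<close> from \<open>S\<close> in the two possible orders gives the same restriction with opposite
  signs: the number of predecessors changes only for the larger of the two, when the smaller one has
  been removed first.
\<close>

lemma cech_diff_diff:
  assumes \<alpha>: "\<alpha> \<in> carrier (Cech p)"
  shows "cech_diff G R fs M (p + 1) (cech_diff G R fs M p \<alpha>) = \<zero>\<^bsub>Cech (p + 2)\<^esub>"
proof -
  have "cech_diff G R fs M (p + 1) (cech_diff G R fs M p \<alpha>) S = \<zero>\<^bsub>Loc S\<^esub>"
    if S: "S \<in> cech_index fs (p + 2)" for S
  proof -
    have S2: "S \<in> cech_index fs ((p + 1) + 1)" using S by (simp add: algebra_simps)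
    then have Sk: "S - {k} \<in> cech_index fs (p + 1)" if "k \<in> S" for k
      using that cech_index_Diff by blast
    have fin: "finite S" using S by (rule cech_index_finite)
    interpret L: abelian_group "Loc S" using S by (rule abelian_group_Loc)
    define X where "X = (\<lambda>k l. restriction S k (restriction (S - {k}) l (\<alpha> (S - {k} - {l}))))"
    define F where "F = (\<lambda>k l. signed S k (restriction S k
      (signed (S - {k}) l (restriction (S - {k}) l (\<alpha> (S - {k} - {l}))))))"
    define c where "c = (\<lambda>k. card {l \<in> S. l < k})"
    define c' where "c' = (\<lambda>k l. card {j \<in> S - {k}. j < l})"
    have \<alpha>S: "\<alpha> (S - {k} - {l}) \<in> carrier (Loc (S - {k} - {l}))" if "k \<in> S" "l \<in> S" "k \<noteq> l" for k l
      using \<alpha> cech_index_Diff[OF Sk, of k l] that by (auto simp: Cech_simps PiE_iff)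
    have X_closed: "X k l \<in> carrier (Loc S)" if "k \<in> S" "l \<in> S" "k \<noteq> l" for k l
      unfolding X_def using that \<alpha>S
      by (intro abelian_group_hom.hom_closed[OF restriction_hom[OF S2]]
          abelian_group_hom.hom_closed[OF restriction_hom[OF Sk]]) auto
    have X_sym: "X k l = X l k" if "k \<in> S" "l \<in> S" "k \<noteq> l" for k l
    proof -
      have "S - {l} - {k} = S - {k} - {l}" by blast
      then show ?thesis
        using restriction_commute[OF S that \<alpha>S[OF that]] by (simp add: X_def)
    qed
    have F_eq: "F k l = (if even (c k + c' k l) then X k l else \<ominus>\<^bsub>Loc S\<^esub> X k l)"
      if "k \<in> S" "l \<in> S" "k \<noteq> l" for k l
    proof -
      have "restriction (S - {k}) l (\<alpha> (S - {k} - {l})) \<in> carrier (Loc (S - {k}))"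
        using abelian_group_hom.hom_closed[OF restriction_hom[OF Sk]] that \<alpha>S by auto
      then show ?thesis
        using abelian_group_hom.hom_a_inv[OF restriction_hom[OF S2 that(1)]] X_closed[OF that]
        by (auto simp: F_def X_def c_def c'_def)
    qed
    have c'_eq: "c' k l = (if k < l then c l - 1 else c l) \<and> (k < l \<longrightarrow> c l > 0)"
      if "k \<in> S" "l \<in> S" "k \<noteq> l" for k l
    proof (cases "k < l")
      case True
      have "{j \<in> S - {k}. j < l} = {j \<in> S. j < l} - {k}" by auto
      moreover have "k \<in> {j \<in> S. j < l}" using True that by simp
      ultimately show ?thesis
        using True fin by (auto simp: c'_def c_def card_gt_0_iff)
    next
      case False
      then have "{j \<in> S - {k}. j < l} = {j \<in> S. j < l}" by auto
      then show ?thesis using False by (simp add: c'_def c_def)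
    qed
    have F_anti: "F k l = \<ominus>\<^bsub>Loc S\<^esub> F l k" if "k \<in> S" "l \<in> S" "k \<noteq> l" for k l
    proof -
      have "even (c k + c' k l) \<noteq> even (c l + c' l k)"
        using c'_eq[OF that] c'_eq[of l k] that by (cases "k < l") auto
      then show ?thesis
        using that X_sym[OF that] X_closed[OF that] F_eq[OF that] F_eq[of l k] by auto
    qed
    have F_closed: "F k l \<in> carrier (Loc S)" if "k \<in> S" "l \<in> S" "k \<noteq> l" for k l
      using that by (simp add: F_eq X_closed)
    have "cech_diff G R fs M (p + 1) (cech_diff G R fs M p \<alpha>) S =
        (\<Oplus>\<^bsub>Loc S\<^esub>k\<in>S. signed S k (restriction S k (cech_diff G R fs M p \<alpha> (S - {k}))))"
      by (rule cech_diff_at[OF S2])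
    also have "\<dots> = (\<Oplus>\<^bsub>Loc S\<^esub>k\<in>S. \<Oplus>\<^bsub>Loc S\<^esub>l\<in>S - {k}. F k l)"
    proof (rule L.finsum_cong')
      show "(\<lambda>k. \<Oplus>\<^bsub>Loc S\<^esub>l\<in>S - {k}. F k l) \<in> S \<rightarrow> carrier (Loc S)"
        using F_closed by (auto intro!: L.finsum_closed)
      fix k assume k: "k \<in> S"
      show "signed S k (restriction S k (cech_diff G R fs M p \<alpha> (S - {k}))) = (\<Oplus>\<^bsub>Loc S\<^esub>l\<in>S - {k}. F k l)"
        unfolding cech_diff_at[OF Sk[OF k]] F_def
        using fin k \<alpha> signed_restriction_closed[OF _ Sk]
        by (intro abelian_group_hom.hom_finsum[OF signed_restriction_hom[OF S2 k]]) auto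
    qed simp
    also have "\<dots> = \<zero>\<^bsub>Loc S\<^esub>"
      using fin F_closed F_anti by (rule L.finsum_antisymmetric)
    finally show ?thesis .
  qed
  then show ?thesis by (auto simp: Cech_simps cech_diff_def add.assoc fun_eq_iff)
qed

end

lemma cech_map_hom:
  assumes M: "cech_module R M fs" and N: "cech_module R N fs"
    and T: "\<And>S. S \<in> cech_index fs p \<Longrightarrow> abelian_group_hom (cech_loc G R fs M S) (cech_loc G R fs N S) (T S)"
  shows "abelian_group_hom (cech_term G R fs M p) (cech_term G R fs N p) (cech_map fs p T)"
proof (rule additive_mapI)
  interpret M: cech_module R M G fs by (rule M)
  interpret N: cech_module R N G fs by (rule N)
  show "abelian_group (M.Cech p)" "abelian_group (N.Cech p)"
    by (rule M.abelian_group_Cech N.abelian_group_Cech)+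
  fix \<alpha> assume \<alpha>: "\<alpha> \<in> carrier (M.Cech p)"
  then show "cech_map fs p T \<alpha> \<in> carrier (N.Cech p)"
    using abelian_group_hom.hom_closed[OF T] by (auto simp: M.Cech_simps N.Cech_simps cech_map_def PiE_iff)
  fix \<beta> assume "\<beta> \<in> carrier (M.Cech p)"
  with \<alpha> show "cech_map fs p T (\<alpha> \<oplus>\<^bsub>M.Cech p\<^esub> \<beta>) = cech_map fs p T \<alpha> \<oplus>\<^bsub>N.Cech p\<^esub> cech_map fs p T \<beta>"
    using abelian_group_hom.hom_add[OF T]
    by (auto simp: M.Cech_simps N.Cech_simps cech_map_def PiE_iff fun_eq_iff)
qed

text \<open>
  The Cech differential is a signed sum of restrictions, so additive maps that commute with the
  restrictions commute with it.
\<close>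

lemma cech_map_diff:
  assumes M: "cech_module R M fs" and N: "cech_module R N fs"
    and T: "\<And>S q. S \<in> cech_index fs q \<Longrightarrow> abelian_group_hom (cech_loc G R fs M S) (cech_loc G R fs N S) (T S)"
    and commute: "\<And>S k X. S \<in> cech_index fs (p + 1) \<Longrightarrow> k \<in> S \<Longrightarrow> X \<in> carrier (cech_loc G R fs M (S - {k})) \<Longrightarrow>
      T S (loc_map R M (cech_elem R fs (S - {k})) (fs ! k) X) =
      loc_map R N (cech_elem R fs (S - {k})) (fs ! k) (T (S - {k}) X)"
    and \<alpha>: "\<alpha> \<in> carrier (cech_term G R fs M p)"
  shows "cech_diff G R fs N p (cech_map fs p T \<alpha>) = cech_map fs (p + 1) T (cech_diff G R fs M p \<alpha>)"
proof -
  interpret M: cech_module R M G fs by (rule M)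
  interpret N: cech_module R N G fs by (rule N)
  have "cech_diff G R fs N p (cech_map fs p T \<alpha>) S = T S (cech_diff G R fs M p \<alpha> S)"
    if S: "S \<in> cech_index fs (p + 1)" for S
  proof -
    interpret T: abelian_group_hom "M.Loc S" "N.Loc S" "T S" using S by (rule T)
    have fin: "finite S" using S by (rule cech_index_finite)
    have 1: "\<alpha> (S - {k}) \<in> carrier (M.Loc (S - {k}))" if "k \<in> S" for k
      using \<alpha> cech_index_Diff[OF S that] by (auto simp: M.Cech_simps)
    have 2: "M.restriction S k (\<alpha> (S - {k})) \<in> carrier (M.Loc S)" if "k \<in> S" for k
      using abelian_group_hom.hom_closed[OF M.restriction_hom[OF S that]] 1 that by blast
    have 3: "N.signed S k (N.restriction S k (cech_map fs p T \<alpha> (S - {k}))) =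
        T S (M.signed S k (M.restriction S k (\<alpha> (S - {k}))))" if "k \<in> S" for k
      using cech_index_Diff[OF S that] commute[OF S that] 1[OF that] 2[OF that]
      by (auto simp: cech_map_def)
    have 4: "M.signed S k (M.restriction S k (\<alpha> (S - {k}))) \<in> carrier (M.Loc S)" if "k \<in> S" for k
      using M.signed_restriction_closed[OF \<alpha> S that] .
    have "cech_diff G R fs N p (cech_map fs p T \<alpha>) S =
        (\<Oplus>\<^bsub>N.Loc S\<^esub>k\<in>S. T S (M.signed S k (M.restriction S k (\<alpha> (S - {k})))))"
      unfolding N.cech_diff_at[OF S] using 3 T.hom_closed[OF 4]
      by (intro T.H.finsum_cong' Pi_I) simp_all
    also have "\<dots> = T S (cech_diff G R fs M p \<alpha> S)"
      unfolding M.cech_diff_at[OF S] using fin 4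
      by (intro T.hom_finsum[symmetric] Pi_I)
    finally show ?thesis .
  qed
  then show ?thesis by (auto simp: cech_map_def cech_diff_def fun_eq_iff)
qed

lemma cech_map_surjective:
  assumes "\<alpha> \<in> extensional (cech_index fs p)"
    and "\<And>S. S \<in> cech_index fs p \<Longrightarrow> \<alpha> S \<in> U S ` A S"
  shows "\<exists>\<beta>\<in>(\<Pi>\<^sub>E S\<in>cech_index fs p. A S). cech_map fs p U \<beta> = \<alpha>"
proof -
  have "\<forall>S\<in>cech_index fs p. \<exists>y. y \<in> A S \<and> U S y = \<alpha> S" using assms(2) by (metis imageE)
  then obtain \<beta> where "\<forall>S\<in>cech_index fs p. \<beta> S \<in> A S \<and> U S (\<beta> S) = \<alpha> S" by metis
  then show ?thesis
    using assms(1)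
    by (intro bexI[of _ "restrict \<beta> (cech_index fs p)"])
      (auto simp: cech_map_def fun_eq_iff extensional_def)
qed


section \<open>Subquotients and homology\<close>

lemma (in abelian_group_hom) a_kernel_iff: "x \<in> a_kernel G H h \<longleftrightarrow> x \<in> carrier G \<and> h x = \<zero>\<^bsub>H\<^esub>"
  by (auto simp: a_kernel_def')

lemma (in abelian_subgroup) coset_eq_iff:
  assumes "x \<in> carrier G"
  shows "H +> x = H \<longleftrightarrow> x \<in> H"
  using a_rcos_self[OF assms] a_rcos_const by metis

lemma (in abelian_group_hom) image_abelian_subgroup: "abelian_subgroup (h ` carrier G) H"
proof (rule abelian_subgroupI3)
  show "additive_subgroup (h ` carrier G) H"
    using group_hom.img_is_subgroup[OF a_group_hom] by (simp add: additive_subgroup_def)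
qed (rule H.abelian_group_axioms)

context linear_map
begin

lemma submodule_kernel: "submodule (a_kernel M N \<phi>) R M"
  by (rule M.submoduleI) (auto simp: a_kernel_iff smult)

lemma submodule_image: "submodule (\<phi> ` carrier M) R N"
proof (rule N.submoduleI)
  fix a b assume "a \<in> \<phi> ` carrier M" "b \<in> \<phi> ` carrier M"
  then show "a \<oplus>\<^bsub>N\<^esub> b \<in> \<phi> ` carrier M" by (auto simp: hom_add[symmetric] simp del: hom_add)
next
  fix a assume "a \<in> \<phi> ` carrier M"
  then show "\<ominus>\<^bsub>N\<^esub> a \<in> \<phi> ` carrier M" by (auto simp: hom_a_inv[symmetric] simp del: hom_a_inv)
next
  fix r a assume "r \<in> carrier R" "a \<in> \<phi> ` carrier M"
  then show "r \<odot>\<^bsub>N\<^esub> a \<in> \<phi> ` carrier M" by (auto simp: smult[symmetric])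
next
  show "\<zero>\<^bsub>N\<^esub> \<in> \<phi> ` carrier M" using hom_zero by (metis imageI M.M.zero_closed)
qed auto

end

lemma linear_mapI:
  assumes "module R M" "module R N"
    and "\<And>x. x \<in> carrier M \<Longrightarrow> \<phi> x \<in> carrier N"
    and "\<And>x y. x \<in> carrier M \<Longrightarrow> y \<in> carrier M \<Longrightarrow> \<phi> (x \<oplus>\<^bsub>M\<^esub> y) = \<phi> x \<oplus>\<^bsub>N\<^esub> \<phi> y"
    and "\<And>r x. r \<in> carrier R \<Longrightarrow> x \<in> carrier M \<Longrightarrow> \<phi> (r \<odot>\<^bsub>M\<^esub> x) = r \<odot>\<^bsub>N\<^esub> \<phi> x"
  shows "linear_map R M N \<phi>"
proof -
  have "abelian_group_hom M N \<phi>"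
    using assms by (intro additive_mapI) (auto intro: module.axioms)
  then show ?thesis using assms by (auto simp: linear_map_def linear_map_axioms_def)
qed

lemma linear_map_compose:
  assumes "linear_map R L M \<phi>" "linear_map R M N \<psi>"
  shows "linear_map R L N (\<lambda>x. \<psi> (\<phi> x))"
proof -
  interpret \<phi>: linear_map R L M \<phi> by fact
  interpret \<psi>: linear_map R M N \<psi> by fact
  show ?thesis
    by (rule linear_mapI) (auto simp: \<phi>.smult \<psi>.smult \<phi>.M.module_axioms \<psi>.N.module_axioms)
qed

text \<open>
  The scalar multiplication of a subquotient is a union over a coset \<open>W + z\<close>; all its members
  coincide, because \<open>r (w + z)\<close> and \<open>r z\<close> differ by an element of the submodule \<open>W\<close>.
\<close>

lemma
  fixes M :: "('g, 'a, 'b) graded_module"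
  assumes M: "module R M" and Z: "submodule Z R M" and W: "submodule W R M" and WZ: "W \<subseteq> Z"
  shows module_subquotient: "module R (subquotient M Z W)"
    and linear_map_subquotient: "linear_map R (M\<lparr>carrier := Z\<rparr>) (subquotient M Z W) (\<lambda>z. W +>\<^bsub>M\<^esub> z)"
proof -
  interpret M: module R M by (rule M)
  have Zmod: "module R (M\<lparr>carrier := Z\<rparr>)" using submodule.submodule_is_module[OF Z M] .
  interpret W: abelian_subgroup W M
  proof (rule abelian_subgroupI3)
    show "additive_subgroup W M"
      using submodule.axioms(1)[OF W] by (simp add: additive_subgroup_def)
  qed (rule M.abelian_group_axioms)
  note Zc = M.submoduleE[OF Z] and Wc = M.submoduleE[OF W]
  have carr: "z \<in> Z \<Longrightarrow> z \<in> carrier M" for z using Zc(1) by blast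
  let ?Q = "subquotient M Z W" and ?c = "\<lambda>z. W +>\<^bsub>M\<^esub> z"
  have Q_carrier: "carrier ?Q = ?c ` Z" and Q_zero: "\<zero>\<^bsub>?Q\<^esub> = ?c \<zero>\<^bsub>M\<^esub>"
    by (simp_all add: subquotient_def W.a_subset)
  have Q_add: "?c x \<oplus>\<^bsub>?Q\<^esub> ?c y = ?c (x \<oplus>\<^bsub>M\<^esub> y)" if "x \<in> Z" "y \<in> Z" for x y
    using W.a_rcos_sum that carr by (simp add: subquotient_def)
  have Q_smult: "r \<odot>\<^bsub>?Q\<^esub> ?c z = ?c (r \<odot>\<^bsub>M\<^esub> z)" if r: "r \<in> carrier R" and z: "z \<in> Z" for r z
  proof -
    have "?c (r \<odot>\<^bsub>M\<^esub> x) = ?c (r \<odot>\<^bsub>M\<^esub> z)" if x: "x \<in> ?c z" for x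
    proof -
      have xM: "x \<in> carrier M" using x z carr W.a_elemrcos_carrier by blast
      have "x \<oplus>\<^bsub>M\<^esub> \<ominus>\<^bsub>M\<^esub> z \<in> W" using x z carr by (intro W.a_rcos_module_imp)
      then have "r \<odot>\<^bsub>M\<^esub> (x \<oplus>\<^bsub>M\<^esub> \<ominus>\<^bsub>M\<^esub> z) \<in> W" using r Wc(4) by blast
      then have "r \<odot>\<^bsub>M\<^esub> x \<oplus>\<^bsub>M\<^esub> \<ominus>\<^bsub>M\<^esub> (r \<odot>\<^bsub>M\<^esub> z) \<in> W"
        using r xM z carr by (simp add: M.smult_r_distr M.smult_r_minus)
      then have "r \<odot>\<^bsub>M\<^esub> x \<in> ?c (r \<odot>\<^bsub>M\<^esub> z)"
        using r xM z carr by (intro W.a_rcos_module_rev) auto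
      then show ?thesis
        using W.a_repr_independence'[of "r \<odot>\<^bsub>M\<^esub> x" "r \<odot>\<^bsub>M\<^esub> z"] r carr[OF z] by simp
    qed
    moreover have "z \<in> ?c z" using z carr W.a_rcos_self by blast
    ultimately have "(\<Union>x\<in>?c z. ?c (r \<odot>\<^bsub>M\<^esub> x)) = ?c (r \<odot>\<^bsub>M\<^esub> z)"
      by (intro UN_constant_eq ballI)
    then show ?thesis by (simp add: subquotient_def)
  qed
  have ab: "abelian_group ?Q"
  proof (rule abelian_groupI)
    fix x assume "x \<in> carrier ?Q"
    then obtain z where z: "z \<in> Z" "x = ?c z" by (auto simp: Q_carrier)
    have zero: "\<zero>\<^bsub>M\<^esub> \<in> Z" using Wc(2) WZ W.zero_closed by blast
    show "\<zero>\<^bsub>?Q\<^esub> \<oplus>\<^bsub>?Q\<^esub> x = x" using z zero carr by (simp add: Q_zero Q_add)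
    have "?c (\<ominus>\<^bsub>M\<^esub> z) \<oplus>\<^bsub>?Q\<^esub> x = \<zero>\<^bsub>?Q\<^esub>"
      unfolding z(2) Q_zero using z Zc(3) carr by (simp add: Q_add M.M.l_neg)
    then show "\<exists>y\<in>carrier ?Q. y \<oplus>\<^bsub>?Q\<^esub> x = \<zero>\<^bsub>?Q\<^esub>" using z Zc(3) by (auto simp: Q_carrier)
    fix y assume "y \<in> carrier ?Q"
    then obtain z' where z': "z' \<in> Z" "y = ?c z'" by (auto simp: Q_carrier)
    show "x \<oplus>\<^bsub>?Q\<^esub> y \<in> carrier ?Q" using z z' Zc(5) by (auto simp: Q_add Q_carrier)
    show "x \<oplus>\<^bsub>?Q\<^esub> y = y \<oplus>\<^bsub>?Q\<^esub> x" using z z' carr by (simp add: Q_add M.M.a_comm)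
    fix u assume "u \<in> carrier ?Q"
    then obtain z'' where z'': "z'' \<in> Z" "u = ?c z''" by (auto simp: Q_carrier)
    show "x \<oplus>\<^bsub>?Q\<^esub> y \<oplus>\<^bsub>?Q\<^esub> u = x \<oplus>\<^bsub>?Q\<^esub> (y \<oplus>\<^bsub>?Q\<^esub> u)"
      using z z' z'' carr Zc(5) by (simp add: Q_add M.M.a_assoc)
  next
    show "\<zero>\<^bsub>?Q\<^esub> \<in> carrier ?Q" unfolding Q_zero Q_carrier using WZ W.zero_closed by (intro imageI) blast
  qed
  show Q: "module R ?Q"
    using M.R.cring_axioms ab carr Zc
    by (intro moduleI)
      (auto simp: Q_carrier Q_smult Q_add M.smult_l_distr M.smult_r_distr M.smult_assoc1)
  show "linear_map R (M\<lparr>carrier := Z\<rparr>) ?Q ?c"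
    by (rule linear_mapI[OF Zmod Q]) (auto simp: Q_carrier Q_add Q_smult)
qed


section \<open>Linear maps on Cech complexes\<close>

definition cech_functor ::
    "('a, 'v) ring_scheme \<Rightarrow> 'a list \<Rightarrow> ('a, 'c, 'w) module_scheme \<Rightarrow> ('b \<Rightarrow> 'c) \<Rightarrow> int
     \<Rightarrow> (nat set \<Rightarrow> ('b \<times> nat) set) \<Rightarrow> (nat set \<Rightarrow> ('c \<times> nat) set)" where
  "cech_functor R fs N \<phi> p = cech_map fs p (\<lambda>S. frac_map R N (cech_elem R fs S) (\<lambda>_. \<phi>))"

locale cech_linear_map = linear_map R M N \<phi> + M: cech_module R M G fs + N: cech_module R N G fs
  for R :: "('g, 'a, 'v) graded_ring_scheme"
  and M :: "('g, 'a, 'b) graded_module"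
  and N :: "('g, 'a, 'c) graded_module"
  and \<phi> :: "'b \<Rightarrow> 'c"
  and G :: "('g, 'u) monoid_scheme" and fs :: "'a list"
begin

abbreviation loc_fun :: "nat set \<Rightarrow> ('b \<times> nat) set \<Rightarrow> ('c \<times> nat) set" where
  "loc_fun S \<equiv> frac_map R N (cech_elem R fs S) (\<lambda>_. \<phi>)"

abbreviation cech_fun :: "int \<Rightarrow> (nat set \<Rightarrow> ('b \<times> nat) set) \<Rightarrow> (nat set \<Rightarrow> ('c \<times> nat) set)" where
  "cech_fun \<equiv> cech_functor R fs N \<phi>"

lemma loc_cases:
  assumes "S \<in> cech_index fs p" "X \<in> carrier (M.Loc S)"
  obtains m n where "m \<in> carrier M" "X = loc_frac R M (cech_elem R fs S) m n"
  using assms(2) unfolding cech_loc_def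
  by (rule module_at.frac_cases[OF M.module_at[OF assms(1)]])

lemma loc_fun_frac:
  assumes "S \<in> cech_index fs p" "m \<in> carrier M"
  shows "loc_fun S (loc_frac R M (cech_elem R fs S) m n) = loc_frac R N (cech_elem R fs S) (\<phi> m) n"
  by (rule frac_map_frac[OF M.cech_elem_closed[OF assms(1)] assms(2)])

lemma loc_fun_hom: "S \<in> cech_index fs p \<Longrightarrow> abelian_group_hom (M.Loc S) (N.Loc S) (loc_fun S)"
  unfolding cech_loc_def
  by (rule fraction_map.frac_map_hom[OF fraction_map[OF M.cech_elem_closed]])

lemma cech_fun_hom: "abelian_group_hom (M.Cech p) (N.Cech p) (cech_fun p)"
  unfolding cech_functor_def
  by (rule cech_map_hom[OF M.cech_module_axioms N.cech_module_axioms loc_fun_hom])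

lemma cech_fun_diff:
  assumes "\<alpha> \<in> carrier (M.Cech p)"
  shows "cech_diff G R fs N p (cech_fun p \<alpha>) = cech_fun (p + 1) (cech_diff G R fs M p \<alpha>)"
  unfolding cech_functor_def
proof (rule cech_map_diff[OF M.cech_module_axioms N.cech_module_axioms loc_fun_hom _ assms])
  fix S k X assume S: "S \<in> cech_index fs (p + 1)" "k \<in> S" and X: "X \<in> carrier (M.Loc (S - {k}))"
  have S': "S - {k} \<in> cech_index fs p" using S by (rule cech_index_Diff)
  have g: "fs ! k \<in> carrier R" using S M.nth_closed by (auto simp: cech_index_def)
  obtain m n where "m \<in> carrier M" "X = loc_frac R M (cech_elem R fs (S - {k})) m n"
    using S' X by (rule loc_cases)
  then show "loc_fun S (M.restriction S k X) = N.restriction S k (loc_fun (S - {k}) X)"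
    using g M.restriction_frac[OF S] N.restriction_frac[OF S] loc_fun_frac[OF S(1)] loc_fun_frac[OF S']
    by (simp add: smult)
qed

text \<open>If \<open>\<phi> m / f\<^sup>n = 0\<close>, then \<open>f\<^sup>k m\<close> is in the kernel of \<open>\<phi>\<close> for some \<open>k\<close>.\<close>

lemma cech_fun_inj:
  assumes inj: "\<And>x. x \<in> carrier M \<Longrightarrow> \<phi> x = \<zero>\<^bsub>N\<^esub> \<Longrightarrow> x = \<zero>\<^bsub>M\<^esub>"
    and \<alpha>: "\<alpha> \<in> carrier (M.Cech p)" and zero: "cech_fun p \<alpha> = \<zero>\<^bsub>N.Cech p\<^esub>"
  shows "\<alpha> = \<zero>\<^bsub>M.Cech p\<^esub>"
proof -
  have "\<alpha> S = \<zero>\<^bsub>M.Loc S\<^esub>" if S: "S \<in> cech_index fs p" for S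
  proof -
    interpret MS: module_at R M G "cech_elem R fs S" using S by (rule M.module_at)
    interpret NS: module_at R N G "cech_elem R fs S" using S by (rule N.module_at)
    have "\<alpha> S \<in> carrier (M.Loc S)" using \<alpha> S by (auto simp: M.Cech_simps)
    then obtain m n where m: "m \<in> carrier M" "\<alpha> S = MS.frac m n" by (rule loc_cases[OF S])
    have "NS.frac (\<phi> m) n = \<zero>\<^bsub>NS.Loc\<^esub>"
      using fun_cong[OF zero, of S] S m loc_fun_frac[OF S]
      by (simp add: cech_functor_def cech_map_def N.Cech_simps cech_loc_def)
    then obtain k :: nat where "\<phi> ((cech_elem R fs S [^]\<^bsub>R\<^esub> k) \<odot>\<^bsub>M\<^esub> m) = \<zero>\<^bsub>N\<^esub>"
      using m(1) by (auto simp: NS.frac_eq_zero_iff smult)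
    then have "(cech_elem R fs S [^]\<^bsub>R\<^esub> k) \<odot>\<^bsub>M\<^esub> m = \<zero>\<^bsub>M\<^esub>" using inj m(1) by auto
    then show ?thesis using m by (auto simp: MS.frac_eq_zero_iff cech_loc_def)
  qed
  then show ?thesis using \<alpha> by (auto simp: M.Cech_simps PiE_iff fun_eq_iff extensional_def)
qed

lemma cech_fun_surj:
  assumes surj: "carrier N \<subseteq> \<phi> ` carrier M" and \<beta>: "\<beta> \<in> carrier (N.Cech p)"
  shows "\<exists>\<alpha>\<in>carrier (M.Cech p). cech_fun p \<alpha> = \<beta>"
  unfolding cech_functor_def M.Cech_simps
proof (rule cech_map_surjective)
  show "\<beta> \<in> extensional (cech_index fs p)" using \<beta> by (auto simp: N.Cech_simps PiE_iff)
  fix S assume S: "S \<in> cech_index fs p"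
  then have "\<beta> S \<in> carrier (localization G R N (cech_elem R fs S))"
    using \<beta> by (auto simp: N.Cech_simps cech_loc_def)
  then obtain x n where x: "x \<in> carrier N" "\<beta> S = loc_frac R N (cech_elem R fs S) x n"
    by (rule module_at.frac_cases[OF N.module_at[OF S]])
  then obtain m where "m \<in> carrier M" "x = \<phi> m" using surj by blast
  then show "\<beta> S \<in> loc_fun S ` carrier (M.Loc S)"
    using x loc_fun_frac[OF S, of m n] module_at.frac_closed[OF M.module_at[OF S], of m n]
    by (auto simp: cech_loc_def)
qed

end

lemma cech_fun_compose:
  assumes \<phi>: "cech_linear_map R L M \<phi> fs" and \<psi>: "cech_linear_map R M N \<psi> fs"
    and \<alpha>: "\<alpha> \<in> carrier (cech_term G R fs L p)"
  shows "cech_functor R fs N \<psi> p (cech_functor R fs M \<phi> p \<alpha>) = cech_functor R fs N (\<lambda>x. \<psi> (\<phi> x)) p \<alpha>"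
proof -
  interpret \<phi>: cech_linear_map R L M \<phi> G fs by (rule \<phi>)
  interpret \<psi>: cech_linear_map R M N \<psi> G fs by (rule \<psi>)
  interpret \<psi>\<phi>: linear_map R L N "\<lambda>x. \<psi> (\<phi> x)"
    by (rule linear_map_compose[OF \<phi>.linear_map_axioms \<psi>.linear_map_axioms])
  interpret \<psi>\<phi>: cech_linear_map R L N "\<lambda>x. \<psi> (\<phi> x)" G fs ..
  have "\<psi>.loc_fun S (\<phi>.loc_fun S (\<alpha> S)) = \<psi>\<phi>.loc_fun S (\<alpha> S)" if S: "S \<in> cech_index fs p" for S
  proof -
    have "\<alpha> S \<in> carrier (\<phi>.M.Loc S)" using \<alpha> S by (auto simp: \<phi>.M.Cech_simps)
    then obtain m n where m: "m \<in> carrier L" "\<alpha> S = loc_frac R L (cech_elem R fs S) m n"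
      by (rule \<phi>.loc_cases[OF S])
    then show ?thesis
      using \<phi>.loc_fun_frac[OF S, of m n] \<psi>.loc_fun_frac[OF S, of "\<phi> m" n] \<psi>\<phi>.loc_fun_frac[OF S, of m n]
      by simp
  qed
  then show ?thesis by (auto simp: cech_functor_def cech_map_def fun_eq_iff)
qed

lemma cech_fun_zero:
  assumes \<phi>: "cech_linear_map R M N \<phi> fs" and zero: "\<And>x. x \<in> carrier M \<Longrightarrow> \<phi> x = \<zero>\<^bsub>N\<^esub>"
    and \<alpha>: "\<alpha> \<in> carrier (cech_term G R fs M p)"
  shows "cech_functor R fs N \<phi> p \<alpha> = \<zero>\<^bsub>cech_term G R fs N p\<^esub>"
proof -
  interpret \<phi>: cech_linear_map R M N \<phi> G fs by (rule \<phi>)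
  have "\<phi>.loc_fun S (\<alpha> S) = \<zero>\<^bsub>cech_loc G R fs N S\<^esub>" if S: "S \<in> cech_index fs p" for S
  proof -
    interpret NS: module_at R N G "cech_elem R fs S" using S by (rule \<phi>.N.module_at)
    have "\<alpha> S \<in> carrier (\<phi>.M.Loc S)" using \<alpha> S by (auto simp: \<phi>.M.Cech_simps)
    then obtain m n where m: "m \<in> carrier M" "\<alpha> S = loc_frac R M (cech_elem R fs S) m n"
      by (rule \<phi>.loc_cases[OF S])
    then show ?thesis
      using \<phi>.loc_fun_frac[OF S, of m n] zero by (simp add: NS.frac_zero cech_loc_def)
  qed
  then show ?thesis by (auto simp: cech_functor_def cech_map_def \<phi>.N.Cech_simps fun_eq_iff)
qed

text \<open>
  Cech cochains are finite products of localizations, and preimages can be chosen factor by factor.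
\<close>

lemma cech_fun_exact:
  assumes \<phi>: "cech_linear_map R L M \<phi> fs" and \<psi>: "cech_linear_map R M N \<psi> fs"
    and exact: "\<And>x. x \<in> carrier M \<Longrightarrow> \<psi> x = \<zero>\<^bsub>N\<^esub> \<Longrightarrow> x \<in> \<phi> ` carrier L"
    and \<alpha>: "\<alpha> \<in> carrier (cech_term G R fs M p)"
    and zero: "cech_functor R fs N \<psi> p \<alpha> = \<zero>\<^bsub>cech_term G R fs N p\<^esub>"
  shows "\<exists>\<beta>\<in>carrier (cech_term G R fs L p). cech_functor R fs M \<phi> p \<beta> = \<alpha>"
proof -
  interpret \<phi>: cech_linear_map R L M \<phi> G fs by (rule \<phi>)
  interpret \<psi>: cech_linear_map R M N \<psi> G fs by (rule \<psi>)
  show ?thesis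
    unfolding cech_functor_def \<phi>.M.Cech_simps
  proof (rule cech_map_surjective)
    show "\<alpha> \<in> extensional (cech_index fs p)" using \<alpha> by (auto simp: \<phi>.N.Cech_simps PiE_iff)
    fix S assume S: "S \<in> cech_index fs p"
    have "\<psi>.loc_fun S (\<alpha> S) = \<zero>\<^bsub>\<psi>.N.Loc S\<^esub>"
      using fun_cong[OF zero, of S] S by (simp add: cech_functor_def cech_map_def \<psi>.N.Cech_simps)
    moreover have "\<alpha> S \<in> carrier (\<phi>.N.Loc S)" using \<alpha> S by (auto simp: \<phi>.N.Cech_simps)
    ultimately show "\<alpha> S \<in> \<phi>.loc_fun S ` carrier (\<phi>.M.Loc S)"
      unfolding cech_loc_def
      using localization_exact[OF \<phi>.linear_map_axioms \<psi>.linear_map_axioms \<phi>.M.cech_elem_closed[OF S] exact]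
      by blast
  qed
qed


section \<open>Homogeneous parts of the Cech complex\<close>

text \<open>
  The degrees of the generators are a parameter, because a generator that is zero does not
  determine its degree.
\<close>

locale graded_cech = graded_module G R M
  for G :: "('g, 'u) monoid_scheme" (structure)
  and R :: "('g, 'a, 'v) graded_ring_scheme" (structure)
  and M :: "('g, 'a, 'b) graded_module" (structure) +
  fixes fs :: "'a list" and deg :: "nat \<Rightarrow> 'g"
  assumes deg_closed: "k < length fs \<Longrightarrow> deg k \<in> carrier G"
    and fs_homogeneous: "k < length fs \<Longrightarrow> fs ! k \<in> ring_part R (deg k)"
begin

sublocale cech_module R M G fs
proof unfold_locales
  show "set fs \<subseteq> carrier R"
    using grading.P_closed[OF deg_closed fs_homogeneous] by (auto simp: in_set_conv_nth)
qed

abbreviation degree :: "nat set \<Rightarrow> 'g" where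
  "degree S \<equiv> finprod G deg S"

text \<open>
  The component of degree \<open>\<gamma>\<close> of \<open>m / f\<^sup>n\<close> has as its numerator the component of \<open>m\<close> in the degree
  \<open>\<gamma>\<close> times the degree of \<open>f\<^sup>n\<close>.
\<close>

definition loc_proj :: "'g \<Rightarrow> nat set \<Rightarrow> ('b \<times> nat) set \<Rightarrow> ('b \<times> nat) set" where
  "loc_proj \<gamma> S =
     frac_map R M (cech_elem R fs S) (\<lambda>n. mod_grading.part (\<gamma> \<otimes>\<^bsub>G\<^esub> degree S [^]\<^bsub>G\<^esub> n))"

definition cech_proj :: "'g \<Rightarrow> int \<Rightarrow> (nat set \<Rightarrow> ('b \<times> nat) set) \<Rightarrow> (nat set \<Rightarrow> ('b \<times> nat) set)" where
  "cech_proj \<gamma> p = cech_map fs p (loc_proj \<gamma>)"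

lemma degree_closed: "S \<in> cech_index fs p \<Longrightarrow> degree S \<in> carrier G"
  by (intro G.finprod_closed) (auto simp: cech_index_def intro!: deg_closed)

lemma cech_elem_homogeneous:
  assumes "S \<in> cech_index fs p"
  shows "cech_elem R fs S \<in> ring_part R (degree S)"
  unfolding cech_elem_def
  using assms cech_index_finite[OF assms]
  by (intro finprod_homogeneous) (auto simp: cech_index_def intro!: deg_closed fs_homogeneous)

lemma degree_remove:
  assumes "S \<in> cech_index fs p" "k \<in> S"
  shows "degree S = degree (S - {k}) \<otimes>\<^bsub>G\<^esub> deg k"
proof -
  have S: "deg \<in> S \<rightarrow> carrier G" "finite S"
    using assms deg_closed cech_index_finite[OF assms(1)] by (auto simp: cech_index_def)
  have "degree (insert k (S - {k})) = deg k \<otimes>\<^bsub>G\<^esub> degree (S - {k})"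
    using S assms by (intro G.finprod_insert) auto
  moreover have "insert k (S - {k}) = S" using assms by auto
  moreover have "degree (S - {k}) \<in> carrier G" "deg k \<in> carrier G"
    using S assms by (auto intro!: G.finprod_closed)
  ultimately show ?thesis by (simp add: G.m_comm)
qed

lemma loc_proj_fraction_map:
  assumes S: "S \<in> cech_index fs p" and \<gamma>: "\<gamma> \<in> carrier G"
  shows "fraction_map R M M (cech_elem R fs S) (cech_elem R fs S)
    (\<lambda>n. mod_grading.part (\<gamma> \<otimes>\<^bsub>G\<^esub> degree S [^]\<^bsub>G\<^esub> n))"
proof (intro fraction_map.intro fraction_map_axioms.intro module_at[OF S])
  note D = degree_closed[OF S]
  show "abelian_group_hom M M (mod_grading.part (\<gamma> \<otimes>\<^bsub>G\<^esub> degree S [^]\<^bsub>G\<^esub> n))" for n :: nat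
    using D \<gamma> by (intro mod_grading.part_hom) simp
  show "(cech_elem R fs S [^]\<^bsub>R\<^esub> j) \<odot>\<^bsub>M\<^esub> mod_grading.part (\<gamma> \<otimes>\<^bsub>G\<^esub> degree S [^]\<^bsub>G\<^esub> n) m =
      mod_grading.part (\<gamma> \<otimes>\<^bsub>G\<^esub> degree S [^]\<^bsub>G\<^esub> (n + j)) ((cech_elem R fs S [^]\<^bsub>R\<^esub> j) \<odot>\<^bsub>M\<^esub> m)"
    if m: "m \<in> carrier M" for m and n j :: nat
    using part_smult[OF pow_homogeneous[OF cech_elem_homogeneous[OF S] D, of j], of "\<gamma> \<otimes>\<^bsub>G\<^esub> degree S [^]\<^bsub>G\<^esub> n" m]
      D \<gamma> m by (simp add: G.m_assoc G.nat_pow_mult)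
qed

lemma loc_proj_frac:
  assumes "S \<in> cech_index fs p" "\<gamma> \<in> carrier G" "m \<in> carrier M"
  shows "loc_proj \<gamma> S (loc_frac R M (cech_elem R fs S) m n) =
    loc_frac R M (cech_elem R fs S) (mod_grading.part (\<gamma> \<otimes>\<^bsub>G\<^esub> degree S [^]\<^bsub>G\<^esub> n) m) n"
  unfolding loc_proj_def
  by (rule fraction_map.frac_map_frac[OF loc_proj_fraction_map]) fact+

lemma loc_proj_hom:
  assumes "S \<in> cech_index fs p" "\<gamma> \<in> carrier G"
  shows "abelian_group_hom (Loc S) (Loc S) (loc_proj \<gamma> S)"
  unfolding loc_proj_def cech_loc_def
  by (rule fraction_map.frac_map_hom[OF loc_proj_fraction_map]) fact+

lemma cech_proj_hom:
  "\<gamma> \<in> carrier G \<Longrightarrow> abelian_group_hom (Cech p) (Cech p) (cech_proj \<gamma> p)"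
  unfolding cech_proj_def
  by (rule cech_map_hom[OF cech_module_axioms cech_module_axioms loc_proj_hom])

lemma loc_cases:
  assumes "S \<in> cech_index fs p" "X \<in> carrier (Loc S)"
  obtains m n where "m \<in> carrier M" "X = loc_frac R M (cech_elem R fs S) m n"
  using assms(2) unfolding cech_loc_def
  by (rule module_at.frac_cases[OF module_at[OF assms(1)]])

text \<open>
  A restriction multiplies the numerator of a fraction with exponent \<open>n\<close> by the \<open>n\<close>-th power of a
  generator, whose degree is the quotient of the degrees of the new and the old denominator.
\<close>

lemma cech_proj_diff:
  assumes \<gamma>: "\<gamma> \<in> carrier G" and \<alpha>: "\<alpha> \<in> carrier (Cech p)"
  shows "cech_diff G R fs M p (cech_proj \<gamma> p \<alpha>) = cech_proj \<gamma> (p + 1) (cech_diff G R fs M p \<alpha>)"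
  unfolding cech_proj_def
proof (rule cech_map_diff[OF cech_module_axioms cech_module_axioms loc_proj_hom[OF _ \<gamma>] _ \<alpha>])
  fix S k X assume S: "S \<in> cech_index fs (p + 1)" "k \<in> S" and X: "X \<in> carrier (Loc (S - {k}))"
  have S': "S - {k} \<in> cech_index fs p" using S by (rule cech_index_Diff)
  have k: "k < length fs" using S by (auto simp: cech_index_def)
  note D = degree_closed[OF S']
  obtain m n where m: "m \<in> carrier M" "X = loc_frac R M (cech_elem R fs (S - {k})) m n"
    using S' X by (rule loc_cases)
  have "\<gamma> \<otimes>\<^bsub>G\<^esub> degree S [^]\<^bsub>G\<^esub> n = (\<gamma> \<otimes>\<^bsub>G\<^esub> degree (S - {k}) [^]\<^bsub>G\<^esub> n) \<otimes>\<^bsub>G\<^esub> deg k [^]\<^bsub>G\<^esub> n"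
    using D \<gamma> deg_closed[OF k] by (simp add: degree_remove[OF S] G.nat_pow_distrib G.m_assoc)
  then have part: "mod_grading.part (\<gamma> \<otimes>\<^bsub>G\<^esub> degree S [^]\<^bsub>G\<^esub> n) (((fs ! k) [^]\<^bsub>R\<^esub> n) \<odot>\<^bsub>M\<^esub> m) =
      ((fs ! k) [^]\<^bsub>R\<^esub> n) \<odot>\<^bsub>M\<^esub> mod_grading.part (\<gamma> \<otimes>\<^bsub>G\<^esub> degree (S - {k}) [^]\<^bsub>G\<^esub> n) m"
    using part_smult[OF pow_homogeneous[OF fs_homogeneous[OF k] deg_closed[OF k], of n],
        of "\<gamma> \<otimes>\<^bsub>G\<^esub> degree (S - {k}) [^]\<^bsub>G\<^esub> n" m] D \<gamma> m deg_closed[OF k]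
    by simp
  have "mod_grading.part (\<gamma> \<otimes>\<^bsub>G\<^esub> degree (S - {k}) [^]\<^bsub>G\<^esub> n) m \<in> carrier M"
    using D \<gamma> m(1) by (intro abelian_group_hom.hom_closed[OF mod_grading.part_hom]) auto
  then show "loc_proj \<gamma> S (restriction S k X) = restriction S k (loc_proj \<gamma> (S - {k}) X)"
    using m \<gamma> nth_closed[OF k] part
    by (simp add: restriction_frac[OF S] loc_proj_frac[OF S(1)] loc_proj_frac[OF S'])
qed

text \<open>
  The degree of \<open>f\<^sup>n\<close> is determined unless \<open>f\<^sup>n = 0\<close>, in which case \<open>M\<^sub>f = 0\<close>; so the homogeneous
  elements of degree \<open>\<gamma>\<close> are the fixed points of the projection.
\<close>

lemma mod_part_Loc_iff:
  assumes S: "S \<in> cech_index fs p" and \<gamma>: "\<gamma> \<in> carrier G"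
  shows "X \<in> mod_part (Loc S) \<gamma> \<longleftrightarrow> X \<in> carrier (Loc S) \<and> loc_proj \<gamma> S X = X"
proof -
  interpret L: module_at R M G "cech_elem R fs S" using S by (rule module_at)
  note D = degree_closed[OF S]
  note f = pow_homogeneous[OF cech_elem_homogeneous[OF S] D]
  have mod_part_eq: "mod_part (Loc S) \<gamma> = {L.frac m n | m n \<delta>. \<delta> \<in> carrier G \<and>
      cech_elem R fs S [^]\<^bsub>R\<^esub> n \<in> ring_part R \<delta> \<and> m \<in> mod_part M (\<gamma> \<otimes>\<^bsub>G\<^esub> \<delta>)}"
    by (simp add: cech_loc_def localization_def)
  show ?thesis
  proof
    assume "X \<in> mod_part (Loc S) \<gamma>"
    then obtain m n \<delta> where \<delta>: "\<delta> \<in> carrier G" "cech_elem R fs S [^]\<^bsub>R\<^esub> n \<in> ring_part R \<delta>"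
        "m \<in> mod_part M (\<gamma> \<otimes>\<^bsub>G\<^esub> \<delta>)" and X: "X = L.frac m n"
      by (auto simp: mod_part_eq)
    then have m: "m \<in> carrier M" using \<gamma> mod_grading.P_closed[of "\<gamma> \<otimes>\<^bsub>G\<^esub> \<delta>" m] by simp
    interpret e: abelian_group_hom "Loc S" "Loc S" "loc_proj \<gamma> S" using S \<gamma> by (rule loc_proj_hom)
    show "X \<in> carrier (Loc S) \<and> loc_proj \<gamma> S X = X"
    proof (cases "cech_elem R fs S [^]\<^bsub>R\<^esub> n = \<zero>\<^bsub>R\<^esub>")
      case True
      then have "\<exists>k::nat. (cech_elem R fs S [^]\<^bsub>R\<^esub> k) \<odot>\<^bsub>M\<^esub> m = \<zero>\<^bsub>M\<^esub>"
        using m by (intro exI[of _ n]) simp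
      then have "X = \<zero>\<^bsub>Loc S\<^esub>"
        using m X by (simp add: L.frac_eq_zero_iff cech_loc_def)
      then show ?thesis by simp
    next
      case False
      then have "\<delta> = degree S [^]\<^bsub>G\<^esub> n"
        using f[of n] \<delta> D by (intro grading.homogeneous_degree_unique) auto
      then show ?thesis
        using X m \<delta> \<gamma> D loc_proj_frac[OF S \<gamma> m, of n] L.frac_closed[OF m, of n]
          mod_grading.part_homogeneous[of "\<gamma> \<otimes>\<^bsub>G\<^esub> \<delta>" m "\<gamma> \<otimes>\<^bsub>G\<^esub> \<delta>"]
        by (simp add: cech_loc_def)
    qed
  next
    assume "X \<in> carrier (Loc S) \<and> loc_proj \<gamma> S X = X"
    then have X: "X \<in> carrier (Loc S)" "loc_proj \<gamma> S X = X" by auto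
    obtain m n where m: "m \<in> carrier M" "X = L.frac m n" using S X(1) by (rule loc_cases)
    let ?\<delta> = "degree S [^]\<^bsub>G\<^esub> n"
    have "X = L.frac (mod_grading.part (\<gamma> \<otimes>\<^bsub>G\<^esub> ?\<delta>) m) n"
      using X(2) m loc_proj_frac[OF S \<gamma> m(1)] by simp
    moreover have "?\<delta> \<in> carrier G" "cech_elem R fs S [^]\<^bsub>R\<^esub> n \<in> ring_part R ?\<delta>"
        "mod_grading.part (\<gamma> \<otimes>\<^bsub>G\<^esub> ?\<delta>) m \<in> mod_part M (\<gamma> \<otimes>\<^bsub>G\<^esub> ?\<delta>)"
      using f[of n] D \<gamma> m mod_grading.part_in_P[of m "\<gamma> \<otimes>\<^bsub>G\<^esub> ?\<delta>"] by simp_all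
    ultimately show "X \<in> mod_part (Loc S) \<gamma>" unfolding mod_part_eq by blast
  qed
qed

lemma mod_part_Cech_eq:
  assumes \<gamma>: "\<gamma> \<in> carrier G"
  shows "mod_part (Cech p) \<gamma> = {\<alpha> \<in> carrier (Cech p). cech_proj \<gamma> p \<alpha> = \<alpha>}"
proof -
  have "mod_part (Cech p) \<gamma> = (\<Pi>\<^sub>E S\<in>cech_index fs p. mod_part (Loc S) \<gamma>)"
    by (simp add: cech_term_def)
  then show ?thesis
    using mod_part_Loc_iff[OF _ \<gamma>]
    by (auto simp: Cech_simps cech_proj_def cech_map_def PiE_iff fun_eq_iff extensional_def)
qed

lemma cech_proj_idem:
  assumes \<gamma>: "\<gamma> \<in> carrier G" and \<alpha>: "\<alpha> \<in> carrier (Cech p)"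
  shows "cech_proj \<gamma> p (cech_proj \<gamma> p \<alpha>) = cech_proj \<gamma> p \<alpha>"
proof -
  have "loc_proj \<gamma> S (loc_proj \<gamma> S (\<alpha> S)) = loc_proj \<gamma> S (\<alpha> S)" if S: "S \<in> cech_index fs p" for S
  proof -
    have "\<alpha> S \<in> carrier (Loc S)" using \<alpha> S by (auto simp: Cech_simps)
    then obtain m n where m: "m \<in> carrier M" "\<alpha> S = loc_frac R M (cech_elem R fs S) m n"
      by (rule loc_cases[OF S])
    let ?\<delta> = "\<gamma> \<otimes>\<^bsub>G\<^esub> degree S [^]\<^bsub>G\<^esub> n"
    have \<delta>: "?\<delta> \<in> carrier G" using degree_closed[OF S] \<gamma> by simp
    then have "mod_grading.part ?\<delta> m \<in> mod_part M ?\<delta>"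
      using m(1) by (intro mod_grading.part_in_P)
    then show ?thesis
      using m(2) loc_proj_frac[OF S \<gamma>] m(1) mod_grading.P_closed[OF \<delta>]
        mod_grading.part_homogeneous[OF \<delta> _ \<delta>] by simp
  qed
  then show ?thesis by (auto simp: cech_proj_def cech_map_def fun_eq_iff)
qed

lemma cech_proj_in_mod_part:
  assumes "\<gamma> \<in> carrier G" "\<alpha> \<in> carrier (Cech p)"
  shows "cech_proj \<gamma> p \<alpha> \<in> mod_part (Cech p) \<gamma>"
  using assms mod_part_Cech_eq cech_proj_idem abelian_group_hom.hom_closed[OF cech_proj_hom] by auto

end

lemma cech_functor_proj:
  assumes M: "graded_cech G R M fs deg" and N: "graded_cech G R N fs deg"
    and \<phi>: "cech_linear_map R M N \<phi> fs"
    and \<phi>_degree: "\<And>\<gamma> x. \<gamma> \<in> carrier G \<Longrightarrow> x \<in> mod_part M \<gamma> \<Longrightarrow> \<phi> x \<in> mod_part N \<gamma>"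
    and \<gamma>: "\<gamma> \<in> carrier G" and \<alpha>: "\<alpha> \<in> carrier (cech_term G R fs M p)"
  shows "graded_cech.cech_proj G R N fs deg \<gamma> p (cech_functor R fs N \<phi> p \<alpha>) =
    cech_functor R fs N \<phi> p (graded_cech.cech_proj G R M fs deg \<gamma> p \<alpha>)"
proof -
  interpret M: graded_cech G R M fs deg by (rule M)
  interpret N: graded_cech G R N fs deg by (rule N)
  interpret \<phi>: cech_linear_map R M N \<phi> G fs by (rule \<phi>)
  have "N.loc_proj \<gamma> S (\<phi>.loc_fun S (\<alpha> S)) = \<phi>.loc_fun S (M.loc_proj \<gamma> S (\<alpha> S))"
    if S: "S \<in> cech_index fs p" for S
  proof -
    have "\<alpha> S \<in> carrier (M.Loc S)" using \<alpha> S by (auto simp: M.Cech_simps)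
    then obtain m n where m: "m \<in> carrier M" "\<alpha> S = loc_frac R M (cech_elem R fs S) m n"
      by (rule M.loc_cases[OF S])
    let ?\<delta> = "\<gamma> \<otimes>\<^bsub>G\<^esub> M.degree S [^]\<^bsub>G\<^esub> n"
    have \<delta>: "?\<delta> \<in> carrier G" using M.degree_closed[OF S] \<gamma> by simp
    have "N.mod_grading.part (id ?\<delta>) (\<phi> m) = \<phi> (M.mod_grading.part ?\<delta> m)"
      using \<phi>_degree \<delta> m(1)
      by (intro part_commute[OF M.mod_direct_sum' N.mod_direct_sum' \<phi>.abelian_group_hom_axioms]) auto
    moreover have "M.mod_grading.part ?\<delta> m \<in> carrier M"
      using m(1) \<delta> by (intro abelian_group_hom.hom_closed[OF M.mod_grading.part_hom])
    ultimately show ?thesis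
      using m(2) M.loc_proj_frac[OF S \<gamma> m(1)] N.loc_proj_frac[OF S \<gamma> \<phi>.hom_closed[OF m(1)]]
        \<phi>.loc_fun_frac[OF S m(1)] \<phi>.loc_fun_frac[OF S, of "M.mod_grading.part ?\<delta> m"] by simp
  qed
  then show ?thesis
    by (auto simp: M.cech_proj_def N.cech_proj_def cech_functor_def cech_map_def fun_eq_iff)
qed


section \<open>The double complex of a graded complex\<close>

lemma fixed_points_abelian_group:
  assumes "abelian_group_hom M M e"
  shows "abelian_group (M\<lparr>carrier := {x \<in> carrier M. e x = x}\<rparr>)"
proof -
  interpret e: abelian_group_hom M M e by (rule assms)
  show ?thesis
  proof (rule abelian_groupI, goal_cases)
    case (6 x)
    then show ?case by (intro bexI[of _ "\<ominus>\<^bsub>M\<^esub> x"]) (auto simp: e.G.l_neg)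
  qed (auto simp: e.G.a_ac)
qed

lemma restricted_hom:
  assumes h: "abelian_group_hom M N h"
    and "abelian_group (M\<lparr>carrier := P\<rparr>)" "abelian_group (N\<lparr>carrier := Q\<rparr>)"
    and "P \<subseteq> carrier M" "\<And>x. x \<in> P \<Longrightarrow> h x \<in> Q"
  shows "abelian_group_hom (M\<lparr>carrier := P\<rparr>) (N\<lparr>carrier := Q\<rparr>) h"
proof -
  interpret h: abelian_group_hom M N h by (rule h)
  show ?thesis
    using assms h.hom_add[of x y for x y] by (intro additive_mapI) (simp_all add: subset_iff)
qed

context cech_module
begin

lemma cocycle_iff:
  "x \<in> a_kernel (Cech p) (Cech (p + 1)) (cech_diff G R fs M p) \<longleftrightarrow>
    x \<in> carrier (Cech p) \<and> cech_diff G R fs M p x = \<zero>\<^bsub>Cech (p + 1)\<^esub>"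
  using abelian_group_hom.a_kernel_iff[OF cech_diff_hom] .

lemma cech_diff_from: "abelian_group_hom (Cech (p - 1)) (Cech p) (cech_diff G R fs M (p - 1))"
  using cech_diff_hom[of "p - 1"] by simp

lemma coboundary_coset_eq_iff:
  assumes "x \<in> carrier (Cech p)"
  shows "(cech_diff G R fs M (p - 1) ` carrier (Cech (p - 1))) +>\<^bsub>Cech p\<^esub> x =
      cech_diff G R fs M (p - 1) ` carrier (Cech (p - 1)) \<longleftrightarrow>
    x \<in> cech_diff G R fs M (p - 1) ` carrier (Cech (p - 1))"
  using abelian_subgroup.coset_eq_iff[OF abelian_group_hom.image_abelian_subgroup[OF cech_diff_from] assms] .

lemma zero_local_cohomologyD:
  assumes zero: "zero_module (local_cohomology G R fs p M)"
    and x: "x \<in> carrier (Cech p)" "cech_diff G R fs M p x = \<zero>\<^bsub>Cech (p + 1)\<^esub>"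
  shows "x \<in> cech_diff G R fs M (p - 1) ` carrier (Cech (p - 1))"
proof -
  let ?W = "cech_diff G R fs M (p - 1) ` carrier (Cech (p - 1))"
  have "?W +>\<^bsub>Cech p\<^esub> x \<in> carrier (local_cohomology G R fs p M)"
    using x by (auto simp: local_cohomology_def homology_at_def subquotient_def cocycle_iff)
  then have "?W +>\<^bsub>Cech p\<^esub> x = ?W"
    using zero by (simp add: zero_module_def local_cohomology_def homology_at_def subquotient_def)
  then show ?thesis using coboundary_coset_eq_iff[OF x(1)] by simp
qed

text \<open>
  For a module without grading axioms the homogeneous part of the cochains could be empty, and
  so differ from \<open>{0}\<close> without containing a cochain; hence the condition on the zero cochain.
\<close>

lemma Supp_local_cohomology_iff:
  assumes "\<gamma> \<in> carrier G" "\<zero>\<^bsub>Cech p\<^esub> \<in> mod_part (Cech p) \<gamma>"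
  shows "\<gamma> \<in> Supp G (local_cohomology G R fs p M) \<longleftrightarrow>
    (\<exists>x\<in>carrier (Cech p). x \<in> mod_part (Cech p) \<gamma> \<and> cech_diff G R fs M p x = \<zero>\<^bsub>Cech (p + 1)\<^esub> \<and>
      x \<notin> cech_diff G R fs M (p - 1) ` carrier (Cech (p - 1)))"
proof -
  let ?W = "cech_diff G R fs M (p - 1) ` carrier (Cech (p - 1))"
  let ?K = "a_kernel (Cech p) (Cech (p + 1)) (cech_diff G R fs M p) \<inter> mod_part (Cech p) \<gamma>"
  interpret d: abelian_group_hom "Cech p" "Cech (p + 1)" "cech_diff G R fs M p" by (rule cech_diff_hom)
  have "\<gamma> \<in> Supp G (local_cohomology G R fs p M) \<longleftrightarrow> (\<lambda>z. ?W +>\<^bsub>Cech p\<^esub> z) ` ?K \<noteq> {?W}"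
    using assms(1)
    by (simp add: Supp_def local_cohomology_def homology_at_def subquotient_def)
  also have "\<dots> \<longleftrightarrow> (\<exists>x\<in>?K. ?W +>\<^bsub>Cech p\<^esub> x \<noteq> ?W)"
  proof -
    have "\<zero>\<^bsub>Cech p\<^esub> \<in> ?K" using assms(2) by (simp add: cocycle_iff)
    then show ?thesis by blast
  qed
  also have "\<dots> \<longleftrightarrow> (\<exists>x\<in>?K. x \<notin> ?W)"
    using coboundary_coset_eq_iff by (intro bex_cong refl) (auto simp: cocycle_iff)
  finally show ?thesis by (auto simp: cocycle_iff)
qed

end

locale cech_double_complex = graded_complex G R C d
  for G :: "('g, 'u) monoid_scheme" (structure)
  and R :: "('g, 'a, 'v) graded_ring_scheme" (structure)
  and C :: "int \<Rightarrow> ('g, 'a, 'b) graded_module"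
  and d :: "int \<Rightarrow> 'b \<Rightarrow> 'b" +
  fixes fs :: "'a list" and deg :: "nat \<Rightarrow> 'g" and \<gamma> :: 'g
  assumes deg_closed: "k < length fs \<Longrightarrow> deg k \<in> carrier G"
    and fs_homogeneous: "k < length fs \<Longrightarrow> fs ! k \<in> ring_part R (deg k)"
    and \<gamma>_closed: "\<gamma> \<in> carrier G"
begin

abbreviation K :: "int \<Rightarrow> int \<Rightarrow> ('g, 'a, nat set \<Rightarrow> ('b \<times> nat) set) graded_module" where
  "K p q \<equiv> cech_term G R fs (C q) p"

abbreviation \<delta> :: "int \<Rightarrow> int \<Rightarrow> (nat set \<Rightarrow> ('b \<times> nat) set) \<Rightarrow> (nat set \<Rightarrow> ('b \<times> nat) set)" where
  "\<delta> p q \<equiv> cech_diff G R fs (C q) p"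

abbreviation D :: "int \<Rightarrow> int \<Rightarrow> (nat set \<Rightarrow> ('b \<times> nat) set) \<Rightarrow> (nat set \<Rightarrow> ('b \<times> nat) set)" where
  "D p q \<equiv> cech_functor R fs (C (q - 1)) (d q) p"

abbreviation proj :: "int \<Rightarrow> int \<Rightarrow> (nat set \<Rightarrow> ('b \<times> nat) set) \<Rightarrow> (nat set \<Rightarrow> ('b \<times> nat) set)" where
  "proj p q \<equiv> graded_cech.cech_proj G R (C q) fs deg \<gamma> p"

abbreviation K_part :: "int \<Rightarrow> int \<Rightarrow> ('g, 'a, nat set \<Rightarrow> ('b \<times> nat) set) graded_module" where
  "K_part p q \<equiv> K p q\<lparr>carrier := mod_part (K p q) \<gamma>\<rparr>"

lemma graded_cech: "graded_cech G R (C q) fs deg"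
  using graded_module by (simp add: graded_cech_def graded_cech_axioms_def deg_closed fs_homogeneous)

lemma cech_module: "cech_module R (C q) fs"
proof -
  interpret graded_cech G R "C q" fs deg by (rule graded_cech)
  show ?thesis by (rule cech_module_axioms)
qed

lemma module_C: "module R (C q)"
  using cech_module by (rule cech_module.axioms(1))

lemma linear_map_cech_linear_map:
  assumes "linear_map R M N \<phi>"
  shows "cech_linear_map R M N \<phi> fs"
  using assms cech_module.axioms(2)[OF cech_module]
  by (simp add: cech_linear_map_def cech_module_def linear_map_def)

lemma linear_map_d: "linear_map R (C q) (C (q - 1)) (d q)"
  using diff_hom[of q] diff_smult[of _ _ q]
  by (intro linear_mapI module_C) (auto simp: hom_def)

lemma linear_map_d_from: "linear_map R (C (q + 1)) (C q) (d (q + 1))"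
  using linear_map_d[of "q + 1"] by simp

lemmas cech_linear_map_d = linear_map_cech_linear_map[OF linear_map_d]

lemma D_hom: "abelian_group_hom (K p q) (K p (q - 1)) (D p q)"
  by (rule cech_linear_map.cech_fun_hom[OF cech_linear_map_d])

lemma D_hom_from: "abelian_group_hom (K p (q + 1)) (K p q) (D p (q + 1))"
  using D_hom[where p = p and q = "q + 1"] by simp

lemma \<delta>_hom: "abelian_group_hom (K p q) (K (p + 1) q) (\<delta> p q)"
  by (rule cech_module.cech_diff_hom[OF cech_module])

lemma \<delta>_hom_from: "abelian_group_hom (K (p - 1) q) (K p q) (\<delta> (p - 1) q)"
  by (rule cech_module.cech_diff_from[OF cech_module])

lemma proj_hom: "abelian_group_hom (K p q) (K p q) (proj p q)"
  by (rule graded_cech.cech_proj_hom[OF graded_cech \<gamma>_closed])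

lemma mod_part_Cech: "mod_part (K p q) \<gamma> = {x \<in> carrier (K p q). proj p q x = x}"
  by (rule graded_cech.mod_part_Cech_eq[OF graded_cech \<gamma>_closed])

lemma proj_in_mod_part: "x \<in> carrier (K p q) \<Longrightarrow> proj p q x \<in> mod_part (K p q) \<gamma>"
  by (rule graded_cech.cech_proj_in_mod_part[OF graded_cech \<gamma>_closed])

lemma proj_\<delta>: "x \<in> carrier (K p q) \<Longrightarrow> \<delta> p q (proj p q x) = proj (p + 1) q (\<delta> p q x)"
  by (rule graded_cech.cech_proj_diff[OF graded_cech \<gamma>_closed])

lemma proj_\<delta>_from: "x \<in> carrier (K (p - 1) q) \<Longrightarrow> \<delta> (p - 1) q (proj (p - 1) q x) = proj p q (\<delta> (p - 1) q x)"
  using proj_\<delta>[where x = x and p = "p - 1" and q = q] by simp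

lemma proj_D: "x \<in> carrier (K p q) \<Longrightarrow> D p q (proj p q x) = proj p (q - 1) (D p q x)"
  using diff_degree
  by (intro cech_functor_proj[OF graded_cech graded_cech cech_linear_map_d _ \<gamma>_closed, symmetric])

lemma proj_D_from: "x \<in> carrier (K p (q + 1)) \<Longrightarrow> D p (q + 1) (proj p (q + 1) x) = proj p q (D p (q + 1) x)"
  using proj_D[where x = x and p = p and q = "q + 1"] by simp

lemma abelian_group_K_part: "abelian_group (K_part p q)"
  unfolding mod_part_Cech by (rule fixed_points_abelian_group[OF proj_hom])

lemma D_D: "x \<in> carrier (K p q) \<Longrightarrow> D p (q - 1) (D p q x) = \<zero>\<^bsub>K p (q - 2)\<^esub>"
proof -
  assume x: "x \<in> carrier (K p q)"
  have eq: "q - 1 - 1 = q - 2" by simp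
  have d': "linear_map R (C (q - 1)) (C (q - 2)) (d (q - 1))"
    using linear_map_d[of "q - 1"] unfolding eq .
  have "linear_map R (C q) (C (q - 2)) (\<lambda>x. d (q - 1) (d q x))"
    by (rule linear_map_compose[OF linear_map_d d'])
  then have "cech_functor R fs (C (q - 2)) (\<lambda>x. d (q - 1) (d q x)) p x = \<zero>\<^bsub>K p (q - 2)\<^esub>"
    using diff_diff x by (intro cech_fun_zero linear_map_cech_linear_map)
  then show ?thesis
    unfolding eq
    using cech_fun_compose[OF cech_linear_map_d linear_map_cech_linear_map[OF d'] x] by simp
qed

lemma bounded:
  assumes "p < 0 \<or> int (length fs) < p"
  shows "carrier (K_part p q) = {\<zero>\<^bsub>K_part p q\<^esub>}"
  using cech_index_empty[OF assms] by (simp add: cech_term_def restrict_def)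

sublocale dc: double_complex K_part \<delta> D "int (length fs)"
proof (rule double_complex.intro)
  fix p q :: int
  have "\<delta> p q x \<in> mod_part (K (p + 1) q) \<gamma>" if "x \<in> mod_part (K p q) \<gamma>" for x
    using that proj_\<delta>[where x = x and p = p and q = q] abelian_group_hom.hom_closed[OF \<delta>_hom] by (simp add: mod_part_Cech)
  then show "abelian_group_hom (K_part p q) (K_part (p + 1) q) (\<delta> p q)"
    by (intro restricted_hom[OF \<delta>_hom] abelian_group_K_part) (auto simp: mod_part_Cech)
  have "D p q x \<in> mod_part (K p (q - 1)) \<gamma>" if "x \<in> mod_part (K p q) \<gamma>" for x
    using that proj_D[where x = x and p = p and q = q] abelian_group_hom.hom_closed[OF D_hom] by (simp add: mod_part_Cech)
  then show "abelian_group_hom (K_part p q) (K_part p (q - 1)) (D p q)"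
    by (intro restricted_hom[OF D_hom] abelian_group_K_part) (auto simp: mod_part_Cech)
  fix x assume "x \<in> carrier (K_part p q)"
  then have x: "x \<in> carrier (K p q)" by (simp add: mod_part_Cech)
  show "\<delta> (p + 1) q (\<delta> p q x) = \<zero>\<^bsub>K_part (p + 2) q\<^esub>"
    using cech_module.cech_diff_diff[OF cech_module x] by simp
  show "D p (q - 1) (D p q x) = \<zero>\<^bsub>K_part p (q - 2)\<^esub>"
    using D_D[OF x] by simp
  show "D (p + 1) q (\<delta> p q x) = \<delta> p (q - 1) (D p q x)"
    using cech_linear_map.cech_fun_diff[OF cech_linear_map_d x] by simp
qed (use bounded in blast)

text \<open>
  A homogeneous cocycle \<open>x\<close> is a coboundary \<open>\<delta> w\<close>, and then it is also the coboundary of the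
  component of \<open>w\<close> of degree \<open>\<gamma>\<close>.
\<close>

lemma row_exact_if_not_in_Supp:
  assumes "\<gamma> \<notin> Supp G (local_cohomology G R fs p (C q))"
  shows "dc.row_exact p q"
  unfolding dc.row_exact_def
proof (intro ballI impI)
  interpret M: cech_module R "C q" G fs by (rule cech_module)
  fix x assume "x \<in> carrier (K_part p q)" and \<delta>x: "\<delta> p q x = \<zero>\<^bsub>K_part (p + 1) q\<^esub>"
  then have x: "x \<in> carrier (K p q)" "x \<in> mod_part (K p q) \<gamma>" "proj p q x = x"
    by (simp_all add: mod_part_Cech)
  have "\<zero>\<^bsub>K p q\<^esub> \<in> mod_part (K p q) \<gamma>"
    using abelian_groupE(2)[OF abelian_group_K_part[where p = p and q = q]] by simp
  then obtain w where w: "w \<in> carrier (K (p - 1) q)" "x = \<delta> (p - 1) q w"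
    using assms x \<delta>x by (auto simp: M.Supp_local_cohomology_iff[OF \<gamma>_closed])
  have "\<delta> (p - 1) q (proj (p - 1) q w) = x"
    using proj_\<delta>_from[OF w(1)] w(2) x(3) by simp
  then show "\<exists>w\<in>carrier (K_part (p - 1) q). \<delta> (p - 1) q w = x"
    using proj_in_mod_part[OF w(1)] by auto
qed

end


section \<open>The second page and the homology of the complex\<close>

context cech_double_complex
begin

definition cycles :: "int \<Rightarrow> ('g, 'a, 'b) graded_module" where
  "cycles q = C q\<lparr>carrier := a_kernel (C q) (C (q - 1)) (d q)\<rparr>"

definition boundaries :: "int \<Rightarrow> 'b set" where
  "boundaries q = d (q + 1) ` carrier (C (q + 1))"

abbreviation hclass :: "int \<Rightarrow> 'b \<Rightarrow> 'b set" where
  "hclass q z \<equiv> boundaries q +>\<^bsub>C q\<^esub> z"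

lemma homology_eq: "homology C d q = subquotient (C q) (carrier (cycles q)) (boundaries q)"
  by (simp add: homology_def homology_at_def cycles_def boundaries_def)

lemma cycles_iff: "z \<in> carrier (cycles q) \<longleftrightarrow> z \<in> carrier (C q) \<and> d q z = \<zero>\<^bsub>C (q - 1)\<^esub>"
proof -
  interpret d: linear_map R "C q" "C (q - 1)" "d q" by (rule linear_map_d)
  show ?thesis by (simp add: cycles_def d.a_kernel_iff)
qed

lemma cycles_simps [simp]:
  "\<zero>\<^bsub>cycles q\<^esub> = \<zero>\<^bsub>C q\<^esub>" "x \<oplus>\<^bsub>cycles q\<^esub> y = x \<oplus>\<^bsub>C q\<^esub> y" "r \<odot>\<^bsub>cycles q\<^esub> x = r \<odot>\<^bsub>C q\<^esub> x"
  by (simp_all add: cycles_def)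

lemma submodule_cycles: "submodule (carrier (cycles q)) R (C q)"
  using linear_map.submodule_kernel[OF linear_map_d] by (simp add: cycles_def)

lemma submodule_boundaries: "submodule (boundaries q) R (C q)"
  unfolding boundaries_def by (rule linear_map.submodule_image[OF linear_map_d_from])

lemma d_cycle: "x \<in> carrier (C (q + 1)) \<Longrightarrow> d (q + 1) x \<in> carrier (cycles q)"
  using diff_diff[of x "q + 1"] linear_map.axioms(3)[OF linear_map_d_from, of q]
  by (auto simp: cycles_iff abelian_group_hom.hom_closed algebra_simps)

lemma boundaries_subset: "boundaries q \<subseteq> carrier (cycles q)"
  by (auto simp: boundaries_def d_cycle)

lemma cycles_eq: "C q\<lparr>carrier := carrier (cycles q)\<rparr> = cycles q"
  by (simp add: cycles_def)

lemma module_cycles: "module R (cycles q)"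
  using submodule.submodule_is_module[OF submodule_cycles module_C] by (simp add: cycles_eq)

lemma module_homology: "module R (homology C d q)"
  unfolding homology_eq
  by (rule module_subquotient[OF module_C submodule_cycles submodule_boundaries boundaries_subset])

lemma cech_module_homology: "cech_module R (homology C d q) fs"
  using module_homology cech_module.axioms(2)[OF cech_module] by (rule cech_module.intro)

lemma cech_inclusion: "cech_linear_map R (cycles q) (C q) (\<lambda>z. z) fs"
  by (intro linear_map_cech_linear_map linear_mapI module_cycles module_C) (simp_all add: cycles_iff)

lemma cech_class: "cech_linear_map R (cycles q) (homology C d q) (hclass q) fs"
  using linear_map_subquotient[OF module_C submodule_cycles submodule_boundaries boundaries_subset]
  by (intro linear_map_cech_linear_map) (simp add: homology_eq cycles_eq)

lemma cech_d_cycles: "cech_linear_map R (C (q + 1)) (cycles q) (d (q + 1)) fs"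
proof (intro linear_map_cech_linear_map linear_mapI module_cycles module_C d_cycle)
  interpret d: linear_map R "C (q + 1)" "C q" "d (q + 1)" by (rule linear_map_d_from)
  show "d (q + 1) (x \<oplus>\<^bsub>C (q + 1)\<^esub> y) = d (q + 1) x \<oplus>\<^bsub>cycles q\<^esub> d (q + 1) y"
    if "x \<in> carrier (C (q + 1))" "y \<in> carrier (C (q + 1))" for x y using that by simp
  show "d (q + 1) (r \<odot>\<^bsub>C (q + 1)\<^esub> x) = r \<odot>\<^bsub>cycles q\<^esub> d (q + 1) x"
    if "r \<in> carrier R" "x \<in> carrier (C (q + 1))" for r x using that d.smult by simp
qed

lemma class_eq_zero_iff:
  "z \<in> carrier (C q) \<Longrightarrow> hclass q z = \<zero>\<^bsub>homology C d q\<^esub> \<longleftrightarrow> z \<in> boundaries q"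
  unfolding homology_eq boundaries_def
  using abelian_subgroup.coset_eq_iff[OF abelian_group_hom.image_abelian_subgroup
      [OF linear_map.axioms(3)[OF linear_map_d_from]], of z q]
  by (simp add: subquotient_def)

abbreviation CZ :: "int \<Rightarrow> int \<Rightarrow> ('g, 'a, nat set \<Rightarrow> ('b \<times> nat) set) graded_module" where
  "CZ p q \<equiv> cech_term G R fs (cycles q) p"

abbreviation CH :: "int \<Rightarrow> int \<Rightarrow> ('g, 'a, nat set \<Rightarrow> ('b set \<times> nat) set) graded_module" where
  "CH p q \<equiv> cech_term G R fs (homology C d q) p"

abbreviation incl :: "int \<Rightarrow> int \<Rightarrow> (nat set \<Rightarrow> ('b \<times> nat) set) \<Rightarrow> (nat set \<Rightarrow> ('b \<times> nat) set)" where
  "incl p q \<equiv> cech_functor R fs (C q) (\<lambda>z. z) p"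

abbreviation cls :: "int \<Rightarrow> int \<Rightarrow> (nat set \<Rightarrow> ('b \<times> nat) set) \<Rightarrow> (nat set \<Rightarrow> ('b set \<times> nat) set)" where
  "cls p q \<equiv> cech_functor R fs (homology C d q) (hclass q) p"

lemma D_incl:
  assumes "\<zeta> \<in> carrier (CZ p q)"
  shows "D p q (incl p q \<zeta>) = \<zero>\<^bsub>K p (q - 1)\<^esub>"
proof -
  have "cech_linear_map R (cycles q) (C (q - 1)) (d q) fs"
    using linear_map_compose[OF cech_linear_map.axioms(1)[OF cech_inclusion] linear_map_d]
    by (rule linear_map_cech_linear_map)
  then have "cech_functor R fs (C (q - 1)) (d q) p \<zeta> = \<zero>\<^bsub>K p (q - 1)\<^esub>"
    by (rule cech_fun_zero[OF _ _ assms]) (simp add: cycles_iff)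
  then show ?thesis
    using cech_fun_compose[OF cech_inclusion cech_linear_map_d assms] by simp
qed

text \<open>
  This is exactness of the Cech functor at the middle of \<open>cycles q\<close>, \<open>C q\<close>, \<open>C (q - 1)\<close>.
\<close>

lemma D_cycle_incl:
  assumes "x \<in> carrier (K p q)" "D p q x = \<zero>\<^bsub>K p (q - 1)\<^esub>"
  shows "\<exists>\<zeta>\<in>carrier (CZ p q). incl p q \<zeta> = x"
  using assms by (intro cech_fun_exact[OF cech_inclusion cech_linear_map_d]) (auto simp: cycles_iff)

lemma incl_D_cycles:
  "y \<in> carrier (K p (q + 1)) \<Longrightarrow>
    incl p q (cech_functor R fs (cycles q) (d (q + 1)) p y) = D p (q + 1) y"
  using cech_fun_compose[OF cech_d_cycles cech_inclusion] by simp

text \<open>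
  The sequence \<open>C (q + 1)\<close>, \<open>cycles q\<close>, \<open>homology C d q\<close> is exact and stays so on Cech cochains.
  Cochains with values in the cycles can be compared in \<open>C q\<close>, because the inclusion stays injective.
\<close>

lemma class_zero_iff:
  assumes \<zeta>: "\<zeta> \<in> carrier (CZ p q)"
  shows "cls p q \<zeta> = \<zero>\<^bsub>CH p q\<^esub> \<longleftrightarrow> (\<exists>y\<in>carrier (K p (q + 1)). incl p q \<zeta> = D p (q + 1) y)"
proof
  assume "cls p q \<zeta> = \<zero>\<^bsub>CH p q\<^esub>"
  then have "\<exists>y\<in>carrier (K p (q + 1)). cech_functor R fs (cycles q) (d (q + 1)) p y = \<zeta>"
    using \<zeta> by (intro cech_fun_exact[OF cech_d_cycles cech_class])
      (auto simp: cycles_iff class_eq_zero_iff simp flip: boundaries_def)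
  then show "\<exists>y\<in>carrier (K p (q + 1)). incl p q \<zeta> = D p (q + 1) y"
    using incl_D_cycles by metis
next
  interpret i: cech_linear_map R "cycles q" "C q" "\<lambda>z. z" G fs by (rule cech_inclusion)
  interpret e: cech_linear_map R "C (q + 1)" "cycles q" "d (q + 1)" G fs by (rule cech_d_cycles)
  interpret h: cech_linear_map R "cycles q" "homology C d q" "hclass q" G fs by (rule cech_class)
  interpret i': abelian_group_hom "CZ p q" "K p q" "incl p q" by (rule i.cech_fun_hom)
  assume "\<exists>y\<in>carrier (K p (q + 1)). incl p q \<zeta> = D p (q + 1) y"
  then obtain y where y: "y \<in> carrier (K p (q + 1))" "incl p q \<zeta> = D p (q + 1) y" by blast
  let ?\<eta> = "cech_functor R fs (cycles q) (d (q + 1)) p y"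
  have \<eta>: "?\<eta> \<in> carrier (CZ p q)" using abelian_group_hom.hom_closed[OF e.cech_fun_hom y(1)] .
  have "incl p q (\<zeta> \<ominus>\<^bsub>CZ p q\<^esub> ?\<eta>) = \<zero>\<^bsub>K p q\<^esub>"
    using y \<zeta> \<eta> incl_D_cycles[OF y(1)] i'.hom_closed[OF \<zeta>] i'.hom_minus[OF \<zeta> \<eta>]
    by (simp add: a_minus_def i'.H.r_neg)
  then have "\<zeta> \<ominus>\<^bsub>CZ p q\<^esub> ?\<eta> = \<zero>\<^bsub>CZ p q\<^esub>"
    using \<zeta> \<eta> by (intro i.cech_fun_inj) auto
  then have "\<zeta> = ?\<eta>" using \<zeta> \<eta> i'.G.minus_eq_zero_iff by blast
  moreover have "cls p q ?\<eta> = \<zero>\<^bsub>CH p q\<^esub>"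
  proof -
    have "linear_map R (C (q + 1)) (homology C d q) (\<lambda>x. hclass q (d (q + 1) x))"
      by (rule linear_map_compose[OF e.linear_map_axioms h.linear_map_axioms])
    then have "cech_functor R fs (homology C d q) (\<lambda>x. hclass q (d (q + 1) x)) p y = \<zero>\<^bsub>CH p q\<^esub>"
      using y(1) d_cycle cycles_iff class_eq_zero_iff boundaries_def
      by (intro cech_fun_zero linear_map_cech_linear_map) auto
    then show ?thesis using cech_fun_compose[OF cech_d_cycles cech_class y(1)] by simp
  qed
  ultimately show "cls p q \<zeta> = \<zero>\<^bsub>CH p q\<^esub>" by simp
qed

lemma class_surj:
  assumes "\<eta> \<in> carrier (CH p q)"
  shows "\<exists>\<zeta>\<in>carrier (CZ p q). cls p q \<zeta> = \<eta>"
  using assms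
  by (intro cech_linear_map.cech_fun_surj[OF cech_class])
    (auto simp: homology_eq subquotient_def)

text \<open>
  A homogeneous class is the class of a homogeneous cycle, so a fraction \<open>x / f\<^sup>n\<close> of classes lifts to a
  fraction of the same degree with the same denominator.
\<close>

lemma class_surj_homogeneous:
  assumes \<eta>: "\<eta> \<in> mod_part (CH p q) \<gamma>"
  shows "\<exists>\<zeta>\<in>carrier (CZ p q). cls p q \<zeta> = \<eta> \<and> incl p q \<zeta> \<in> mod_part (K p q) \<gamma>"
proof -
  interpret i: cech_linear_map R "cycles q" "C q" "\<lambda>z. z" G fs by (rule cech_inclusion)
  interpret h: cech_linear_map R "cycles q" "homology C d q" "hclass q" G fs by (rule cech_class)
  have \<eta>S: "\<eta> \<in> (\<Pi>\<^sub>E S\<in>cech_index fs p. mod_part (cech_loc G R fs (homology C d q) S) \<gamma>)"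
    using \<eta> by (simp add: cech_term_def)
  let ?A = "\<lambda>S. {X \<in> carrier (i.M.Loc S). i.loc_fun S X \<in> mod_part (i.N.Loc S) \<gamma>}"
  have "\<exists>\<zeta>\<in>(\<Pi>\<^sub>E S\<in>cech_index fs p. ?A S). cech_map fs p h.loc_fun \<zeta> = \<eta>"
  proof (rule cech_map_surjective)
    show "\<eta> \<in> extensional (cech_index fs p)" using \<eta>S by (auto simp: PiE_iff)
    fix S assume S: "S \<in> cech_index fs p"
    interpret Z: module_at R "cycles q" G "cech_elem R fs S" using S by (rule i.M.module_at)
    have "\<eta> S \<in> mod_part (localization G R (homology C d q) (cech_elem R fs S)) \<gamma>"
      using \<eta>S S by (auto simp: cech_loc_def)
    then obtain x n \<delta> where \<delta>: "\<delta> \<in> carrier G" "cech_elem R fs S [^]\<^bsub>R\<^esub> n \<in> ring_part R \<delta>"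
        "x \<in> mod_part (homology C d q) (\<gamma> \<otimes> \<delta>)" "\<eta> S = loc_frac R (homology C d q) (cech_elem R fs S) x n"
      by (auto simp: localization_def)
    then obtain z where z: "z \<in> carrier (cycles q)" "z \<in> mod_part (C q) (\<gamma> \<otimes> \<delta>)" "x = hclass q z"
      by (auto simp: homology_eq subquotient_def)
    have "h.loc_fun S (Z.frac z n) = \<eta> S"
      using h.loc_fun_frac[OF S z(1)] \<delta>(4) z(3) by simp
    moreover have "i.loc_fun S (Z.frac z n) \<in> mod_part (i.N.Loc S) \<gamma>"
      using i.loc_fun_frac[OF S z(1), of n] \<delta> z(2) by (auto simp: cech_loc_def localization_def)
    moreover have "Z.frac z n \<in> carrier (i.M.Loc S)"
      using Z.frac_closed[OF z(1)] by (simp add: cech_loc_def)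
    ultimately show "\<eta> S \<in> h.loc_fun S ` ?A S" by blast
  qed
  then obtain \<zeta> where \<zeta>: "\<zeta> \<in> (\<Pi>\<^sub>E S\<in>cech_index fs p. ?A S)" "cech_map fs p h.loc_fun \<zeta> = \<eta>"
    by blast
  have "\<zeta> \<in> carrier (CZ p q)" using \<zeta>(1) by (auto simp: i.M.Cech_simps PiE_iff)
  moreover have "cls p q \<zeta> = \<eta>" using \<zeta>(2) by (simp add: cech_functor_def)
  moreover have "incl p q \<zeta> \<in> mod_part (K p q) \<gamma>"
    using \<zeta>(1) by (auto simp: cech_functor_def cech_map_def cech_term_def PiE_iff)
  ultimately show ?thesis by blast
qed

text \<open>
  A cochain \<open>x\<close> with \<open>D x = 0\<close> and \<open>\<delta> x = D y\<close> comes from a cochain of cycles whose class is a Cech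
  cocycle.  This class is the coboundary of a class, which is represented by a cochain of cycles;
  on this \<open>D\<close> vanishes, and its coboundary differs from \<open>x\<close> by a \<open>D\<close>-boundary.
\<close>

lemma E2_zero_if_zero_module:
  assumes "zero_module (local_cohomology G R fs p (homology C d q))"
  shows "dc.E2_zero p q"
  unfolding dc.E2_zero_def
proof (intro ballI impI, elim conjE)
  interpret i: cech_linear_map R "cycles q" "C q" "\<lambda>z. z" G fs by (rule cech_inclusion)
  interpret h: cech_linear_map R "cycles q" "homology C d q" "hclass q" G fs by (rule cech_class)
  interpret i': abelian_group_hom "CZ p q" "K p q" "incl p q" by (rule i.cech_fun_hom)
  interpret h': abelian_group_hom "CZ p q" "CH p q" "cls p q" by (rule h.cech_fun_hom)
  interpret dZ: abelian_group_hom "CZ (p - 1) q" "CZ p q" "cech_diff G R fs (cycles q) (p - 1)"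
    by (rule i.M.cech_diff_from)
  interpret dZ1: abelian_group_hom "CZ p q" "CZ (p + 1) q" "cech_diff G R fs (cycles q) p"
    by (rule i.M.cech_diff_hom)
  interpret pr: abelian_group_hom "K p q" "K p q" "proj p q" by (rule proj_hom)
  fix x y assume "x \<in> carrier (K_part p q)" "y \<in> carrier (K_part (p + 1) (q + 1))"
    and "D p q x = \<zero>\<^bsub>K_part p (q - 1)\<^esub>" and xy: "\<delta> p q x = D (p + 1) (q + 1) y"
  then have x: "x \<in> carrier (K p q)" "proj p q x = x" "D p q x = \<zero>\<^bsub>K p (q - 1)\<^esub>"
    and y: "y \<in> carrier (K (p + 1) (q + 1))"
    by (simp_all add: mod_part_Cech)
  obtain \<zeta> where \<zeta>: "\<zeta> \<in> carrier (CZ p q)" "incl p q \<zeta> = x"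
    using D_cycle_incl[OF x(1,3)] by blast
  have "incl (p + 1) q (cech_diff G R fs (cycles q) p \<zeta>) = D (p + 1) (q + 1) y"
    using i.cech_fun_diff[OF \<zeta>(1)] \<zeta>(2) xy by simp
  then have "cls (p + 1) q (cech_diff G R fs (cycles q) p \<zeta>) = \<zero>\<^bsub>CH (p + 1) q\<^esub>"
    using class_zero_iff[OF dZ1.hom_closed[OF \<zeta>(1)]] y by blast
  then have "cech_diff G R fs (homology C d q) p (cls p q \<zeta>) = \<zero>\<^bsub>CH (p + 1) q\<^esub>"
    using h.cech_fun_diff[OF \<zeta>(1)] by simp
  then have "cls p q \<zeta> \<in> cech_diff G R fs (homology C d q) (p - 1) ` carrier (CH (p - 1) q)"
    using assms h'.hom_closed[OF \<zeta>(1)] by (intro h.N.zero_local_cohomologyD)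
  then obtain \<eta> where \<eta>: "\<eta> \<in> carrier (CH (p - 1) q)"
      "cls p q \<zeta> = cech_diff G R fs (homology C d q) (p - 1) \<eta>" by blast
  obtain \<xi> where \<xi>: "\<xi> \<in> carrier (CZ (p - 1) q)" "cls (p - 1) q \<xi> = \<eta>"
    using class_surj[OF \<eta>(1)] by blast
  let ?\<xi> = "cech_diff G R fs (cycles q) (p - 1) \<xi>"
  have \<xi>': "?\<xi> \<in> carrier (CZ p q)" using \<xi>(1) by simp
  have "cls p q ?\<xi> = cls p q \<zeta>"
    using h.cech_fun_diff[OF \<xi>(1)] \<xi>(2) \<eta>(2) by simp
  then have "cls p q (\<zeta> \<ominus>\<^bsub>CZ p q\<^esub> ?\<xi>) = \<zero>\<^bsub>CH p q\<^esub>"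
    using h'.hom_minus[OF \<zeta>(1) \<xi>'] h'.hom_closed[OF \<zeta>(1)] by (simp add: a_minus_def h'.H.r_neg)
  then obtain w where w: "w \<in> carrier (K p (q + 1))" "incl p q (\<zeta> \<ominus>\<^bsub>CZ p q\<^esub> ?\<xi>) = D p (q + 1) w"
    using class_zero_iff[where \<zeta> = "\<zeta> \<ominus>\<^bsub>CZ p q\<^esub> ?\<xi>" and p = p and q = q] \<zeta>(1) \<xi>' by auto
  let ?z = "incl (p - 1) q \<xi>"
  have z: "?z \<in> carrier (K (p - 1) q)" using abelian_group_hom.hom_closed[OF i.cech_fun_hom \<xi>(1)] .
  have \<delta>z: "\<delta> (p - 1) q ?z = incl p q ?\<xi>" using i.cech_fun_diff[OF \<xi>(1)] by simp
  have "D p (q + 1) w = x \<ominus>\<^bsub>K p q\<^esub> \<delta> (p - 1) q ?z"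
    using w(2) i'.hom_minus[OF \<zeta>(1) \<xi>'] \<zeta>(2) \<delta>z by simp
  then have "D p (q + 1) w \<oplus>\<^bsub>K p q\<^esub> \<delta> (p - 1) q ?z = x"
    using x(1) i'.hom_closed[OF \<xi>'] \<delta>z by (simp add: a_minus_def i'.H.a_assoc i'.H.l_neg)
  \<comment> \<open>The cochains \<open>w\<close> and \<open>z\<close> need not be homogeneous; their components of degree \<open>\<gamma>\<close> serve as well.\<close>
  then have "proj p q x = proj p q (D p (q + 1) w) \<oplus>\<^bsub>K p q\<^esub> proj p q (\<delta> (p - 1) q ?z)"
    using abelian_group_hom.hom_closed[OF D_hom_from w(1)]
      abelian_group_hom.hom_closed[OF \<delta>_hom_from z] pr.hom_add by metis
  then have "x = D p (q + 1) (proj p (q + 1) w) \<oplus>\<^bsub>K p q\<^esub> \<delta> (p - 1) q (proj (p - 1) q ?z)"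
    using x(2) proj_D_from[OF w(1)] proj_\<delta>_from[OF z] by simp
  moreover have "D (p - 1) q (proj (p - 1) q ?z) = \<zero>\<^bsub>K (p - 1) (q - 1)\<^esub>"
    using proj_D[OF z] D_incl[OF \<xi>(1)] abelian_group_hom.hom_zero[OF proj_hom] by simp
  ultimately show "\<exists>w\<in>carrier (K_part p (q + 1)). \<exists>z\<in>carrier (K_part (p - 1) q).
      D (p - 1) q z = \<zero>\<^bsub>K_part (p - 1) (q - 1)\<^esub> \<and> x = D p (q + 1) w \<oplus>\<^bsub>K_part p q\<^esub> \<delta> (p - 1) q z"
    using proj_in_mod_part[OF w(1)] proj_in_mod_part[OF z] by auto
qed

lemma zero_homogeneous: "\<zero>\<^bsub>CH p q\<^esub> \<in> mod_part (CH p q) \<gamma>"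
proof -
  interpret H: cech_module R "homology C d q" G fs by (rule cech_module_homology)
  interpret M: graded_module G R "C q" by (rule graded_module)
  have "\<zero>\<^bsub>H.Loc S\<^esub> \<in> mod_part (H.Loc S) \<gamma>" for S
  proof -
    have "\<zero>\<^bsub>homology C d q\<^esub> = hclass q \<zero>\<^bsub>C q\<^esub>"
      using class_eq_zero_iff[of "\<zero>\<^bsub>C q\<^esub>" q] submodule_boundaries[of q]
        submodule.axioms(1)[THEN subgroup.one_closed] by fastforce
    moreover have "\<zero>\<^bsub>C q\<^esub> \<in> mod_part (C q) (\<gamma> \<otimes> \<one>)" using \<gamma>_closed M.mod_grading.P_zero by simp
    moreover have "\<zero>\<^bsub>C q\<^esub> \<in> carrier (cycles q)"
      using module.module_incl_imp_submodule[OF module_C] abelian_groupE(2)[OF module.axioms(2)[OF module_cycles, of q]]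
      by simp
    ultimately have "\<zero>\<^bsub>homology C d q\<^esub> \<in> mod_part (homology C d q) (\<gamma> \<otimes> \<one>)"
      by (auto simp: homology_eq subquotient_def)
    moreover have "cech_elem R fs S [^]\<^bsub>R\<^esub> (0::nat) \<in> ring_part R \<one>"
      using one_homogeneous by simp
    ultimately show ?thesis
      using G.one_closed unfolding cech_loc_def localization_def graded_module.simps module.simps ring.simps
      by (intro CollectI exI[of _ "\<zero>\<^bsub>homology C d q\<^esub>"] exI[of _ "0::nat"] exI[of _ \<one>] conjI refl)
  qed
  then show ?thesis by (auto simp: cech_term_def)
qed

text \<open>
  A homogeneous cocycle \<open>\<eta>\<close> with values in the homology lifts to a homogeneous \<open>x\<close> with \<open>D x = 0\<close>
  and \<open>\<delta> x = D y\<close>.  If \<open>x = D w + \<delta> z\<close> with \<open>D z = 0\<close>, then \<open>\<eta>\<close> is the coboundary of the class of \<open>z\<close>.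
\<close>

lemma not_in_Supp_if_E2_zero:
  assumes "dc.E2_zero p q"
  shows "\<gamma> \<notin> Supp G (local_cohomology G R fs p (homology C d q))"
proof -
  interpret i: cech_linear_map R "cycles q" "C q" "\<lambda>z. z" G fs by (rule cech_inclusion)
  interpret h: cech_linear_map R "cycles q" "homology C d q" "hclass q" G fs by (rule cech_class)
  interpret i': abelian_group_hom "CZ p q" "K p q" "incl p q" by (rule i.cech_fun_hom)
  interpret h': abelian_group_hom "CZ p q" "CH p q" "cls p q" by (rule h.cech_fun_hom)
  interpret dZ: abelian_group_hom "CZ (p - 1) q" "CZ p q" "cech_diff G R fs (cycles q) (p - 1)"
    by (rule i.M.cech_diff_from)
  interpret dZ1: abelian_group_hom "CZ p q" "CZ (p + 1) q" "cech_diff G R fs (cycles q) p"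
    by (rule i.M.cech_diff_hom)
  have "\<eta> \<in> cech_diff G R fs (homology C d q) (p - 1) ` carrier (CH (p - 1) q)"
    if \<eta>: "\<eta> \<in> mod_part (CH p q) \<gamma>" "cech_diff G R fs (homology C d q) p \<eta> = \<zero>\<^bsub>CH (p + 1) q\<^esub>" for \<eta>
  proof -
    obtain \<zeta> where \<zeta>: "\<zeta> \<in> carrier (CZ p q)" "cls p q \<zeta> = \<eta>" and
        x: "incl p q \<zeta> \<in> mod_part (K p q) \<gamma>"
      using class_surj_homogeneous[OF \<eta>(1)] by blast
    let ?x = "incl p q \<zeta>"
    have "cls (p + 1) q (cech_diff G R fs (cycles q) p \<zeta>) = \<zero>\<^bsub>CH (p + 1) q\<^esub>"
      using h.cech_fun_diff[OF \<zeta>(1)] \<zeta>(2) \<eta>(2) by simp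
    then obtain y where y: "y \<in> carrier (K (p + 1) (q + 1))"
        "incl (p + 1) q (cech_diff G R fs (cycles q) p \<zeta>) = D (p + 1) (q + 1) y"
      using class_zero_iff[OF dZ1.hom_closed[OF \<zeta>(1)]] by blast
    \<comment> \<open>The cochain \<open>y\<close> need not be homogeneous, but its component of degree \<open>\<gamma>\<close> serves as well.\<close>
    have "proj (p + 1) q (\<delta> p q ?x) = \<delta> p q ?x"
      using proj_\<delta>[of ?x q p] x by (simp add: mod_part_Cech)
    then have "\<delta> p q ?x = D (p + 1) (q + 1) (proj (p + 1) (q + 1) y)"
      using y i.cech_fun_diff[OF \<zeta>(1)] proj_D_from[OF y(1)] by simp
    moreover have "?x \<in> carrier (K_part p q)"
        "proj (p + 1) (q + 1) y \<in> carrier (K_part (p + 1) (q + 1))"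
        "D p q ?x = \<zero>\<^bsub>K_part p (q - 1)\<^esub>"
      using x proj_in_mod_part[OF y(1)] D_incl[OF \<zeta>(1)] by simp_all
    ultimately obtain w z where "w \<in> carrier (K_part p (q + 1))" "z \<in> carrier (K_part (p - 1) q)"
        and "D (p - 1) q z = \<zero>\<^bsub>K_part (p - 1) (q - 1)\<^esub>"
        and "?x = D p (q + 1) w \<oplus>\<^bsub>K_part p q\<^esub> \<delta> (p - 1) q z"
      using assms unfolding dc.E2_zero_def by blast
    then have w: "w \<in> carrier (K p (q + 1))"
      and z: "z \<in> carrier (K (p - 1) q)" "D (p - 1) q z = \<zero>\<^bsub>K (p - 1) (q - 1)\<^esub>"
      and xwz: "?x = D p (q + 1) w \<oplus>\<^bsub>K p q\<^esub> \<delta> (p - 1) q z"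
      by (simp_all add: mod_part_Cech)
    obtain \<xi> where \<xi>: "\<xi> \<in> carrier (CZ (p - 1) q)" "incl (p - 1) q \<xi> = z"
      using D_cycle_incl[OF z] by blast
    let ?\<xi> = "cech_diff G R fs (cycles q) (p - 1) \<xi>"
    have \<xi>': "?\<xi> \<in> carrier (CZ p q)" using \<xi>(1) by simp
    have \<delta>z: "\<delta> (p - 1) q z = incl p q ?\<xi>" using i.cech_fun_diff[OF \<xi>(1)] \<xi>(2) by simp
    have "incl p q (\<zeta> \<ominus>\<^bsub>CZ p q\<^esub> ?\<xi>) = ?x \<ominus>\<^bsub>K p q\<^esub> \<delta> (p - 1) q z"
      using i'.hom_minus[OF \<zeta>(1) \<xi>'] \<delta>z by simp
    also have "\<dots> = D p (q + 1) w"
      unfolding xwz \<delta>z using abelian_group_hom.hom_closed[OF D_hom_from w] i'.hom_closed[OF \<xi>']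
      by (simp add: a_minus_def i'.H.a_assoc i'.H.r_neg)
    finally have "cls p q (\<zeta> \<ominus>\<^bsub>CZ p q\<^esub> ?\<xi>) = \<zero>\<^bsub>CH p q\<^esub>"
      using class_zero_iff[where \<zeta> = "\<zeta> \<ominus>\<^bsub>CZ p q\<^esub> ?\<xi>" and p = p and q = q] \<zeta>(1) \<xi>' w by auto
    then have "\<eta> = cls p q ?\<xi>"
      using h'.hom_minus[OF \<zeta>(1) \<xi>'] h'.hom_closed[OF \<zeta>(1)] h'.hom_closed[OF \<xi>'] \<zeta>(2)
        h'.H.minus_eq_zero_iff[OF h'.hom_closed[OF \<zeta>(1)] h'.hom_closed[OF \<xi>']] by simp
    also have "\<dots> = cech_diff G R fs (homology C d q) (p - 1) (cls (p - 1) q \<xi>)"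
      using h.cech_fun_diff[OF \<xi>(1)] by simp
    finally show ?thesis
      using abelian_group_hom.hom_closed[OF h.cech_fun_hom \<xi>(1)] by blast
  qed
  then show ?thesis
    using h.N.Supp_local_cohomology_iff[OF \<gamma>_closed zero_homogeneous] by blast
qed

end

theorem theorem3p4:
  fixes G :: "('g, 'u) monoid_scheme"
    and R :: "('g, 'a, 'v) graded_ring_scheme"
    and B :: "'a set"
    and fs :: "'a list"
    and C :: "int \<Rightarrow> ('g, 'a, 'b) graded_module"
    and d :: "int \<Rightarrow> 'b \<Rightarrow> 'b"
    and i j :: int
  assumes "comm_group G" and "finitely_generated_group G"
    and "graded_ring G R"
    and "homogeneous_generators G R B fs"
    and "graded_complex G R C d"
    and "\<not> zero_module (local_cohomology G R fs i (homology C d j)) \<Longrightarrow>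
      \<forall>l::int. l \<ge> 1 \<longrightarrow>
        zero_module (local_cohomology G R fs (i + l + 1) (homology C d (j + l))) \<and>
        zero_module (local_cohomology G R fs (i - l - 1) (homology C d (j - l)))"
  shows "Supp G (local_cohomology G R fs i (homology C d j)) \<subseteq>
    (\<Union>k::int. Supp G (local_cohomology G R fs (i + k) (C (j + k))))"
proof (rule subsetI, rule ccontr)
  fix \<gamma> assume \<gamma>: "\<gamma> \<in> Supp G (local_cohomology G R fs i (homology C d j))"
    and not_in: "\<gamma> \<notin> (\<Union>k::int. Supp G (local_cohomology G R fs (i + k) (C (j + k))))"
  have "\<exists>\<delta>. \<delta> \<in> carrier G \<and> fs ! k \<in> ring_part R \<delta>" if "k < length fs" for k
    using assms(4) nth_mem[OF that] unfolding homogeneous_generators_def by blast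
  then obtain deg where deg: "\<And>k. k < length fs \<Longrightarrow> deg k \<in> carrier G \<and> fs ! k \<in> ring_part R (deg k)"
    by metis
  interpret cech_double_complex G R C d fs deg \<gamma>
    using assms(5) deg \<gamma> by (simp add: cech_double_complex_def cech_double_complex_axioms_def Supp_def)
  have rows: "dc.row_exact (i + k) (j + k)" for k
    using not_in by (intro row_exact_if_not_in_Supp) auto
  have "dc.E2_zero i j"
  proof (cases "zero_module (local_cohomology G R fs i (homology C d j))")
    case True
    then show ?thesis by (rule E2_zero_if_zero_module)
  next
    case False
    show ?thesis
    proof (rule dc.E2_zero_if_isolated[OF rows])
      fix l :: int assume "l \<ge> 1"
      then show "dc.E2_zero (i + l + 1) (j + l)" "dc.E2_zero (i - l - 1) (j - l)"
        using assms(6)[OF False] by (blast intro: E2_zero_if_zero_module)+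
    qed
  qed
  then show False using not_in_Supp_if_E2_zero \<gamma> by blast
qed

end
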